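(* Let $(\Omega,\mathcal B)$ be a standard Borel space endowed with a nonatomic probability measure $\mathbb P$, let $\mathsf X$ be a separable and reflexive Banach space, $p\in(1,\infty)$, and $\mathcal X:=L^p(\Omega,\mathcal B,\mathbb P;\mathsf X)$. If $A\subset\mathcal X\times\mathcal X^*$ is a nonempty monotone operator invariant by measure-preserving isomorphisms, then there exists a maximal monotone extension of $A$ which is invariant by measure-preserving isomorphisms (and therefore also law invariant), whose domain is contained in $\overline{\mathrm{co}}(\mathrm D(A))$.
   Context: $\mathcal X^*$ is identified with $L^{p^*}(\Omega,\mathcal B,\mathbb P;\mathsf X^* )$, $\frac1p+\frac1{p^*}=1$, with pairing $\langle V,X\rangle=\int_\Omega\langle V(\omega),X(\omega)\rangle\,d\mathbb P(\omega)$. $A\subset\mathcal X\times\mathcal X^*$ is monotone if $\langle V-W,X-Y\rangle\ge0$ for all $(X,V),(Y,W)\in A$; maximal monotone if it is monotone and every monotone subset of $\mathcal X\times\mathcal X^*$ containing it coincides with it. $\mathrm D(A)$ is the projection of $A$ on $\mathcal X$; $\overline{\mathrm{co}}$ denotes closed convex hull. $\mathrm S(\Omega)$ is the class of $\mathcal B$-$\mathcal B$-measurable maps $g:\Omega\to\Omega$ that are essentially injective (injective on some $\Omega_0\in\mathcal B$ with $\mathbb P(\Omega_0)=1$) and measure-preserving ($g_\sharp\mathbb P=\mathbb P$). $A$ is invariant by measure-preserving isomorphisms if $(X,V)\in A$, $g\in\mathrm S(\Omega)$ imply $(X\circ g,V\circ g)\in A$. $A$ is law invariant if $(X,V)\in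 A$, $(X',V')\in\mathcal X\times\mathcal X^*$ and $(X,V)_\sharp\mathbb P=(X',V')_\sharp\mathbb P$ imply $(X',V')\in A$. *)

theory Defs
  imports "HOL-Probability.Probability"
begin

section \<open>The underlying probability space\<close>

definition standard_borel :: "'w measure \<Rightarrow> bool" where
  "standard_borel M \<longleftrightarrow>
     (\<exists>T. topspace T = space M \<and> completely_metrizable_space T \<and> separable_space T \<and>
          sets M = sigma_sets (space M) {U. openin T U})"

definition nonatomic :: "'w measure \<Rightarrow> bool" where
  "nonatomic M \<longleftrightarrow>
     (\<forall>E\<in>sets M. 0 < emeasure M E \<longrightarrow>
        (\<exists>F\<in>sets M. F \<subseteq> E \<and> 0 < emeasure M F \<and> emeasure M F < emeasure M E))"

definition mp_maps :: "'w measure \<Rightarrow> ('w \<Rightarrow> 'w) set" where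
  "mp_maps M =
     {g \<in> measurable M M.
        (\<exists>S\<in>sets M. emeasure M S = 1 \<and> inj_on g S) \<and> distr M M g = M}"

section \<open>Reflexive spaces\<close>

text \<open>The canonical embedding into the bidual is onto. The type \<open>'a \<Rightarrow>\<^sub>L real\<close> is the normed dual.\<close>

definition reflexive_space :: "'a::real_normed_vector itself \<Rightarrow> bool" where
  "reflexive_space _ \<longleftrightarrow>
     (\<forall>\<Phi> :: ('a \<Rightarrow>\<^sub>L real) \<Rightarrow>\<^sub>L real. \<exists>x::'a. \<forall>f. blinfun_apply \<Phi> f = blinfun_apply f x)"

section \<open>Lebesgue--Bochner spaces\<close>

text \<open>
  Elements of \<open>Lp M p\<close> are classes of almost everywhere equal functions. Measurability is Borel
  measurability, which agrees with strong measurability when the target is separable. In the theorem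
  the targets are a separable reflexive space and its dual, which is then separable as well (but
  has no \<open>second_countable_topology\<close> instance).

  Operations on classes are computed on a chosen representative \<open>Lp_rep X\<close>. The choice is
  immaterial, see the lemmas at the end of the theory (for linear combinations of classes it
  follows from \<open>Lp_class_eqI\<close>).
\<close>

definition Lp_fun :: "'w measure \<Rightarrow> real \<Rightarrow> ('w \<Rightarrow> 'b::real_normed_vector) set" where
  "Lp_fun M p = {f \<in> borel_measurable M. integrable M (\<lambda>\<omega>. norm (f \<omega>) powr p)}"

definition Lp_eq ::
    "'w measure \<Rightarrow> real \<Rightarrow> (('w \<Rightarrow> 'b::real_normed_vector) \<times> ('w \<Rightarrow> 'b)) set" where
  "Lp_eq M p = {(f, g). f \<in> Lp_fun M p \<and> g \<in> Lp_fun M p \<and> (AE \<omega> in M. f \<omega> = g \<omega>)}"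

definition Lp :: "'w measure \<Rightarrow> real \<Rightarrow> ('w \<Rightarrow> 'b::real_normed_vector) set set" where
  "Lp M p = Lp_fun M p // Lp_eq M p"

definition Lp_class ::
    "'w measure \<Rightarrow> real \<Rightarrow> ('w \<Rightarrow> 'b::real_normed_vector) \<Rightarrow> ('w \<Rightarrow> 'b) set" where
  "Lp_class M p f = Lp_eq M p `` {f}"

definition Lp_rep :: "('w \<Rightarrow> 'b::real_normed_vector) set \<Rightarrow> 'w \<Rightarrow> 'b" where
  "Lp_rep X = (SOME f. f \<in> X)"

definition Lp_lincomb ::
    "'w measure \<Rightarrow> real \<Rightarrow> real \<Rightarrow> ('w \<Rightarrow> 'b::real_normed_vector) set \<Rightarrow> real \<Rightarrow> ('w \<Rightarrow> 'b) set
       \<Rightarrow> ('w \<Rightarrow> 'b) set" where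
  "Lp_lincomb M p a X b Y = Lp_class M p (\<lambda>\<omega>. a *\<^sub>R Lp_rep X \<omega> + b *\<^sub>R Lp_rep Y \<omega>)"

definition Lp_diff ::
    "'w measure \<Rightarrow> real \<Rightarrow> ('w \<Rightarrow> 'b::real_normed_vector) set \<Rightarrow> ('w \<Rightarrow> 'b) set \<Rightarrow> ('w \<Rightarrow> 'b) set" where
  "Lp_diff M p X Y = Lp_class M p (\<lambda>\<omega>. Lp_rep X \<omega> - Lp_rep Y \<omega>)"

definition Lp_norm :: "'w measure \<Rightarrow> real \<Rightarrow> ('w \<Rightarrow> 'b::real_normed_vector) set \<Rightarrow> real" where
  "Lp_norm M p X = (\<integral>\<omega>. norm (Lp_rep X \<omega>) powr p \<partial>M) powr (1 / p)"

definition Lp_comp ::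
    "'w measure \<Rightarrow> real \<Rightarrow> ('w \<Rightarrow> 'b::real_normed_vector) set \<Rightarrow> ('w \<Rightarrow> 'w) \<Rightarrow> ('w \<Rightarrow> 'b) set" where
  "Lp_comp M p X g = Lp_class M p (Lp_rep X \<circ> g)"

definition Lp_pairing ::
    "'w measure \<Rightarrow> ('w \<Rightarrow> 'a::real_normed_vector \<Rightarrow>\<^sub>L real) set \<Rightarrow> ('w \<Rightarrow> 'a) set \<Rightarrow> real" where
  "Lp_pairing M V X = (\<integral>\<omega>. blinfun_apply (Lp_rep V \<omega>) (Lp_rep X \<omega>) \<partial>M)"

definition joint_law ::
    "'w measure \<Rightarrow> ('w \<Rightarrow> 'a::real_normed_vector) set \<Rightarrow> ('w \<Rightarrow> 'b::real_normed_vector) set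
       \<Rightarrow> ('a \<times> 'b) measure" where
  "joint_law M X V = distr M (borel \<Otimes>\<^sub>M borel) (\<lambda>\<omega>. (Lp_rep X \<omega>, Lp_rep V \<omega>))"

section \<open>Closed convex hulls in the Lebesgue--Bochner spaces\<close>

definition Lp_convex ::
    "'w measure \<Rightarrow> real \<Rightarrow> ('w \<Rightarrow> 'b::real_normed_vector) set set \<Rightarrow> bool" where
  "Lp_convex M p C \<longleftrightarrow>
     (\<forall>X\<in>C. \<forall>Y\<in>C. \<forall>u\<ge>0. \<forall>v\<ge>0. u + v = 1 \<longrightarrow> Lp_lincomb M p u X v Y \<in> C)"

definition Lp_closed ::
    "'w measure \<Rightarrow> real \<Rightarrow> ('w \<Rightarrow> 'b::real_normed_vector) set set \<Rightarrow> bool" where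
  "Lp_closed M p C \<longleftrightarrow>
     (\<forall>Y X. (\<forall>n::nat. Y n \<in> C) \<and> X \<in> Lp M p \<and>
        (\<lambda>n. Lp_norm M p (Lp_diff M p (Y n) X)) \<longlonglongrightarrow> 0 \<longrightarrow> X \<in> C)"

definition Lp_closed_convex_hull ::
    "'w measure \<Rightarrow> real \<Rightarrow> ('w \<Rightarrow> 'b::real_normed_vector) set set \<Rightarrow> ('w \<Rightarrow> 'b) set set" where
  "Lp_closed_convex_hull M p D =
     (\<lambda>C. C \<subseteq> Lp M p \<and> Lp_convex M p C \<and> Lp_closed M p C) hull D"

section \<open>Monotone operators\<close>

text \<open>
  An operator is a set of pairs \<open>(X, V)\<close> with \<open>X \<in> Lp M p\<close> and \<open>V \<in> Lp M q\<close>, where \<open>q\<close> is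
  the exponent conjugate to \<open>p\<close>; \<open>Lp M q\<close> with values in \<open>'a \<Rightarrow>\<^sub>L real\<close> plays the role of the dual
  of \<open>Lp M p\<close> with values in \<open>'a\<close>.
\<close>

type_synonym ('w, 'a) Lp_operator =
  "(('w \<Rightarrow> 'a) set \<times> ('w \<Rightarrow> 'a \<Rightarrow>\<^sub>L real) set) set"

definition monotone_op ::
    "'w measure \<Rightarrow> real \<Rightarrow> real \<Rightarrow> ('w, 'a::real_normed_vector) Lp_operator \<Rightarrow> bool" where
  "monotone_op M p q A \<longleftrightarrow>
     A \<subseteq> Lp M p \<times> Lp M q \<and>
     (\<forall>(X, V)\<in>A. \<forall>(Y, W)\<in>A. 0 \<le> Lp_pairing M (Lp_diff M q V W) (Lp_diff M p X Y))"

definition maximal_monotone_op ::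
    "'w measure \<Rightarrow> real \<Rightarrow> real \<Rightarrow> ('w, 'a::real_normed_vector) Lp_operator \<Rightarrow> bool" where
  "maximal_monotone_op M p q A \<longleftrightarrow>
     monotone_op M p q A \<and> (\<forall>B. monotone_op M p q B \<and> A \<subseteq> B \<longrightarrow> B = A)"

definition mp_invariant ::
    "'w measure \<Rightarrow> real \<Rightarrow> real \<Rightarrow> ('w, 'a::real_normed_vector) Lp_operator \<Rightarrow> bool" where
  "mp_invariant M p q A \<longleftrightarrow>
     (\<forall>(X, V)\<in>A. \<forall>g\<in>mp_maps M. (Lp_comp M p X g, Lp_comp M q V g) \<in> A)"

definition law_invariant ::
    "'w measure \<Rightarrow> real \<Rightarrow> real \<Rightarrow> ('w, 'a::real_normed_vector) Lp_operator \<Rightarrow> bool" where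
  "law_invariant M p q A \<longleftrightarrow>
     (\<forall>(X, V)\<in>A. \<forall>X'\<in>Lp M p. \<forall>V'\<in>Lp M q.
        joint_law M X V = joint_law M X' V' \<longrightarrow> (X', V') \<in> A)"

section \<open>Independence of representatives\<close>

lemma equiv_Lp_eq: "equiv (Lp_fun M p) (Lp_eq M p)"
proof (rule equivI)
  show "Lp_eq M p \<subseteq> Lp_fun M p \<times> Lp_fun M p" by (auto simp: Lp_eq_def)
  show "refl_on (Lp_fun M p) (Lp_eq M p)" by (auto simp: refl_on_def Lp_eq_def)
  show "sym (Lp_eq M p)"
    by (auto simp: sym_def Lp_eq_def elim: eventually_mono)
  show "trans (Lp_eq M p)"
  proof (rule transI)
    fix f g h assume "(f, g) \<in> Lp_eq M p" "(g, h) \<in> Lp_eq M p"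
    moreover from this have "AE \<omega> in M. f \<omega> = g \<omega>" "AE \<omega> in M. g \<omega> = h \<omega>"
      by (auto simp: Lp_eq_def)
    then have "AE \<omega> in M. f \<omega> = h \<omega>" by eventually_elim simp
    ultimately show "(f, h) \<in> Lp_eq M p" by (auto simp: Lp_eq_def)
  qed
qed

lemma Lp_rep_AE:
  assumes "X \<in> Lp M p" "f \<in> X"
  shows "f \<in> Lp_fun M p" "Lp_rep X \<in> Lp_fun M p" "AE \<omega> in M. Lp_rep X \<omega> = f \<omega>"
proof -
  have "Lp_rep X \<in> X" unfolding Lp_rep_def using someI[of "\<lambda>f. f \<in> X" f] assms(2) by simp
  then have "(Lp_rep X, f) \<in> Lp_eq M p"
    using assms quotient_eq_iff[OF equiv_Lp_eq, of X M p X "Lp_rep X" f] by (auto simp: Lp_def)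
  then show "f \<in> Lp_fun M p" "Lp_rep X \<in> Lp_fun M p" "AE \<omega> in M. Lp_rep X \<omega> = f \<omega>"
    by (auto simp: Lp_eq_def)
qed

lemma Lp_class_eqI:
  assumes "f \<in> borel_measurable M" "g \<in> borel_measurable M" "AE \<omega> in M. f \<omega> = g \<omega>"
  shows "Lp_class M p f = Lp_class M p g"
proof -
  have "integrable M (\<lambda>\<omega>. norm (f \<omega>) powr p) = integrable M (\<lambda>\<omega>. norm (g \<omega>) powr p)"
    using assms by (intro integrable_cong_AE) auto
  then have "f \<in> Lp_fun M p \<longleftrightarrow> g \<in> Lp_fun M p" using assms by (simp add: Lp_fun_def)
  moreover have "(AE \<omega> in M. f \<omega> = h \<omega>) \<longleftrightarrow> (AE \<omega> in M. g \<omega> = h \<omega>)" for h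
  proof
    assume "AE \<omega> in M. f \<omega> = h \<omega>"
    with assms(3) show "AE \<omega> in M. g \<omega> = h \<omega>" by eventually_elim simp
  next
    assume "AE \<omega> in M. g \<omega> = h \<omega>"
    with assms(3) show "AE \<omega> in M. f \<omega> = h \<omega>" by eventually_elim simp
  qed
  ultimately show ?thesis by (auto simp: Lp_class_def Lp_eq_def)
qed

lemma Lp_norm_eq:
  assumes "X \<in> Lp M p" "f \<in> X"
  shows "Lp_norm M p X = (\<integral>\<omega>. norm (f \<omega>) powr p \<partial>M) powr (1 / p)"
proof -
  have "(\<integral>\<omega>. norm (Lp_rep X \<omega>) powr p \<partial>M) = (\<integral>\<omega>. norm (f \<omega>) powr p \<partial>M)"
    using Lp_rep_AE[OF assms] by (intro integral_cong_AE) (auto simp: Lp_fun_def)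
  then show ?thesis by (simp add: Lp_norm_def)
qed

lemma Lp_comp_eq:
  assumes X: "X \<in> Lp M p" "f \<in> X" and g: "g \<in> mp_maps M"
  shows "Lp_comp M p X g = Lp_class M p (f \<circ> g)"
proof -
  have [measurable]: "g \<in> measurable M M" and d: "distr M M g = M"
    using g by (auto simp: mp_maps_def)
  have [measurable]: "f \<in> borel_measurable M" "Lp_rep X \<in> borel_measurable M"
    using Lp_rep_AE[OF X] by (auto simp: Lp_fun_def)
  have "AE \<omega> in distr M M g. Lp_rep X \<omega> = f \<omega>" unfolding d by (rule Lp_rep_AE(3)[OF X])
  then have "AE \<omega> in M. Lp_rep X (g \<omega>) = f (g \<omega>)" by (rule AE_distrD[rotated]) measurable
  then show ?thesis unfolding Lp_comp_def by (intro Lp_class_eqI) (auto simp: comp_def)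
qed

lemma joint_law_eq:
  assumes "X \<in> Lp M p" "f \<in> X" "V \<in> Lp M q" "h \<in> V"
  shows "joint_law M X V = distr M (borel \<Otimes>\<^sub>M borel) (\<lambda>\<omega>. (f \<omega>, h \<omega>))"
proof -
  note * = Lp_rep_AE[OF assms(1,2)] Lp_rep_AE[OF assms(3,4)]
  have [measurable]: "f \<in> borel_measurable M" "Lp_rep X \<in> borel_measurable M"
    "h \<in> borel_measurable M" "Lp_rep V \<in> borel_measurable M"
    using * by (auto simp: Lp_fun_def)
  have "AE \<omega> in M. (Lp_rep X \<omega>, Lp_rep V \<omega>) = (f \<omega>, h \<omega>)"
    using *(3,6) by eventually_elim simp
  then show ?thesis unfolding joint_law_def by (intro distr_cong_AE) auto
qed

lemma Lp_pairing_eq: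
  fixes X :: "('w \<Rightarrow> 'a::{banach, second_countable_topology}) set"
  assumes "X \<in> Lp M p" "f \<in> X" "V \<in> Lp M q" "h \<in> V"
  shows "Lp_pairing M V X = (\<integral>\<omega>. blinfun_apply (h \<omega>) (f \<omega>) \<partial>M)"
proof -
  note * = Lp_rep_AE[OF assms(1,2)] Lp_rep_AE[OF assms(3,4)]
  have meas: "(\<lambda>\<omega>. blinfun_apply (k \<omega>) (l \<omega>)) \<in> borel_measurable M"
    if k: "k \<in> borel_measurable M" and l: "l \<in> borel_measurable M"
    for k :: "'w \<Rightarrow> 'a \<Rightarrow>\<^sub>L real" and l
  proof -
    obtain s where s: "\<And>i. simple_function M (s i)"
        "\<And>\<omega>. \<omega> \<in> space M \<Longrightarrow> (\<lambda>i. s i \<omega>) \<longlonglongrightarrow> l \<omega>"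
      using borel_measurable_implies_sequence_metric[OF l, of 0] by blast
    have "(\<lambda>\<omega>. blinfun_apply (k \<omega>) (s i \<omega>)) \<in> borel_measurable M" for i
    proof (rule measurable_compose_countable'[where I = "s i ` space M" and N = borel])
      show "(\<lambda>\<omega>. blinfun_apply (k \<omega>) x) \<in> borel_measurable M" for x
        by (rule borel_measurable_continuous_on[OF _ k]) (intro continuous_intros)
      show "s i \<in> measurable M (count_space (s i ` space M))"
        using s(1)[of i] measurable_simple_function[OF s(1)[of i]]
        by (auto simp: measurable_def)
      show "countable (s i ` space M)"
        using s(1)[of i] by (simp add: simple_function_def countable_finite)
    qed
    then show ?thesis
      by (rule borel_measurable_LIMSEQ_metric) (auto intro!: tendsto_intros s(2))
  qed
  have "AE \<omega> in M. blinfun_apply (Lp_rep V \<omega>) (Lp_rep X \<omega>) = blinfun_apply (h \<omega>) (f \<omega>)"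
    using *(3,6) by eventually_elim simp
  then show ?thesis unfolding Lp_pairing_def using * 
    by (intro integral_cong_AE meas) (auto simp: Lp_fun_def)
qed

end

theory Submission
  imports Defs "HOL-Library.Function_Algebras"
begin

text \<open>
  Write \<open>z = (X, V)\<close> for a pair of \<open>p\<close>- and \<open>q\<close>-integrable functions, \<open>\<langle>V, X\<rangle>\<close> for the integral of
  the pointwise pairing, \<open>\<beta> z z'\<close> for the symmetric form \<open>\<langle>V, X'\<rangle> + \<langle>V', X\<rangle>\<close>, and
  \<open>\<pi> z = \<beta> z z / 2 = \<langle>V, X\<rangle>\<close>. Monotonicity of a set \<open>A\<close> of pairs says
  \<open>\<pi> z + \<pi> z' \<ge> \<beta> z z'\<close> on \<open>A\<close>. Call \<open>(z, a)\<close> and \<open>(z', a')\<close> compatible if \<open>a + a' \<ge> \<beta> z z'\<close>. For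
  a set of pairwise compatible points, let \<open>h z\<close> be the infimum of the heights \<open>a\<close> over \<open>z\<close>. Then \<open>h\<close>
  dominates its own conjugate for \<open>\<beta>\<close>; if the set is maximal, then it is the epigraph of \<open>h\<close>, which
  equals its conjugate, and the contact set \<open>{z. h z = \<pi> z}\<close> is monotone. The graph of \<open>\<pi>\<close> over \<open>A\<close> is such a set, so Zorn's lemma gives a
  self-conjugate \<open>h\<close> whose contact set \<open>B\<close> contains \<open>A\<close>.

  This survives a symmetry requirement. A point cannot always be added to an invariant operator
  together with its orbit, because the orbit need not be monotone; but a point \<open>(z, a)\<close> can be
  added to an invariant epigraph together with its whole orbit at one common height, once \<open>a\<close> is
  large enough, and a maximal invariant set of compatible points turns out to contain every
  point that is compatible with all its members (\<open>maximal_invariant_clique\<close>). The symmetry used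
  here is equality of joint laws. Two pairs with the same law become arbitrarily close in the
  uniform sense after composing one of them with a measure-preserving essentially injective map
  (\<open>equidistributed_approx_rearrangement\<close>), so invariance under such maps passes to invariance
  under equality of laws in the limit; conversely law invariance contains invariance under such maps.

  That \<open>B\<close> is maximal is Fenchel duality (\<open>contact_set_maximal\<close>). For \<open>z0\<close> monotonically related
  to \<open>B\<close>, the functional \<open>\<Phi> (X, V)\<close>, the integral of \<open>\<bar>X\<bar>\<^sup>p / p + \<bar>V\<bar>\<^sup>q / q\<close>, is self-conjugate and
  dominates \<open>- \<pi>\<close> by Young's inequality. An affine function separating \<open>- \<Phi>\<close> from the translate of
  \<open>h\<close> to \<open>z0\<close> is represented by a point \<open>w\<close>, and comparing the conjugates shows that \<open>z0 + w\<close> lies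
  in \<open>B\<close> with \<open>\<pi> w = - \<Phi> w\<close>. Relatedness forces \<open>\<pi> w \<ge> 0\<close>, so \<open>w\<close> vanishes and \<open>z0\<close> is in \<open>B\<close>.
  The separation is \<open>Hahn_Banach_sandwich\<close>; the representation of affine functions says that the
  two Lebesgue--Bochner spaces are each other's dual, and is derived from the Radon--Nikodym
  theorem (\<open>representation\<close>), using that a separable reflexive space has a separable dual.

  To keep the domain inside the closed convex hull of the domain of \<open>A\<close>, only points over
  this hull are admitted to the epigraph. The conjugate is then automatically infinite elsewhere:
  a functional \<open>v\<close> that separates \<open>X\<close> from the hull gives a direction \<open>(0, v)\<close>; translating the epigraph
  along it costs at most the supremum of \<open>v\<close> over the hull per unit, which is less than the gain
  \<open>\<langle>v, X\<rangle>\<close> in the conjugate at a point over \<open>X\<close>.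
\<close>

section \<open>Coding a standard Borel space by real numbers\<close>

text \<open>Digits 0 and 1 to base three: there are no ambiguous expansions, so a sequence of truth
values can be read off again from its sum.\<close>

definition ternary_sum :: "(nat \<Rightarrow> bool) \<Rightarrow> real" where
  "ternary_sum b = (\<Sum>k. of_bool (b k) * (1/3) ^ Suc k)"

text \<open>The remainder after removing \<open>k\<close> leading digits, rescaled; the next digit is 1 exactly if the
remainder is at least \<open>1/3\<close>.\<close>

primrec ternary_rem :: "nat \<Rightarrow> real \<Rightarrow> real" where
  "ternary_rem 0 t = t"
| "ternary_rem (Suc k) t = 3 * ternary_rem k t - of_bool (ternary_rem k t \<ge> 1/3)"

lemma ternary_summable: "summable (\<lambda>k. of_bool (b k) * (1/3::real) ^ Suc k)"
  by (rule summable_comparison_test[of _ "\<lambda>k. (1/3) ^ Suc k"])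
     (auto intro!: exI[of _ 0] simp: summable_geometric)

lemma ternary_sum_bounds: "0 \<le> ternary_sum b" "ternary_sum b \<le> 1/2"
proof -
  show "0 \<le> ternary_sum b"
    unfolding ternary_sum_def by (intro suminf_nonneg ternary_summable) auto
  have "(\<lambda>k. (1/3::real) * (1/3) ^ k) sums ((1/3) * (1 / (1 - 1/3)))"
    by (intro sums_mult geometric_sums) auto
  then have s: "(\<lambda>k. (1/3::real) ^ Suc k) sums (1/2)" by simp
  have "ternary_sum b \<le> (\<Sum>k. (1/3::real) ^ Suc k)"
    unfolding ternary_sum_def using s by (intro suminf_le ternary_summable) (auto simp: sums_iff)
  then show "ternary_sum b \<le> 1/2" using s by (simp add: sums_iff)
qed

lemma ternary_sum_shift: "ternary_sum b = of_bool (b 0) / 3 + ternary_sum (\<lambda>k. b (Suc k)) / 3"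
proof -
  have "(\<Sum>k. of_bool (b (Suc k)) * (1/3::real) ^ Suc (Suc k)) =
      ternary_sum b - of_bool (b 0) / 3"
    unfolding ternary_sum_def
    using suminf_split_head[OF ternary_summable, of b] by simp
  moreover have "(\<Sum>k. of_bool (b (Suc k)) * (1/3::real) ^ Suc (Suc k)) =
      (\<Sum>k. of_bool (b (Suc k)) * (1/3::real) ^ Suc k * (1/3))"
    by (simp add: mult_ac)
  moreover have "\<dots> = ternary_sum (\<lambda>k. b (Suc k)) / 3"
    unfolding ternary_sum_def by (subst suminf_mult2[OF ternary_summable, symmetric]) simp
  ultimately show ?thesis by linarith
qed

lemma ternary_sum_digit: "1/3 \<le> ternary_sum b \<longleftrightarrow> b 0"
  using ternary_sum_bounds[of "\<lambda>k. b (Suc k)"] by (auto simp: ternary_sum_shift[of b])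

lemma ternary_rem_sum: "ternary_rem k (ternary_sum b) = ternary_sum (\<lambda>j. b (k + j))"
proof (induction k)
  case (Suc k)
  then show ?case
    using ternary_sum_digit[of "\<lambda>j. b (k + j)"] ternary_sum_shift[of "\<lambda>j. b (k + j)"] by simp
qed simp

lemma measurable_ternary_rem [measurable]: "ternary_rem k \<in> borel_measurable borel"
  by (induction k) auto

text \<open>A point is coded by the truth values of \<open>d \<omega> (s j) < 2\<^sup>-\<^sup>n\<close> for a dense sequence \<open>s\<close>. The
decoder picks for every \<open>n\<close> the first \<open>s j\<close> that the code declares to be \<open>2\<^sup>-\<^sup>n\<close>-close and passes
to the limit, which exists by completeness. Such limits can be formed measurably at every real number
whose declared points are consistent, so the decoder is defined on the whole line.\<close>

lemma standard_borel_coding: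
  assumes "standard_borel M" "space M \<noteq> {}"
  obtains \<phi> :: "'w \<Rightarrow> real" and r
  where "\<phi> \<in> borel_measurable M" "r \<in> measurable borel M"
    "\<forall>\<omega>\<in>space M. 0 \<le> \<phi> \<omega> \<and> \<phi> \<omega> \<le> 1/2 \<and> r (\<phi> \<omega>) = \<omega>"
proof -
  obtain T where T: "topspace T = space M" "completely_metrizable_space T" "separable_space T"
      "sets M = sigma_sets (space M) {U. openin T U}"
    using assms(1) by (auto simp: standard_borel_def)
  obtain S d where S: "Metric_space S d" "Metric_space.mcomplete S d" "T = Metric_space.mtopology S d"
    using T(2) by (auto simp: completely_metrizable_space_def)
  interpret Metric_space S d by (rule S)
  have SM: "space M = S" using T(1) S(3) by simp
  obtain C where C: "countable C" "C \<subseteq> S" "T closure_of C = S"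
    using T(3) SM T(1) unfolding separable_space_def by auto
  have "C \<noteq> {}" using C(3) assms(2) SM by auto
  define s where "s = from_nat_into C"
  have sS: "s j \<in> S" for j using C(2) from_nat_into[OF \<open>C \<noteq> {}\<close>] by (auto simp: s_def)
  have dense: "\<exists>j. d x (s j) < e" if "x \<in> S" "0 < e" for x e
  proof -
    have "x \<in> T closure_of C" using C(3) that by simp
    moreover have "x \<in> mball x e" "openin T (mball x e)" using that S(3) by auto
    ultimately obtain y where "y \<in> C" "y \<in> mball x e"
      unfolding in_closure_of by blast
    then show ?thesis using from_nat_into_surj[OF C(1), of y] by (auto simp: s_def)
  qed
  have mball_M: "mball x e \<in> sets M" for x e
    unfolding T(4) by (rule sigma_sets.Basic) (simp add: S(3))
  have open_UN: "U = (\<Union>(j,n)\<in>{(j,n). mball (s j) (1/2^n) \<subseteq> U}. mball (s j) (1/2^n))"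
    if U: "openin T U" for U
  proof
    show "U \<subseteq> (\<Union>(j,n)\<in>{(j,n). mball (s j) (1/2^n) \<subseteq> U}. mball (s j) (1/2^n))"
    proof
      fix x assume x: "x \<in> U"
      have "U \<subseteq> S \<and> (\<forall>x. x \<in> U \<longrightarrow> (\<exists>r>0. mball x r \<subseteq> U))"
        using U unfolding S(3) openin_mtopology .
      with x obtain e where e: "e > 0" "mball x e \<subseteq> U" and xS: "x \<in> S"
        by (metis subsetD)
      obtain n where n: "(1/2::real)^n < e / 2"
        using real_arch_pow_inv[of "e/2" "1/2"] e by auto
      obtain j where j: "d x (s j) < 1/2^n" using dense[OF xS, of "1/2^n"] by auto
      have "mball (s j) (1/2^n) \<subseteq> mball x e"
      proof
        fix y assume "y \<in> mball (s j) (1/2^n)"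
        then have y: "y \<in> S" "d (s j) y < 1/2^n" by auto
        have "d x y \<le> d x (s j) + d (s j) y" using triangle[OF xS sS y(1)] .
        then show "y \<in> mball x e" using y j n xS by (auto simp: power_one_over)
      qed
      then show "x \<in> (\<Union>(j,n)\<in>{(j,n). mball (s j) (1/2^n) \<subseteq> U}. mball (s j) (1/2^n))"
        using e j xS sS commute[of x "s j"] by (intro UN_I[of "(j,n)"]) auto
    qed
  qed auto
  define b where "b \<omega> k = (case prod_decode k of (j, n) \<Rightarrow> d \<omega> (s j) < 1/2^n)" for \<omega> k
  define \<phi> where "\<phi> \<omega> = ternary_sum (b \<omega>)" for \<omega>
  have \<phi>m: "\<phi> \<in> borel_measurable M"
  proof -
    have "{\<omega> \<in> space M. b \<omega> k} \<in> sets M" for k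
    proof -
      obtain j n where "prod_decode k = (j, n)" by force
      then have "{\<omega> \<in> space M. b \<omega> k} = mball (s j) (1/2^n)"
        unfolding SM using sS by (auto simp: b_def commute)
      then show ?thesis using mball_M by simp
    qed
    then have [measurable]: "Measurable.pred M (\<lambda>\<omega>. b \<omega> k)" for k
      by (simp add: pred_def)
    show ?thesis unfolding \<phi>_def ternary_sum_def by measurable
  qed
  \<comment> \<open>decoding: the index of a point of the dense sequence that is \<open>2\<^sup>-\<^sup>n\<close>-close to the coded point\<close>
  define i where "i n t = (LEAST j. ternary_rem (prod_encode (j, n)) t \<ge> 1/3)" for n and t :: real
  have i_m [measurable]: "i n \<in> measurable borel (count_space UNIV)" for n
    unfolding i_def by measurable
  define good where "good t \<longleftrightarrow> (\<forall>n m. d (s (i n t)) (s (i m t)) \<le> (1/2)^n + (1/2)^m)" for t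
  have good_m [measurable]: "Measurable.pred borel good"
    unfolding good_def by measurable
  have ex_lim: "\<exists>x. limitin mtopology (\<lambda>n. s (i n t)) x sequentially" if "good t" for t
  proof -
    have "MCauchy (\<lambda>n. s (i n t))"
      unfolding MCauchy_def
    proof (intro conjI allI impI)
      fix e :: real assume "e > 0"
      then obtain N where N: "(1/2::real)^N < e / 2" using real_arch_pow_inv[of "e/2" "1/2"] by auto
      have "d (s (i n t)) (s (i n' t)) < e" if "N \<le> n" "N \<le> n'" for n n'
      proof -
        have "(1/2::real)^n \<le> (1/2)^N" "(1/2::real)^n' \<le> (1/2)^N"
          using that by (auto intro: power_decreasing)
        then show ?thesis using \<open>good t\<close> N unfolding good_def by (smt (verit) field_sum_of_halves)
      qed
      then show "\<exists>N. \<forall>n n'. N \<le> n \<longrightarrow> N \<le> n' \<longrightarrow> d (s (i n t)) (s (i n' t)) < e" by blast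
    qed (use sS in auto)
    then show ?thesis using S(2) by (auto simp: mcomplete_def)
  qed
  define r where "r t = (if good t then SOME x. limitin mtopology (\<lambda>n. s (i n t)) x sequentially else s 0)" for t
  have r_lim: "limitin mtopology (\<lambda>n. s (i n t)) (r t) sequentially" if "good t" for t
    using someI_ex[OF ex_lim[OF that]] that by (simp add: r_def)
  have rS: "r t \<in> S" for t
    using r_lim[of t] sS by (cases "good t") (auto simp: r_def limitin_metric)
  have dr_m: "(\<lambda>t. d (r t) (s j)) \<in> borel_measurable borel" for j
  proof (rule borel_measurable_LIMSEQ_real)
    show "(\<lambda>t. if good t then d (s (i n t)) (s j) else d (s 0) (s j)) \<in> borel_measurable borel" for n
      by measurable
    fix t :: real
    show "(\<lambda>n. if good t then d (s (i n t)) (s j) else d (s 0) (s j)) \<longlonglongrightarrow> d (r t) (s j)"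
    proof (cases "good t")
      case True
      have "(\<lambda>n. d (s (i n t)) (r t)) \<longlonglongrightarrow> 0"
        using r_lim[OF True] by (simp add: limitin_metric_dist_null)
      moreover have "norm (d (s (i n t)) (s j) - d (r t) (s j)) \<le> d (s (i n t)) (r t)" for n
        using triangle[OF sS[of "i n t"] rS[of t] sS[of j]] triangle[OF rS[of t] sS[of "i n t"] sS[of j]]
          commute[of "r t" "s (i n t)"] by auto
      ultimately have "(\<lambda>n. d (s (i n t)) (s j) - d (r t) (s j)) \<longlonglongrightarrow> 0"
        by (metis (mono_tags, lifting) Lim_null_comparison always_eventually)
      from LIM_zero_cancel[OF this] show ?thesis using True by simp
    qed (simp add: r_def)
  qed
  have rm: "r \<in> measurable borel M"
  proof (rule measurable_sigma_sets[OF T(4)])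
    show "{U. openin T U} \<subseteq> Pow (space M)" using T(1) openin_subset by fastforce
    show "r \<in> space borel \<rightarrow> space M" using rS SM by auto
    fix U assume "U \<in> {U. openin T U}"
    then have U: "U = (\<Union>(j,n)\<in>{(j,n). mball (s j) (1/2^n) \<subseteq> U}. mball (s j) (1/2^n))"
      using open_UN by blast
    have ball: "r -` mball (s j) e \<in> sets borel" for j e
    proof -
      have "r -` mball (s j) e = {t \<in> space borel. d (r t) (s j) < e}"
        using rS sS by (auto simp: commute[of "s j"])
      also have "\<dots> \<in> sets borel" using dr_m[of j] by measurable
      finally show ?thesis .
    qed
    have "r -` U = (\<Union>p\<in>{(j,n). mball (s j) (1/2^n) \<subseteq> U}. r -` mball (s (fst p)) (1/2^snd p))"
      by (subst U) (simp add: vimage_UN case_prod_beta)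
    then show "r -` U \<inter> space borel \<in> sets borel"
      using ball by (auto intro!: sets.countable_UN'')
  qed
  have "0 \<le> \<phi> \<omega> \<and> \<phi> \<omega> \<le> 1/2 \<and> r (\<phi> \<omega>) = \<omega>" if "\<omega> \<in> space M" for \<omega>
  proof -
    have \<omega>: "\<omega> \<in> S" using that SM by simp
    have near: "d \<omega> (s (i n (\<phi> \<omega>))) < (1/2)^n" for n
    proof -
      have bit: "ternary_rem (prod_encode (j, n)) (\<phi> \<omega>) \<ge> 1/3 \<longleftrightarrow> d \<omega> (s j) < 1/2^n" for j
        unfolding \<phi>_def ternary_rem_sum ternary_sum_digit by (simp add: b_def)
      show ?thesis using LeastI_ex[OF dense[OF \<omega>, of "1/2^n"]] 
        unfolding i_def bit by (simp add: power_one_over)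
    qed
    have "d (s (i n (\<phi> \<omega>))) (s (i m (\<phi> \<omega>))) \<le> (1/2)^n + (1/2)^m" for n m
      using triangle[OF sS[of "i n (\<phi> \<omega>)"] \<omega> sS[of "i m (\<phi> \<omega>)"]] near[of n] near[of m]
        commute[of \<omega> "s (i n (\<phi> \<omega>))"] by linarith
    then have "good (\<phi> \<omega>)" by (simp add: good_def)
    from r_lim[OF this] have "limitin mtopology (\<lambda>n. s (i n (\<phi> \<omega>))) (r (\<phi> \<omega>)) sequentially" .
    moreover have "limitin mtopology (\<lambda>n. s (i n (\<phi> \<omega>))) \<omega> sequentially"
      unfolding limitin_metric_dist_null
    proof (intro conjI always_eventually allI \<omega> sS)
      have "(\<lambda>n. (1/2::real)^n) \<longlonglongrightarrow> 0" by (intro LIMSEQ_realpow_zero) auto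
      moreover have "\<forall>n. norm (d (s (i n (\<phi> \<omega>))) \<omega>) \<le> (1/2)^n"
        using near by (auto simp: commute[of _ \<omega>] intro: less_imp_le)
      ultimately show "(\<lambda>n. d (s (i n (\<phi> \<omega>))) \<omega>) \<longlonglongrightarrow> 0"
        by (metis (mono_tags, lifting) Lim_null_comparison always_eventually)
    qed
    ultimately have "r (\<phi> \<omega>) = \<omega>" by (rule limitin_metric_unique) simp
    then show ?thesis using ternary_sum_bounds by (simp add: \<phi>_def)
  qed
  then show ?thesis using that \<phi>m rm by blast
qed

section \<open>Rearrangements of a nonatomic standard Borel space\<close>

context cdf_distribution
begin

definition quantile :: "real \<Rightarrow> real" where
  "quantile t = (if 0 < t \<and> t < 1 then I t else 0)"

lemma quantile_le_iff: "0 < t \<Longrightarrow> t < 1 \<Longrightarrow> quantile t \<le> x \<longleftrightarrow> t \<le> C x"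
  using pseudoinverse[of t x] by (simp add: quantile_def)

lemma measurable_quantile [measurable]: "quantile \<in> borel_measurable borel"
proof -
  have "(\<lambda>t. if t \<in> {0<..<1} then I t else 0) \<in> borel_measurable borel"
    by (rule measurable_restrict_space_iff[THEN iffD1]) (use measurable_CI in auto)
  also have "(\<lambda>t. if t \<in> {0<..<1} then I t else 0) = quantile"
    by (auto simp: quantile_def fun_eq_iff)
  finally show ?thesis .
qed

lemma distr_quantile: "distr (restrict_space lborel {0<..<1::real}) borel quantile = M"
proof -
  have "distr (restrict_space lborel {0<..<1::real}) borel quantile =
      distr (restrict_space lborel {0<..<1::real}) borel I"
    by (rule distr_cong) (auto simp: quantile_def space_restrict_space)
  then show ?thesis using distr_I_eq_M by simp
qed

context
  assumes null_points: "\<And>x. measure M {x} = 0"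
begin

text \<open>In the absence of atoms the distribution function is continuous, so it attains the value \<open>t\<close>.\<close>

lemma cdf_quantile:
  assumes "0 < t" "t < 1" shows "C (quantile t) = t"
proof (rule antisym)
  show "t \<le> C (quantile t)" using quantile_le_iff[OF assms, of "quantile t"] by simp
  have "isCont C (quantile t)" using null_points isCont_cdf by simp
  then have "(C \<longlongrightarrow> C (quantile t)) (at_left (quantile t))"
    by (simp add: isCont_def filterlim_at_split)
  moreover have "C y \<le> t" if "y < quantile t" for y
    using quantile_le_iff[OF assms, of y] that by linarith
  then have "eventually (\<lambda>y. C y \<le> t) (at_left (quantile t))"
    by (auto simp: eventually_at_filter)
  ultimately show "C (quantile t) \<le> t"
    by (intro tendsto_upperbound[of C _ "at_left (quantile t)"]) auto
qed

text \<open>The law is the image of the uniform distribution under the quantile function, and on the range of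
that function the identity follows from \<open>cdf_quantile\<close>. In particular the distribution
function is injective off a null set.\<close>

lemma AE_quantile_cdf: "AE y in M. 0 < C y \<and> C y < 1 \<and> quantile (C y) = y"
proof -
  have "AE y in distr (restrict_space lborel {0<..<1::real}) borel quantile.
      0 < C y \<and> C y < 1 \<and> quantile (C y) = y"
    by (subst AE_distr_iff)
       (auto simp: AE_restrict_space_iff cdf_quantile measurable_restrict_space1)
  then show ?thesis unfolding distr_quantile .
qed

lemma distr_cdf: "distr M borel C = distr (restrict_space lborel {0<..<1::real}) borel (\<lambda>t. t)"
proof -
  have "distr M borel C = distr (distr (restrict_space lborel {0<..<1::real}) borel quantile) borel C"
    by (simp add: distr_quantile)
  also have "\<dots> = distr (restrict_space lborel {0<..<1::real}) borel (C \<circ> quantile)"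
    by (rule distr_distr) (auto intro: measurable_restrict_space1)
  also have "\<dots> = distr (restrict_space lborel {0<..<1::real}) borel (\<lambda>t. t)"
    by (rule distr_cong) (auto simp: space_restrict_space cdf_quantile)
  finally show ?thesis .
qed

end
end

text \<open>A level set of an injective function has at most one point, hence no subset of intermediate measure.\<close>

lemma nonatomic_inj_null:
  fixes f :: "'w \<Rightarrow> real"
  assumes "nonatomic M" and [measurable]: "f \<in> borel_measurable M" and inj: "inj_on f (space M)"
  shows "emeasure M {\<omega> \<in> space M. f \<omega> = y} = 0"
proof (rule ccontr)
  let ?E = "{\<omega> \<in> space M. f \<omega> = y}"
  assume "emeasure M ?E \<noteq> 0"
  then have "0 < emeasure M ?E" by (simp add: zero_less_iff_neq_zero)
  moreover have "?E \<in> sets M" by measurable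
  ultimately obtain F where F: "F \<subseteq> ?E" "0 < emeasure M F" "emeasure M F < emeasure M ?E"
    using bspec[OF assms(1)[unfolded nonatomic_def], of ?E] by blast
  have "F \<noteq> {}" "F \<noteq> ?E" using F(2,3) by auto
  then obtain a b where "a \<in> F" "b \<in> ?E" "b \<notin> F" using F(1) by blast
  then have "a = b" using F(1) inj by (auto dest: inj_onD)
  then show False using \<open>a \<in> F\<close> \<open>b \<notin> F\<close> by simp
qed

text \<open>Adding a code with values in \<open>[0, 1/2]\<close> to the labels \<open>l\<close> and \<open>l'\<close> makes them injective while keeping
the labels readable as integer parts. The increasing rearrangement that carries the law of the
second coded label to that of the first, composed with the decoder, is measure-preserving. It is
essentially injective because quantile and distribution functions are mutually inverse almost
everywhere, and it respects the labels since both distribution functions agree at the thresholds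
\<open>i + 3/4\<close>.\<close>

lemma equidistributed_labels_rearrangement:
  fixes l l' :: "'w \<Rightarrow> nat"
  assumes "prob_space M" "standard_borel M" "nonatomic M"
    and [measurable]: "l \<in> measurable M (count_space UNIV)" "l' \<in> measurable M (count_space UNIV)"
    and law: "distr M (count_space UNIV) l = distr M (count_space UNIV) l'"
  obtains g where "g \<in> mp_maps M" "AE \<omega> in M. l (g \<omega>) = l' \<omega>"
proof -
  interpret prob_space M by fact
  obtain \<phi> :: "'w \<Rightarrow> real" and r where [measurable]: "\<phi> \<in> borel_measurable M" "r \<in> measurable borel M"
    and "\<forall>\<omega>\<in>space M. 0 \<le> \<phi> \<omega> \<and> \<phi> \<omega> \<le> 1/2 \<and> r (\<phi> \<omega>) = \<omega>"
    by (rule standard_borel_coding[OF assms(2) not_empty])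
  then have \<phi>: "\<And>\<omega>. \<omega> \<in> space M \<Longrightarrow> 0 \<le> \<phi> \<omega> \<and> \<phi> \<omega> \<le> 1/2 \<and> r (\<phi> \<omega>) = \<omega>"
    by blast
  define \<rho> where "\<rho> t = r (frac t)" for t
  have "(frac :: real \<Rightarrow> real) \<in> borel_measurable borel"
    unfolding frac_def by measurable
  then have [measurable]: "\<rho> \<in> measurable borel M"
    unfolding \<rho>_def by (rule measurable_compose) measurable
  define code where "code k \<omega> = real (k \<omega>) + \<phi> \<omega>" for k :: "'w \<Rightarrow> nat" and \<omega>
  have \<rho>_code: "\<rho> (code k \<omega>) = \<omega>" if "\<omega> \<in> space M" for k \<omega>
  proof -
    have "frac (code k \<omega>) = \<phi> \<omega>"
      using \<phi>[OF that] unfolding frac_unique_iff code_def by auto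
    then show ?thesis using \<phi>[OF that] by (simp add: \<rho>_def)
  qed
  have code_le: "code k \<omega> \<le> real i + 3/4 \<longleftrightarrow> k \<omega> \<le> i" if "\<omega> \<in> space M" for k i \<omega>
    using \<phi>[OF that] unfolding code_def by linarith
  have code_m [measurable]: "code k \<in> borel_measurable M"
    if "k \<in> measurable M (count_space UNIV)" for k
    using that unfolding code_def by measurable
  have cdf_dist: "cdf_distribution (distr M borel (code k))"
    if [measurable]: "k \<in> measurable M (count_space UNIV)" for k
    unfolding cdf_distribution_def by (intro real_distribution_distr) measurable
  have null: "measure (distr M borel (code k)) {y} = 0"
    if [measurable]: "k \<in> measurable M (count_space UNIV)" for k y
  proof -
    have "inj_on (code k) (space M)" by (rule inj_on_inverseI[of _ \<rho>]) (rule \<rho>_code)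
    from nonatomic_inj_null[OF assms(3) _ this, of y]
    have "emeasure (distr M borel (code k)) {y} = 0"
      by (subst emeasure_distr) (auto simp: vimage_def Int_def conj_commute)
    then show ?thesis by (simp add: measure_def)
  qed
  interpret N: cdf_distribution "distr M borel (code l)" by (rule cdf_dist) measurable
  interpret N': cdf_distribution "distr M borel (code l')" by (rule cdf_dist) measurable
  let ?N = "distr M borel (code l)" and ?N' = "distr M borel (code l')"
  let ?U = "restrict_space lborel {0<..<1::real}"
  define h where "h = N.quantile \<circ> cdf ?N' \<circ> code l'"
  have [measurable]: "h \<in> borel_measurable M"
    unfolding h_def comp_def by measurable
  have law_h: "distr M borel h = ?N"
  proof -
    have "distr M borel h = distr (distr ?N' borel (cdf ?N')) borel N.quantile"
      unfolding h_def by (simp add: distr_distr comp_assoc)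
    also have "\<dots> = distr ?U borel N.quantile"
      unfolding N'.distr_cdf[OF null[OF assms(5)]]
      by (subst distr_distr) (auto intro: measurable_restrict_space1 simp: comp_def)
    finally show ?thesis by (simp add: N.distr_quantile)
  qed
  define g where "g = \<rho> \<circ> h"
  have g_m [measurable]: "g \<in> measurable M M" unfolding g_def comp_def by measurable
  have g_law: "distr M M g = M"
  proof -
    have "distr M M g = distr (distr M borel (code l)) M \<rho>"
      unfolding g_def law_h[symmetric] by (simp add: distr_distr)
    also have "\<dots> = distr M M (\<rho> \<circ> code l)" by (rule distr_distr) measurable
    also have "\<dots> = distr M M (\<lambda>\<omega>. \<omega>)" by (rule distr_cong) (auto simp: \<rho>_code)
    finally show ?thesis by (simp add: distr_id)
  qed
  have ae1: "AE \<omega> in M. code l (\<rho> (h \<omega>)) = h \<omega>"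
  proof -
    have "AE t in distr M borel (code l). code l (\<rho> t) = t"
      by (subst AE_distr_iff) (measurable, auto simp: \<rho>_code)
    then have "AE t in distr M borel h. code l (\<rho> t) = t" unfolding law_h .
    from AE_distrD[OF _ this] show ?thesis by simp
  qed
  have ae2: "AE \<omega> in M. 0 < cdf ?N' (code l' \<omega>) \<and> cdf ?N' (code l' \<omega>) < 1 \<and>
      N'.quantile (cdf ?N' (code l' \<omega>)) = code l' \<omega>"
    using AE_distrD[OF _ N'.AE_quantile_cdf[OF null[OF assms(5)]]] by simp
  define S where "S = {\<omega> \<in> space M. code l (\<rho> (h \<omega>)) = h \<omega> \<and> 0 < cdf ?N' (code l' \<omega>) \<and>
      cdf ?N' (code l' \<omega>) < 1 \<and> N'.quantile (cdf ?N' (code l' \<omega>)) = code l' \<omega>}"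
  have S_M: "S \<in> sets M" unfolding S_def by measurable
  have AE_S: "AE \<omega> in M. \<omega> \<in> S" using ae1 ae2 AE_space unfolding S_def by eventually_elim auto
  have S_1: "emeasure M S = 1" using emeasure_eq_1_AE[OF S_M AE_S] .
  have g_code: "code l (g \<omega>) = N.quantile (cdf ?N' (code l' \<omega>))" if "\<omega> \<in> S" for \<omega>
    using that by (simp add: S_def g_def h_def)
  have inj: "inj_on g S"
  proof (rule inj_on_inverseI)
    fix \<omega> assume \<omega>: "\<omega> \<in> S"
    then have "cdf ?N (code l (g \<omega>)) = cdf ?N' (code l' \<omega>)"
      using N.cdf_quantile[OF null[OF assms(4)]] g_code by (simp add: S_def)
    then show "\<rho> (N'.quantile (cdf ?N (code l (g \<omega>)))) = \<omega>"
      using \<omega> \<rho>_code by (simp add: S_def)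
  qed
  have cdf_eq: "cdf ?N (real i + 3/4) = cdf ?N' (real i + 3/4)" for i
  proof -
    have "cdf (distr M borel (code k)) (real i + 3/4) = measure (distr M (count_space UNIV) k) {..i}"
      if [measurable]: "k \<in> measurable M (count_space UNIV)" for k
    proof -
      have "code k -` {..real i + 3/4} \<inter> space M = k -` {..i} \<inter> space M"
        using code_le by auto
      then show ?thesis by (simp add: cdf_def measure_distr)
    qed
    from this[of l] this[of l'] show ?thesis using law by simp
  qed
  have "l (g \<omega>) = l' \<omega>" if \<omega>: "\<omega> \<in> S" for \<omega>
  proof -
    have sp: "\<omega> \<in> space M" "g \<omega> \<in> space M"
      using \<omega> measurable_space[OF g_m] by (auto simp: S_def)
    have "l (g \<omega>) \<le> i \<longleftrightarrow> l' \<omega> \<le> i" for i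
    proof -
      have "l (g \<omega>) \<le> i \<longleftrightarrow> cdf ?N' (code l' \<omega>) \<le> cdf ?N (real i + 3/4)"
        using code_le[OF sp(2), of l i] g_code[OF \<omega>] \<omega> N.quantile_le_iff by (simp add: S_def)
      also have "\<dots> \<longleftrightarrow> code l' \<omega> \<le> real i + 3/4"
        using N'.quantile_le_iff[of "cdf ?N' (code l' \<omega>)" "real i + 3/4"] \<omega>
        by (simp add: cdf_eq S_def)
      finally show ?thesis using code_le[OF sp(1)] by simp
    qed
    from this[of "l (g \<omega>)"] this[of "l' \<omega>"] show ?thesis by simp
  qed
  then have "AE \<omega> in M. l (g \<omega>) = l' \<omega>" using AE_S by auto
  moreover have "g \<in> mp_maps M" using g_m g_law S_M S_1 inj by (auto simp: mp_maps_def)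
  ultimately show ?thesis using that by blast
qed

section \<open>Measurability in separable normed spaces\<close>

text \<open>The leading zero makes the origin a competitor in every nearest-point approximation \<open>near_idx\<close>,
which bounds the approximants of \<open>x\<close> by \<open>2 * norm x\<close>. An explicit sequence is used because the
dual of a reflexive space is separable without being an instance of the class of second countable
spaces.\<close>

definition dense_seq :: "(nat \<Rightarrow> 'b::real_normed_vector) \<Rightarrow> bool" where
  "dense_seq s \<longleftrightarrow> s 0 = 0 \<and> (\<forall>x. \<forall>e>0. \<exists>n. dist x (s n) < e)"

lemma dense_seq_of_countable:
  fixes D :: "'b::real_normed_vector set"
  assumes "countable D" and D: "\<And>x e. e > 0 \<Longrightarrow> \<exists>y\<in>D. dist x y < e"
  obtains s where "dense_seq s" "\<And>n. s n \<in> insert 0 D"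
proof -
  have "D \<noteq> {}" using D[of 1] by auto
  define s where "s n = (case n of 0 \<Rightarrow> 0 | Suc m \<Rightarrow> from_nat_into D m)" for n
  have s_Suc: "s (Suc m) = from_nat_into D m" for m by (simp add: s_def)
  have "\<exists>n. dist x (s n) < e" if e: "e > 0" for x e
  proof -
    obtain y where y: "y \<in> D" "dist x y < e" using D[OF e] by blast
    then obtain m where "from_nat_into D m = y" using from_nat_into_surj[OF assms(1)] by blast
    with y show ?thesis by (intro exI[of _ "Suc m"]) (simp add: s_Suc)
  qed
  moreover have s0: "s 0 = 0" by (simp add: s_def)
  ultimately have "dense_seq s" by (simp add: dense_seq_def)
  moreover have "s n \<in> insert 0 D" for n
    using from_nat_into[OF \<open>D \<noteq> {}\<close>] by (cases n) (auto simp: s_Suc s0)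
  ultimately show ?thesis by (rule that)
qed

lemma dense_seq_exists: "\<exists>s :: nat \<Rightarrow> 'b::{real_normed_vector, second_countable_topology}. dense_seq s"
proof -
  obtain D :: "'b set" where D: "countable D" "\<And>X. open X \<Longrightarrow> X \<noteq> {} \<Longrightarrow> \<exists>d\<in>D. d \<in> X"
    by (rule countable_dense_setE) blast
  have "\<exists>y\<in>D. dist x y < e" if "e > 0" for x e
    using D(2)[of "ball x e"] that by auto
  from dense_seq_of_countable[OF D(1) this] show ?thesis by blast
qed

definition near_idx :: "(nat \<Rightarrow> 'b::metric_space) \<Rightarrow> nat \<Rightarrow> 'b \<Rightarrow> nat" where
  "near_idx s n x = (LEAST k. k \<le> n \<and> (\<forall>j\<le>n. dist x (s k) \<le> dist x (s j)))"

lemma near_idx: "near_idx s n x \<le> n" "j \<le> n \<Longrightarrow> dist x (s (near_idx s n x)) \<le> dist x (s j)"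
proof -
  have "\<exists>k. k \<le> n \<and> (\<forall>j\<le>n. dist x (s k) \<le> dist x (s j))"
  proof (intro exI conjI allI impI)
    let ?k = "arg_min_on (\<lambda>k. dist x (s k)) {..n}"
    show "?k \<le> n" using arg_min_if_finite(1)[of "{..n}" "\<lambda>k. dist x (s k)"] by simp
    show "dist x (s ?k) \<le> dist x (s j)" if "j \<le> n" for j
      using arg_min_least[of "{..n}" j "\<lambda>k. dist x (s k)"] that by simp
  qed
  from LeastI_ex[OF this]
  show "near_idx s n x \<le> n" "j \<le> n \<Longrightarrow> dist x (s (near_idx s n x)) \<le> dist x (s j)"
    unfolding near_idx_def by auto
qed

lemma measurable_near_idx [measurable]:
  "near_idx (s :: nat \<Rightarrow> 'b::metric_space) n \<in> measurable borel (count_space UNIV)"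
proof -
  have [measurable]: "(\<lambda>x. dist x c) \<in> borel_measurable borel" for c :: 'b
    by (intro borel_measurable_continuous_onI continuous_intros)
  show ?thesis unfolding near_idx_def by measurable
qed

lemma near_idx_tendsto:
  assumes "dense_seq s" shows "(\<lambda>n. s (near_idx s n x)) \<longlonglongrightarrow> x"
proof (rule metric_LIMSEQ_I)
  fix e :: real assume "e > 0"
  then obtain k where k: "dist x (s k) < e" using assms by (auto simp: dense_seq_def)
  have "dist (s (near_idx s n x)) x < e" if "n \<ge> k" for n
    using near_idx(2)[OF that, of x s] k by (simp add: dist_commute)
  then show "\<exists>no. \<forall>n\<ge>no. dist (s (near_idx s n x)) x < e" by blast
qed

lemma norm_near_idx_le:
  assumes "dense_seq s" shows "norm (s (near_idx s n x)) \<le> 2 * norm x"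
proof -
  have "dist x (s (near_idx s n x)) \<le> norm x"
    using near_idx(2)[of 0 n x s] assms by (simp add: dense_seq_def)
  then show ?thesis
    using norm_triangle_ineq4[of x "x - s (near_idx s n x)"] by (simp add: dist_norm)
qed

text \<open>Approximating both arguments by functions with countably many values turns \<open>H\<close> into a function of
two indices, and continuity carries measurability to the limit.\<close>

lemma borel_measurable_continuous_dense:
  fixes H :: "'b::real_normed_vector \<Rightarrow> 'c::real_normed_vector \<Rightarrow> 'd::metric_space"
  assumes H: "continuous_on UNIV (\<lambda>p. H (fst p) (snd p))"
    and s: "dense_seq (s :: nat \<Rightarrow> 'b)" and t: "dense_seq (t :: nat \<Rightarrow> 'c)"
    and [measurable]: "f \<in> borel_measurable M" "g \<in> borel_measurable M"
  shows "(\<lambda>\<omega>. H (f \<omega>) (g \<omega>)) \<in> borel_measurable M"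
proof (rule borel_measurable_LIMSEQ_metric)
  fix n
  have "(\<lambda>\<omega>. H (s (near_idx s n (f \<omega>))) (t j)) \<in> borel_measurable M" for j
    by (rule measurable_compose_countable[where g="\<lambda>\<omega>. near_idx s n (f \<omega>)"]) auto
  then show "(\<lambda>\<omega>. H (s (near_idx s n (f \<omega>))) (t (near_idx t n (g \<omega>)))) \<in> borel_measurable M"
    by (rule measurable_compose_countable[where g="\<lambda>\<omega>. near_idx t n (g \<omega>)"]) auto
next
  fix \<omega>
  have "(\<lambda>n. (s (near_idx s n (f \<omega>)), t (near_idx t n (g \<omega>)))) \<longlonglongrightarrow> (f \<omega>, g \<omega>)"
    by (intro tendsto_Pair near_idx_tendsto s t)
  from continuous_on_tendsto_compose[OF H this]
  show "(\<lambda>n. H (s (near_idx s n (f \<omega>))) (t (near_idx t n (g \<omega>)))) \<longlonglongrightarrow> H (f \<omega>) (g \<omega>)"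
    by simp
qed

lemma borel_measurable_lincomb_dense:
  fixes f g :: "'w \<Rightarrow> 'b::real_normed_vector"
  assumes "dense_seq (s :: nat \<Rightarrow> 'b)" "f \<in> borel_measurable M" "g \<in> borel_measurable M"
  shows "(\<lambda>\<omega>. a *\<^sub>R f \<omega> + b *\<^sub>R g \<omega>) \<in> borel_measurable M"
  by (rule borel_measurable_continuous_dense[OF _ assms(1,1,2,3)]) (intro continuous_intros)

lemma borel_measurable_scaleR_dense:
  fixes f :: "'w \<Rightarrow> 'b::real_normed_vector"
  assumes "dense_seq (s :: nat \<Rightarrow> 'b)" "f \<in> borel_measurable M" "h \<in> borel_measurable M"
  shows "(\<lambda>\<omega>. h \<omega> *\<^sub>R f \<omega>) \<in> borel_measurable M"
proof -
  obtain t :: "nat \<Rightarrow> real" where t: "dense_seq t" using dense_seq_exists by blast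
  show ?thesis
    by (rule borel_measurable_continuous_dense[OF _ t assms(1,3,2)]) (intro continuous_intros)
qed

text \<open>Approximating \<open>f\<close> by functions with countably many values reduces the claim to evaluations at
fixed points, which are continuous in the functional.\<close>

lemma borel_measurable_blinfun_apply_dense:
  fixes v :: "'w \<Rightarrow> 'b::real_normed_vector \<Rightarrow>\<^sub>L real"
  assumes s: "dense_seq (s :: nat \<Rightarrow> 'b)"
    and v: "v \<in> borel_measurable M" and [measurable]: "f \<in> borel_measurable M"
  shows "(\<lambda>\<omega>. blinfun_apply (v \<omega>) (f \<omega>)) \<in> borel_measurable M"
proof (rule borel_measurable_LIMSEQ_metric)
  fix n
  have "(\<lambda>\<omega>. blinfun_apply (v \<omega>) (s j)) \<in> borel_measurable M" for j
    by (rule borel_measurable_continuous_on[OF _ v]) (intro continuous_intros)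
  then show "(\<lambda>\<omega>. blinfun_apply (v \<omega>) (s (near_idx s n (f \<omega>)))) \<in> borel_measurable M"
    by (rule measurable_compose_countable[where g="\<lambda>\<omega>. near_idx s n (f \<omega>)"]) auto
next
  fix \<omega>
  show "(\<lambda>n. blinfun_apply (v \<omega>) (s (near_idx s n (f \<omega>)))) \<longlonglongrightarrow> blinfun_apply (v \<omega>) (f \<omega>)"
    by (intro tendsto_intros near_idx_tendsto s)
qed

lemma dense_seq_label:
  fixes s :: "nat \<Rightarrow> 'b::real_normed_vector"
  assumes s: "dense_seq s" and e: "e > 0"
  obtains l where "l \<in> measurable borel (count_space UNIV)" "\<And>x. dist x (s (l x)) < e"
proof -
  define l where "l x = (LEAST n. dist x (s n) < e)" for x
  have [measurable]: "(\<lambda>x. dist x c) \<in> borel_measurable borel" for c :: 'b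
    by (intro borel_measurable_continuous_onI continuous_intros)
  have "l \<in> measurable borel (count_space UNIV)" unfolding l_def by measurable
  moreover have "dist x (s (l x)) < e" for x
  proof -
    have "\<exists>n. dist x (s n) < e" using s e by (simp add: dense_seq_def)
    from LeastI_ex[OF this] show ?thesis by (simp add: l_def)
  qed
  ultimately show ?thesis by (rule that)
qed

text \<open>Labelling the points of both target spaces by small Borel sets reduces the claim to countably many
labels. A map that matches labels moves values by less than the diameter of the label sets, so the
approximation is uniform and serves all exponents at once.\<close>

lemma equidistributed_approx_rearrangement:
  fixes f f' :: "'w \<Rightarrow> 'b::real_normed_vector" and v v' :: "'w \<Rightarrow> 'c::real_normed_vector"
  assumes M: "prob_space M" "standard_borel M" "nonatomic M"
    and s: "dense_seq (s :: nat \<Rightarrow> 'b)" and t: "dense_seq (t :: nat \<Rightarrow> 'c)"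
    and [measurable]: "f \<in> borel_measurable M" "f' \<in> borel_measurable M"
      "v \<in> borel_measurable M" "v' \<in> borel_measurable M"
    and law: "distr M (borel \<Otimes>\<^sub>M borel) (\<lambda>\<omega>. (f \<omega>, v \<omega>)) =
      distr M (borel \<Otimes>\<^sub>M borel) (\<lambda>\<omega>. (f' \<omega>, v' \<omega>))"
    and e: "e > 0"
  obtains g where "g \<in> mp_maps M" "AE \<omega> in M. dist (f (g \<omega>)) (f' \<omega>) < e \<and> dist (v (g \<omega>)) (v' \<omega>) < e"
proof -
  have e2: "e / 2 > 0" using e by simp
  obtain k where [measurable]: "k \<in> measurable borel (count_space UNIV)"
    and k: "\<And>x. dist x (s (k x)) < e / 2" by (rule dense_seq_label[OF s e2]) blast
  obtain j where [measurable]: "j \<in> measurable borel (count_space UNIV)"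
    and j: "\<And>x. dist x (t (j x)) < e / 2" by (rule dense_seq_label[OF t e2]) blast
  define L where "L p = prod_encode (k (fst p), j (snd p))" for p
  have L [measurable]: "L \<in> measurable (borel \<Otimes>\<^sub>M borel) (count_space UNIV)"
  proof -
    have "(\<lambda>p. prod_encode (n, j (snd p))) \<in> measurable (borel \<Otimes>\<^sub>M borel) (count_space UNIV)" for n
      by (rule measurable_compose_countable[where g="\<lambda>p. j (snd p)"]) auto
    then show ?thesis unfolding L_def
      by (rule measurable_compose_countable[where g="\<lambda>p. k (fst p)"]) auto
  qed
  have "distr M (count_space UNIV) (\<lambda>\<omega>. L (f \<omega>, v \<omega>)) = distr M (count_space UNIV) (\<lambda>\<omega>. L (f' \<omega>, v' \<omega>))"
    using distr_distr[OF L, of "\<lambda>\<omega>. (f \<omega>, v \<omega>)" M] distr_distr[OF L, of "\<lambda>\<omega>. (f' \<omega>, v' \<omega>)" M]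
    by (simp add: law comp_def)
  then obtain g where g: "g \<in> mp_maps M" "AE \<omega> in M. L (f (g \<omega>), v (g \<omega>)) = L (f' \<omega>, v' \<omega>)"
    by (rule equidistributed_labels_rearrangement[OF M, rotated 2]) measurable
  from g(2) have "AE \<omega> in M. dist (f (g \<omega>)) (f' \<omega>) < e \<and> dist (v (g \<omega>)) (v' \<omega>) < e"
  proof eventually_elim
    case (elim \<omega>)
    then have *: "k (f (g \<omega>)) = k (f' \<omega>)" "j (v (g \<omega>)) = j (v' \<omega>)" by (auto simp: L_def)
    show ?case
      using k[of "f (g \<omega>)"] k[of "f' \<omega>"] j[of "v (g \<omega>)"] j[of "v' \<omega>"] unfolding *
      by (metis dist_commute dist_triangle_half_l)
  qed
  with g(1) show ?thesis by (rule that)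
qed

section \<open>The Hahn--Banach sandwich theorem\<close>

text \<open>Functions form a vector space under pointwise operations, so that integrable functions are a subspace
and the Hahn--Banach theorem for subspaces applies to them before passing to classes.\<close>

instantiation "fun" :: (type, scaleR) scaleR
begin

definition scaleR_fun :: "real \<Rightarrow> ('a \<Rightarrow> 'b) \<Rightarrow> 'a \<Rightarrow> 'b" where
  "scaleR_fun r f = (\<lambda>x. r *\<^sub>R f x)"

instance ..

end

instance "fun" :: (type, real_vector) real_vector
  by standard (auto simp: scaleR_fun_def plus_fun_def fun_eq_iff scaleR_add_right scaleR_add_left)

definition sublinear_on :: "'v::real_vector set \<Rightarrow> ('v \<Rightarrow> real) \<Rightarrow> bool" where
  "sublinear_on S p \<longleftrightarrow> (\<forall>x\<in>S. \<forall>y\<in>S. p (x + y) \<le> p x + p y) \<and> (\<forall>x\<in>S. \<forall>t>0. p (t *\<^sub>R x) \<le> t * p x)"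

definition linear_functional_on :: "'v::real_vector set \<Rightarrow> ('v \<Rightarrow> real) \<Rightarrow> bool" where
  "linear_functional_on S l \<longleftrightarrow> (\<forall>x\<in>S. \<forall>y\<in>S. l (x + y) = l x + l y) \<and> (\<forall>x\<in>S. \<forall>r. l (r *\<^sub>R x) = r * l x)"

lemma sublinear_on_scale:
  assumes "subspace S" "sublinear_on S p" "x \<in> S" "t > 0" shows "p (t *\<^sub>R x) = t * p x"
proof (rule antisym)
  show "p (t *\<^sub>R x) \<le> t * p x" using assms by (auto simp: sublinear_on_def)
  have "p (inverse t *\<^sub>R (t *\<^sub>R x)) \<le> inverse t * p (t *\<^sub>R x)"
    using assms subspace_scale[of S x t] unfolding sublinear_on_def by (metis inverse_positive_iff_positive)
  then show "t * p x \<le> p (t *\<^sub>R x)" using \<open>t > 0\<close> by (simp add: field_simps)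
qed

lemma sublinear_on_0:
  assumes "subspace S" "sublinear_on S p" shows "p 0 = 0"
  using sublinear_on_scale[OF assms subspace_0[OF assms(1)], of 2] by simp

lemma sublinear_on_neg:
  assumes "subspace S" "sublinear_on S p" "x \<in> S" shows "- p (- x) \<le> p x"
proof -
  have "p (x + - x) \<le> p x + p (- x)"
    using assms subspace_neg[of S x] unfolding sublinear_on_def by blast
  then show ?thesis using sublinear_on_0[OF assms(1,2)] by simp
qed

text \<open>Zorn's lemma: pointwise infima of chains stay finite, since a sublinear functional below \<open>p\<close> is at
least \<open>- p (- x)\<close> at \<open>x\<close>.\<close>

lemma minimal_sublinear_on_exists:
  assumes S: "subspace S" and p: "sublinear_on S p"
  obtains m where "sublinear_on S m" "\<And>x. x \<in> S \<Longrightarrow> m x \<le> p x"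
    "\<forall>k. sublinear_on S k \<longrightarrow> (\<forall>x\<in>S. k x \<le> m x) \<longrightarrow> (\<forall>x\<in>S. k x = m x)"
proof -
  define F where "F = {m. sublinear_on S m \<and> (\<forall>x\<in>S. m x \<le> p x) \<and> (\<forall>x. x \<notin> S \<longrightarrow> m x = 0)}"
  define R where "R f g \<longleftrightarrow> (\<forall>x. g x \<le> (f x :: real))" for f g :: "'a \<Rightarrow> real"
  have pF: "(\<lambda>x. if x \<in> S then p x else 0) \<in> F"
    using p S by (auto simp: F_def sublinear_on_def subspace_add subspace_scale)
  \<comment> \<open>the order is reversed, so that maximal elements for \<open>R\<close> are minimal functionals\<close>
  have "\<exists>m\<in>F. \<forall>a\<in>F. R m a \<longrightarrow> a = m"
  proof (rule predicate_Zorn)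
    show "partial_order_on F (relation_of R F)"
      by (rule partial_order_on_relation_ofI) (auto simp: R_def fun_eq_iff intro: order_trans antisym)
    fix C assume C: "C \<in> Chains (relation_of R F)"
    then have CF: "C \<subseteq> F" and chain: "\<And>f g. f \<in> C \<Longrightarrow> g \<in> C \<Longrightarrow> R f g \<or> R g f"
      by (auto simp: Chains_def relation_of_def)
    show "\<exists>u\<in>F. \<forall>a\<in>C. R a u"
    proof (cases "C = {}")
      case True
      then show ?thesis using pF by auto
    next
      case False
      define u where "u x = (INF m\<in>C. m x)" for x
      have low: "- p (- x) \<le> m x" if "m \<in> C" "x \<in> S" for m x
      proof -
        have "sublinear_on S m" "m (- x) \<le> p (- x)"
          using that CF subspace_neg[OF S] by (auto simp: F_def)
        then show ?thesis using sublinear_on_neg[OF S, of m x] that by linarith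
      qed
      have bdd: "bdd_below ((\<lambda>m. m x) ` C)" for x
      proof (cases "x \<in> S")
        case True then show ?thesis using low by (intro bdd_belowI2[of _ "- p (- x)"]) auto
      next
        case False then show ?thesis using CF by (intro bdd_belowI2[of _ 0]) (auto simp: F_def)
      qed
      have u_le: "u x \<le> m x" if "m \<in> C" for m x
        unfolding u_def by (rule cINF_lower[OF bdd that])
      have u_ge: "c \<le> u x" if "\<And>m. m \<in> C \<Longrightarrow> c \<le> m x" for c x
        unfolding u_def by (rule cINF_greatest[OF False that])
      have "u (x + y) \<le> u x + u y" if xy: "x \<in> S" "y \<in> S" for x y
      proof -
        have "u (x + y) \<le> m1 x + m2 y" if m: "m1 \<in> C" "m2 \<in> C" for m1 m2
        proof -
          obtain m where m': "m \<in> C" "m x \<le> m1 x" "m y \<le> m2 y"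
            using chain[OF m] m unfolding R_def by blast
          have "m (x + y) \<le> m x + m y" using m' CF xy by (auto simp: F_def sublinear_on_def)
          then show ?thesis using u_le[OF m'(1), of "x + y"] m' by linarith
        qed
        then have "u (x + y) - m2 y \<le> u x" if "m2 \<in> C" for m2
          using that by (intro u_ge) (simp add: algebra_simps)
        then have "u (x + y) - u x \<le> u y"
          by (intro u_ge) (simp add: algebra_simps)
        then show ?thesis by simp
      qed
      moreover have "u (t *\<^sub>R x) \<le> t * u x" if "x \<in> S" "t > 0" for t x
      proof -
        have "u (t *\<^sub>R x) / t \<le> m x" if m: "m \<in> C" for m
        proof -
          have "m (t *\<^sub>R x) \<le> t * m x"
            using m CF \<open>x \<in> S\<close> \<open>t > 0\<close> by (auto simp: F_def sublinear_on_def)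
          then have "u (t *\<^sub>R x) \<le> t * m x" using u_le[OF m, of "t *\<^sub>R x"] by linarith
          then show ?thesis using \<open>t > 0\<close> by (simp add: field_simps)
        qed
        then have "u (t *\<^sub>R x) / t \<le> u x" by (rule u_ge)
        then show ?thesis using \<open>t > 0\<close> by (simp add: field_simps)
      qed
      moreover obtain m0 where m0: "m0 \<in> C" using False by blast
      have "u x \<le> p x" if "x \<in> S" for x
        using u_le[OF m0, of x] m0 CF that by (force simp: F_def)
      moreover have "u x = 0" if "x \<notin> S" for x
        using u_le[OF m0, of x] u_ge[of 0 x] CF m0 that by (force simp: F_def)
      ultimately have "u \<in> F" by (simp add: F_def sublinear_on_def)
      then show ?thesis using u_le by (auto simp: R_def)
    qed
  qed
  then obtain m where m: "m \<in> F" "\<And>a. a \<in> F \<Longrightarrow> R m a \<Longrightarrow> a = m" by blast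
  show ?thesis
  proof (rule that)
    show "sublinear_on S m" "\<And>x. x \<in> S \<Longrightarrow> m x \<le> p x" using m(1) by (auto simp: F_def)
    have "k x = m x" if k: "sublinear_on S k" "\<forall>x\<in>S. k x \<le> m x" and x: "x \<in> S" for k x
    proof -
    define k' where "k' x = (if x \<in> S then k x else 0)" for x
    have "k' \<in> F"
      using k S m(1) unfolding F_def sublinear_on_def k'_def
      by (auto simp: subspace_add subspace_scale) (meson order_trans)
    moreover have "R m k'" using k(2) m(1) by (auto simp: R_def k'_def F_def)
    ultimately have "k' = m" by (rule m(2))
    from fun_cong[OF this, of x] show "k x = m x" using x by (simp add: k'_def)
    qed
    then show "\<forall>k. sublinear_on S k \<longrightarrow> (\<forall>x\<in>S. k x \<le> m x) \<longrightarrow> (\<forall>x\<in>S. k x = m x)" by blast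
  qed
qed

text \<open>Lowering \<open>m\<close> as much as possible along a direction \<open>y\<close> yields another sublinear functional, whose
value at \<open>z\<close> is at most \<open>m (z + y) - m y\<close>. Minimality turns this into additivity.\<close>

lemma minimal_sublinear_on_linear:
  assumes S: "subspace S" and m: "sublinear_on S m"
    and min: "\<forall>k. sublinear_on S k \<longrightarrow> (\<forall>x\<in>S. k x \<le> m x) \<longrightarrow> (\<forall>x\<in>S. k x = m x)"
  shows "linear_functional_on S m"
proof -
  have m_add: "m (x + y) \<le> m x + m y" if "x \<in> S" "y \<in> S" for x y
    using m that by (simp add: sublinear_on_def)
  have m_scale: "m (t *\<^sub>R x) = t * m x" if "x \<in> S" "t \<ge> 0" for x t
    using sublinear_on_scale[OF S m that(1), of t] sublinear_on_0[OF S m] that by (cases "t = 0") auto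
  have add: "m (z + y) = m z + m y" if y: "y \<in> S" and z: "z \<in> S" for y z
  proof -
    \<comment> \<open>a sublinear functional below \<open>m\<close> that is at most \<open>m (z + y) - m y\<close> at \<open>z\<close>\<close>
    define k where "k z = (INF t\<in>{0..}. m (z + t *\<^sub>R y) - t * m y)" for z
    have low: "- m (- z) \<le> m (z + t *\<^sub>R y) - t * m y" if "z \<in> S" "t \<ge> 0" for z t
      using m_add[of "z + t *\<^sub>R y" "- z"] m_scale[OF y \<open>t \<ge> 0\<close>] that y S
      by (simp add: subspace_add subspace_scale subspace_neg)
    have k_le: "k z \<le> m (z + t *\<^sub>R y) - t * m y" if "z \<in> S" "t \<ge> 0" for z t
      unfolding k_def using low that
      by (intro cINF_lower bdd_belowI2[of _ "- m (- z)"]) auto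
    have k_ge: "c \<le> k z" if "\<And>t. t \<ge> 0 \<Longrightarrow> c \<le> m (z + t *\<^sub>R y) - t * m y" for c z
      unfolding k_def using that by (intro cINF_greatest) auto
    have k_add: "k (a + b) \<le> k a + k b" if ab: "a \<in> S" "b \<in> S" for a b
    proof -
      have *: "k (a + b) \<le> (m (a + t *\<^sub>R y) - t * m y) + (m (b + t' *\<^sub>R y) - t' * m y)"
        if "t \<ge> 0" "t' \<ge> 0" for t t'
      proof -
        have "m ((a + t *\<^sub>R y) + (b + t' *\<^sub>R y)) \<le> m (a + t *\<^sub>R y) + m (b + t' *\<^sub>R y)"
          using ab y S by (intro m_add) (auto simp: subspace_add subspace_scale)
        moreover have "(a + t *\<^sub>R y) + (b + t' *\<^sub>R y) = (a + b) + (t + t') *\<^sub>R y"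
          by (simp add: algebra_simps)
        ultimately show ?thesis
          using k_le[of "a + b" "t + t'"] that ab S by (simp add: subspace_add algebra_simps)
      qed
      have "k (a + b) - (m (b + t' *\<^sub>R y) - t' * m y) \<le> k a" if "t' \<ge> 0" for t'
        using *[OF _ that] by (intro k_ge) (simp add: algebra_simps)
      then have "k (a + b) - k a \<le> k b" by (intro k_ge) (simp add: algebra_simps)
      then show ?thesis by simp
    qed
    have k_scale: "k (s *\<^sub>R a) \<le> s * k a" if a: "a \<in> S" and s: "s > 0" for a s
    proof -
      have "k (s *\<^sub>R a) / s \<le> m (a + t *\<^sub>R y) - t * m y" if "t \<ge> 0" for t
      proof -
        have "s *\<^sub>R a + (s * t) *\<^sub>R y = s *\<^sub>R (a + t *\<^sub>R y)" by (simp add: algebra_simps)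
        then have "m (s *\<^sub>R a + (s * t) *\<^sub>R y) = s * m (a + t *\<^sub>R y)"
          using m_scale[of "a + t *\<^sub>R y" s] a y s S by (simp add: subspace_add subspace_scale)
        then have "k (s *\<^sub>R a) \<le> s * m (a + t *\<^sub>R y) - s * t * m y"
          using k_le[of "s *\<^sub>R a" "s * t"] a s that S by (simp add: subspace_scale)
        then show ?thesis using s by (simp add: field_simps)
      qed
      then have "k (s *\<^sub>R a) / s \<le> k a" by (rule k_ge)
      then show ?thesis using s by (simp add: field_simps)
    qed
    have "sublinear_on S k" using k_add k_scale by (simp add: sublinear_on_def)
    moreover have "k x \<le> m x" if "x \<in> S" for x using k_le[OF that, of 0] by simp
    ultimately have "k z = m z" using min z by blast
    then show ?thesis using k_le[OF z, of 1] m_add[OF z y] by simp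
  qed
  have "m (r *\<^sub>R x) = r * m x" if x: "x \<in> S" for r x
  proof (cases "r \<ge> 0")
    case False
    have "m (r *\<^sub>R x + (- r) *\<^sub>R x) = m (r *\<^sub>R x) + m ((- r) *\<^sub>R x)"
      using x S by (intro add) (auto intro: subspace_scale subspace_neg)
    then show ?thesis using m_scale[OF x, of "- r"] False sublinear_on_0[OF S m] by simp
  qed (use m_scale x in simp)
  with add show ?thesis by (simp add: linear_functional_on_def)
qed

theorem Hahn_Banach_sublinear:
  assumes "subspace S" "sublinear_on S p"
  obtains l where "linear_functional_on S l" "\<And>x. x \<in> S \<Longrightarrow> l x \<le> p x"
proof -
  obtain m where m: "sublinear_on S m" "\<And>x. x \<in> S \<Longrightarrow> m x \<le> p x"
    "\<forall>k. sublinear_on S k \<longrightarrow> (\<forall>x\<in>S. k x \<le> m x) \<longrightarrow> (\<forall>x\<in>S. k x = m x)"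
    by (rule minimal_sublinear_on_exists[OF assms]) blast
  have "linear_functional_on S m"
    by (rule minimal_sublinear_on_linear[OF assms(1) m(1,3)])
  then show ?thesis using that m(2) by blast
qed

text \<open>A concave function below a convex one, here given by its epigraph \<open>Q\<close>, leaves room for an affine
function between them. The functional \<open>p\<close> of the proof is the sublinear hull of the infimal
convolution of the two; a linear functional below \<open>p\<close> has the slope that is looked for.\<close>

theorem Hahn_Banach_sandwich:
  fixes Q :: "('v::real_vector \<times> real) set"
  assumes S: "subspace S" and Q: "convex Q" "Q \<noteq> {}" "\<And>y b. (y, b) \<in> Q \<Longrightarrow> y \<in> S"
    and \<Psi>: "convex_on S \<Psi>" and le: "\<And>y b. (y, b) \<in> Q \<Longrightarrow> - \<Psi> y \<le> b"
  obtains l c where "linear_functional_on S l" "\<And>u. u \<in> S \<Longrightarrow> - \<Psi> u \<le> l u + c"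
    "\<And>y b. (y, b) \<in> Q \<Longrightarrow> l y + c \<le> b"
proof -
  define I where "I = ({0<..} :: real set) \<times> Q"
  define val where "val z i = (case i of (\<tau>, y, b) \<Rightarrow> (b + \<Psi> (y - \<tau> *\<^sub>R z)) / \<tau>)" for z i
  define p where "p z = (INF i\<in>I. val z i)" for z
  obtain y1 b1 where Q1: "(y1, b1) \<in> Q" using Q(2) by fastforce
  have I_ne: "I \<noteq> {}" using Q(2) by (auto simp: I_def)
  have comb: "(a *\<^sub>R y + a' *\<^sub>R y', a * b + a' * b') \<in> Q"
    if "(y, b) \<in> Q" "(y', b') \<in> Q" "a \<ge> 0" "a' \<ge> 0" "a + a' = 1" for y b y' b' a a'
    using convexD[OF Q(1) that] by simp
  have \<Psi>_comb: "\<Psi> (a *\<^sub>R u + a' *\<^sub>R u') \<le> a * \<Psi> u + a' * \<Psi> u'"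
    if "u \<in> S" "u' \<in> S" "a \<ge> 0" "a' \<ge> 0" "a + a' = 1" for u u' a a'
    using \<Psi> that unfolding convex_on_def by blast
  have val_low: "- (b1 + \<Psi> (y1 + z)) \<le> val z i" if z: "z \<in> S" and i: "i \<in> I" for z i
  proof -
    obtain \<tau> y b where i_eq: "i = (\<tau>, y, b)" and \<tau>: "\<tau> > 0" and yb: "(y, b) \<in> Q"
      using i by (auto simp: I_def)
    define a where "a = 1 / (1 + \<tau>)"
    have a: "a > 0" "a * \<tau> \<ge> 0" "a + a * \<tau> = 1" using \<tau> by (auto simp: a_def field_simps add_divide_distrib[symmetric])
    have yS: "y \<in> S" "y1 \<in> S" using Q(3) yb Q1 by auto
    have eq: "a *\<^sub>R y + (a * \<tau>) *\<^sub>R y1 = a *\<^sub>R (y - \<tau> *\<^sub>R z) + (a * \<tau>) *\<^sub>R (y1 + z)"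
      by (simp add: algebra_simps)
    have "0 \<le> (a * b + a * \<tau> * b1) + \<Psi> (a *\<^sub>R y + (a * \<tau>) *\<^sub>R y1)"
      using le[OF comb[OF yb Q1, of a "a * \<tau>"]] a by simp
    also have "\<Psi> (a *\<^sub>R y + (a * \<tau>) *\<^sub>R y1) \<le> a * \<Psi> (y - \<tau> *\<^sub>R z) + a * \<tau> * \<Psi> (y1 + z)"
      unfolding eq using a yS z S
      by (intro \<Psi>_comb) (auto simp: subspace_add subspace_diff subspace_scale)
    finally have "0 \<le> a * ((b + \<Psi> (y - \<tau> *\<^sub>R z)) + \<tau> * (b1 + \<Psi> (y1 + z)))"
      by (simp add: algebra_simps)
    then have "0 \<le> (b + \<Psi> (y - \<tau> *\<^sub>R z)) + \<tau> * (b1 + \<Psi> (y1 + z))"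
      using a(1) by (simp add: zero_le_mult_iff)
    then show ?thesis using \<tau> by (simp add: i_eq val_def field_simps)
  qed
  have p_le: "p z \<le> val z i" if "z \<in> S" "i \<in> I" for z i
    unfolding p_def using val_low that by (intro cINF_lower bdd_belowI2[of _ "- (b1 + \<Psi> (y1 + z))"]) auto
  have p_ge: "c \<le> p z" if "\<And>i. i \<in> I \<Longrightarrow> c \<le> val z i" for c z
    unfolding p_def by (rule cINF_greatest[OF I_ne that])
  have p_add: "p (z + z') \<le> p z + p z'" if z: "z \<in> S" "z' \<in> S" for z z'
  proof -
    have *: "p (z + z') \<le> val z i + val z' i'" if i: "i \<in> I" "i' \<in> I" for i i'
    proof -
      obtain \<tau> y b \<tau>' y' b' where i_eq: "i = (\<tau>, y, b)" "i' = (\<tau>', y', b')"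
        and \<tau>: "\<tau> > 0" "\<tau>' > 0" and yb: "(y, b) \<in> Q" "(y', b') \<in> Q"
        using i by (auto simp: I_def)
      define a a' \<sigma> where "a = \<tau>' / (\<tau> + \<tau>')" and "a' = \<tau> / (\<tau> + \<tau>')" and "\<sigma> = \<tau> * \<tau>' / (\<tau> + \<tau>')"
      have a: "a \<ge> 0" "a' \<ge> 0" "a + a' = 1" "a * \<tau> = \<sigma>" "a' * \<tau>' = \<sigma>" "\<sigma> > 0" "a / \<sigma> = 1 / \<tau>" "a' / \<sigma> = 1 / \<tau>'"
        using \<tau> by (auto simp: a_def a'_def \<sigma>_def add_divide_distrib[symmetric] add.commute mult_ac)
      have yS: "y \<in> S" "y' \<in> S" using Q(3) yb by auto
      have eq: "(a *\<^sub>R y + a' *\<^sub>R y') - \<sigma> *\<^sub>R (z + z') = a *\<^sub>R (y - \<tau> *\<^sub>R z) + a' *\<^sub>R (y' - \<tau>' *\<^sub>R z')"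
        by (simp add: scaleR_diff_right scaleR_add_right a)
      have "p (z + z') \<le> (a * b + a' * b' + \<Psi> ((a *\<^sub>R y + a' *\<^sub>R y') - \<sigma> *\<^sub>R (z + z'))) / \<sigma>"
        using p_le[of "z + z'" "(\<sigma>, a *\<^sub>R y + a' *\<^sub>R y', a * b + a' * b')"] comb[OF yb a(1-3)] z S a(6)
        by (simp add: val_def I_def subspace_add)
      also have "\<Psi> ((a *\<^sub>R y + a' *\<^sub>R y') - \<sigma> *\<^sub>R (z + z')) \<le> a * \<Psi> (y - \<tau> *\<^sub>R z) + a' * \<Psi> (y' - \<tau>' *\<^sub>R z')"
        unfolding eq using a yS z S
        by (intro \<Psi>_comb) (auto simp: subspace_diff subspace_scale)
      finally have "p (z + z') \<le> (a * b + a' * b' + (a * \<Psi> (y - \<tau> *\<^sub>R z) + a' * \<Psi> (y' - \<tau>' *\<^sub>R z'))) / \<sigma>"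
        using a(6) by (simp add: divide_right_mono)
      also have "\<dots> = a / \<sigma> * (b + \<Psi> (y - \<tau> *\<^sub>R z)) + a' / \<sigma> * (b' + \<Psi> (y' - \<tau>' *\<^sub>R z'))"
        by (simp add: algebra_simps add_divide_distrib)
      finally show ?thesis unfolding a by (simp add: i_eq val_def)
    qed
    have "p (z + z') - val z' i' \<le> p z" if "i' \<in> I" for i'
      using *[OF _ that] by (intro p_ge) (simp add: algebra_simps)
    then have "p (z + z') - p z \<le> p z'" by (intro p_ge) (simp add: algebra_simps)
    then show ?thesis by simp
  qed
  have p_scale: "p (s *\<^sub>R z) \<le> s * p z" if z: "z \<in> S" and s: "s > 0" for z s
  proof -
    have "p (s *\<^sub>R z) / s \<le> val z i" if i: "i \<in> I" for i
    proof -
      obtain \<tau> y b where i_eq: "i = (\<tau>, y, b)" and \<tau>: "\<tau> > 0" and yb: "(y, b) \<in> Q"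
        using i by (auto simp: I_def)
      have "p (s *\<^sub>R z) \<le> val (s *\<^sub>R z) (\<tau> / s, y, b)"
        using \<tau> s yb z S by (intro p_le) (auto simp: I_def subspace_scale)
      also have "\<dots> = s * val z i" using s by (simp add: val_def i_eq)
      finally show ?thesis using s by (simp add: field_simps)
    qed
    then have "p (s *\<^sub>R z) / s \<le> p z" by (rule p_ge)
    then show ?thesis using s by (simp add: field_simps)
  qed
  have "sublinear_on S p" using p_add p_scale by (simp add: sublinear_on_def)
  then obtain l where l: "linear_functional_on S l" "\<And>x. x \<in> S \<Longrightarrow> l x \<le> p x"
    by (rule Hahn_Banach_sublinear[OF S]) blast
  have key: "- \<Psi> u - l u \<le> b - l y" if u: "u \<in> S" and yb: "(y, b) \<in> Q" for u y b
  proof -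
    have yS: "y \<in> S" using Q(3) yb by auto
    have "l (y - u) \<le> val (y - u) (1, y, b)"
      using l(2)[of "y - u"] p_le[of "y - u" "(1, y, b)"] yb yS u S
      by (auto simp: I_def subspace_diff)
    then have "l (y - u) \<le> b + \<Psi> u" by (simp add: val_def)
    moreover have "l (y + (-1) *\<^sub>R u) = l y + (-1) * l u"
      using l(1) yS u subspace_scale[OF S u, of "-1"] unfolding linear_functional_on_def by metis
    ultimately show ?thesis by simp
  qed
  define c where "c = (INF i\<in>Q. snd i - l (fst i))"
  show ?thesis
  proof (rule that[OF l(1)])
    show "- \<Psi> u \<le> l u + c" if u: "u \<in> S" for u
    proof -
      have "- \<Psi> u - l u \<le> c" unfolding c_def using key[OF u] Q(2) by (intro cINF_greatest) auto
      then show ?thesis by simp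
    qed
    show "l y + c \<le> b" if yb: "(y, b) \<in> Q" for y b
    proof -
      have "c \<le> snd (y, b) - l (fst (y, b))"
        unfolding c_def using key[OF subspace_0[OF S]] yb
        by (intro cINF_lower bdd_belowI2[of _ "- \<Psi> 0 - l 0"]) auto
      then show ?thesis by simp
    qed
  qed
qed

section \<open>Separable duals and reflexivity\<close>

lemma linear_functional_on_UNIV_iff: "linear_functional_on UNIV l \<longleftrightarrow> linear l"
  by (auto simp: linear_functional_on_def linear_iff)

text \<open>Scaling \<open>u\<close> makes the additive constant negligible.\<close>

lemma linear_bounded_below_norm:
  fixes l :: "'b::real_normed_vector \<Rightarrow> real"
  assumes l: "linear l" and ge: "\<And>u. - norm u \<le> l u + c"
  shows "\<bar>l u\<bar> \<le> norm u"
proof -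
  have *: "- norm u \<le> l u" for u
  proof (rule ccontr)
    assume "\<not> - norm u \<le> l u"
    define \<delta> where "\<delta> = - norm u - l u"
    have \<delta>: "\<delta> > 0" using \<open>\<not> - norm u \<le> l u\<close> by (simp add: \<delta>_def)
    define t where "t = (\<bar>c\<bar> + 1) / \<delta>"
    have t: "t > 0" "t * \<delta> = \<bar>c\<bar> + 1" using \<delta> by (auto simp: t_def)
    have "- norm (t *\<^sub>R u) \<le> l (t *\<^sub>R u) + c" by (rule ge)
    then have "t * \<delta> \<le> c" using t(1) by (simp add: \<delta>_def linear_scale[OF l] algebra_simps)
    then show False using t by linarith
  qed
  from *[of u] *[of "- u"] show ?thesis by (simp add: linear_neg[OF l])
qed

lemma bounded_linear_of_le_norm:
  fixes l :: "'b::real_normed_vector \<Rightarrow> real"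
  assumes "linear l" "\<And>u. \<bar>l u\<bar> \<le> norm u" shows "bounded_linear l"
  using assms by (intro bounded_linear_intro[of _ 1]) (auto simp: linear_iff)

lemma convex_on_norm_diff: "convex_on UNIV (\<lambda>u::'b::real_normed_vector. norm u - d)"
proof (rule convex_onI)
  fix t :: real and x y :: 'b assume "0 < t" "t < 1"
  then have "norm ((1 - t) *\<^sub>R x + t *\<^sub>R y) \<le> (1 - t) * norm x + t * norm y"
    using norm_triangle_ineq[of "(1 - t) *\<^sub>R x" "t *\<^sub>R y"] by simp
  then show "norm ((1 - t) *\<^sub>R x + t *\<^sub>R y) - d \<le> (1 - t) * (norm x - d) + t * (norm y - d)"
    by (simp add: algebra_simps)
qed simp

lemma norming_functional_exists:
  fixes x :: "'b::real_normed_vector"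
  obtains \<phi> :: "'b \<Rightarrow>\<^sub>L real" where "norm \<phi> \<le> 1" "blinfun_apply \<phi> x = norm x"
proof -
  obtain l c where l: "linear_functional_on (UNIV :: 'b set) l" "\<And>u. - norm u \<le> l u + c"
    "\<And>y b. (y, b) \<in> {(x, - norm x)} \<Longrightarrow> l y + c \<le> b"
    by (rule Hahn_Banach_sandwich[of UNIV "{(x, - norm x)}" norm]) (use convex_on_norm_diff[of 0] in auto)
  then have lin: "linear l" by (simp add: linear_functional_on_UNIV_iff)
  have le: "\<bar>l u\<bar> \<le> norm u" for u by (rule linear_bounded_below_norm[OF lin l(2)])
  have "0 \<le> c" using l(2)[of 0] linear_0[OF lin] by simp
  then have "l x = - norm x" using l(3)[of x "- norm x"] le[of x] by simp
  have bl: "bounded_linear (\<lambda>u. - l u)"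
    using bounded_linear_of_le_norm[OF lin le] by (rule bounded_linear_minus)
  show ?thesis
  proof (rule that)
    show "norm (Blinfun (\<lambda>u. - l u)) \<le> 1"
      using le by (intro norm_blinfun_bound) (auto simp: bounded_linear_Blinfun_apply[OF bl])
    show "blinfun_apply (Blinfun (\<lambda>u. - l u)) x = norm x"
      using \<open>l x = - norm x\<close> by (simp add: bounded_linear_Blinfun_apply[OF bl])
  qed
qed

text \<open>Rational combinations are indexed by lists, which makes countability and closure under addition
(concatenation) immediate.\<close>

definition rat_span :: "'b::real_vector set \<Rightarrow> 'b set" where
  "rat_span Y = (\<lambda>ps. sum_list (map (\<lambda>(q, y). real_of_rat q *\<^sub>R y) ps)) ` lists (UNIV \<times> Y)"

lemma countable_rat_span: "countable Y \<Longrightarrow> countable (rat_span Y)"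
  unfolding rat_span_def by (intro countable_image countable_lists) auto

lemma rat_span_superset: "y \<in> Y \<Longrightarrow> y \<in> rat_span Y"
  unfolding rat_span_def by (rule image_eqI[of _ _ "[(1, y)]"]) auto

lemma rat_span_add:
  assumes "x \<in> rat_span Y" "y \<in> rat_span Y" shows "x + y \<in> rat_span Y"
proof -
  obtain ps qs where "ps \<in> lists (UNIV \<times> Y)" "qs \<in> lists (UNIV \<times> Y)"
    "x = sum_list (map (\<lambda>(q, y). real_of_rat q *\<^sub>R y) ps)"
    "y = sum_list (map (\<lambda>(q, y). real_of_rat q *\<^sub>R y) qs)"
    using assms unfolding rat_span_def by blast
  then show ?thesis
    unfolding rat_span_def by (intro image_eqI[of _ _ "ps @ qs"]) auto
qed

lemma rat_span_scale:
  assumes "x \<in> rat_span Y" "r \<in> \<rat>" shows "r *\<^sub>R x \<in> rat_span Y"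
proof -
  obtain ps where ps: "ps \<in> lists (UNIV \<times> Y)"
    "x = sum_list (map (\<lambda>(q, y). real_of_rat q *\<^sub>R y) ps)"
    using assms unfolding rat_span_def by blast
  obtain q where r: "r = real_of_rat q" using assms(2) by (rule Rats_cases)
  have "r *\<^sub>R sum_list (map (\<lambda>(q, y). real_of_rat q *\<^sub>R y) ps) =
      sum_list (map (\<lambda>(q, y). real_of_rat q *\<^sub>R y) (map (\<lambda>(q', y). (q * q', y)) ps))" for ps :: "(rat \<times> 'a) list"
    by (induction ps) (auto simp: scaleR_add_right r of_rat_mult)
  then show ?thesis using ps
    unfolding rat_span_def by (intro image_eqI[of _ _ "map (\<lambda>(q', y). (q * q', y)) ps"]) auto
qed

lemma rational_sequence_tendsto:
  fixes r :: real
  obtains q where "\<forall>n. q n \<in> \<rat>" "q \<longlonglongrightarrow> r"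
proof -
  have "\<exists>x\<in>\<rat>. r < x \<and> x < r + 1 / Suc n" for n by (rule Rats_dense_in_real) simp
  then obtain q where q: "\<And>n. q n \<in> \<rat>" "\<And>n. r < q n" "\<And>n. q n < r + 1 / Suc n" by metis
  have "(\<lambda>n. r + 1 / real (Suc n)) \<longlonglongrightarrow> r + 0"
    by (intro tendsto_add tendsto_const LIMSEQ_Suc lim_1_over_n)
  then have lim: "(\<lambda>n. r + 1 / real (Suc n)) \<longlonglongrightarrow> r" by simp
  have "q \<longlonglongrightarrow> r"
  proof (rule tendsto_sandwich[OF _ _ tendsto_const lim])
    show "\<forall>\<^sub>F n in sequentially. r \<le> q n" using q(2) by (intro always_eventually allI less_imp_le)
    show "\<forall>\<^sub>F n in sequentially. q n \<le> r + 1 / real (Suc n)"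
      using q(3) by (intro always_eventually allI less_imp_le)
  qed
  moreover have "\<forall>n. q n \<in> \<rat>" using q(1) by blast
  ultimately show ?thesis by (rule that[rotated])
qed

lemma subspace_closure_rat_span:
  fixes Y :: "'b::real_normed_vector set"
  assumes "Y \<noteq> {}" shows "subspace (closure (rat_span Y))"
proof (rule subspaceI)
  obtain y where "y \<in> rat_span Y" using assms rat_span_superset by blast
  from rat_span_scale[OF this, of 0] show "0 \<in> closure (rat_span Y)"
    using closure_subset by auto
next
  fix x y assume "x \<in> closure (rat_span Y)" "y \<in> closure (rat_span Y)"
  then obtain u v where u: "\<And>n. u n \<in> rat_span Y" "u \<longlonglongrightarrow> x" and v: "\<And>n. v n \<in> rat_span Y" "v \<longlonglongrightarrow> y"
    unfolding closure_sequential by blast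
  have "(\<lambda>n. u n + v n) \<longlonglongrightarrow> x + y" by (intro tendsto_intros u v)
  moreover have "u n + v n \<in> rat_span Y" for n using u v rat_span_add by blast
  ultimately show "x + y \<in> closure (rat_span Y)"
    unfolding closure_sequential by (intro exI[of _ "\<lambda>n. u n + v n"]) simp
next
  fix r :: real and x assume "x \<in> closure (rat_span Y)"
  then obtain u where u: "\<And>n. u n \<in> rat_span Y" "u \<longlonglongrightarrow> x"
    unfolding closure_sequential by blast
  obtain q where q: "\<forall>n. q n \<in> \<rat>" "q \<longlonglongrightarrow> r" by (rule rational_sequence_tendsto[of r])
  have "(\<lambda>n. q n *\<^sub>R u n) \<longlonglongrightarrow> r *\<^sub>R x" by (intro tendsto_intros u q)
  moreover have "q n *\<^sub>R u n \<in> rat_span Y" for n by (rule rat_span_scale[OF u(1) q(1)[rule_format]])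
  ultimately show "r *\<^sub>R x \<in> closure (rat_span Y)"
    unfolding closure_sequential by (intro exI[of _ "\<lambda>n. q n *\<^sub>R u n"]) simp
qed

text \<open>Vectors \<open>y n\<close> at which the functionals of a dense sequence \<open>t\<close> attain half of their norms span a
dense subspace: otherwise some nonzero functional \<open>\<phi>\<close> vanishes on it, and then
\<open>norm (t n) / 2 \<le> (t n - \<phi>) (y n)\<close> keeps \<open>t n\<close> away from \<open>\<phi>\<close>.\<close>

lemma dense_seq_of_dense_seq_dual:
  assumes t: "dense_seq (t :: nat \<Rightarrow> 'b::real_normed_vector \<Rightarrow>\<^sub>L real)"
  shows "\<exists>s :: nat \<Rightarrow> 'b. dense_seq s"
proof -
  have "\<exists>y. norm y \<le> 1 \<and> norm (t n) / 2 \<le> blinfun_apply (t n) y" for n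
  proof (rule ccontr)
    assume no: "\<nexists>y. norm y \<le> 1 \<and> norm (t n) / 2 \<le> blinfun_apply (t n) y"
    have pos: "0 < norm (t n)" using no[THEN not_ex[THEN iffD1], THEN spec, of 0] by auto
    have le1: "blinfun_apply (t n) y \<le> norm (t n) / 2" if "norm y \<le> 1" for y
      using no that by (meson linear)
    have "norm (blinfun_apply (t n) x) \<le> norm (t n) / 2 * norm x" for x
    proof (cases "x = 0")
      case False
      from le1[of "x /\<^sub>R norm x"] le1[of "- (x /\<^sub>R norm x)"]
      have "\<bar>blinfun_apply (t n) (x /\<^sub>R norm x)\<bar> \<le> norm (t n) / 2"
        using False by (simp add: blinfun.minus_right)
      then show ?thesis using False by (simp add: blinfun.scaleR_right abs_mult field_simps)
    qed simp
    then have "norm (t n) \<le> norm (t n) / 2" by (intro norm_blinfun_bound) auto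
    then show False using pos by simp
  qed
  then obtain y where y: "\<And>n. norm (y n) \<le> 1" "\<And>n. norm (t n) / 2 \<le> blinfun_apply (t n) (y n)"
    by metis
  let ?N = "rat_span (range y)"
  have sub: "subspace (closure ?N)" by (rule subspace_closure_rat_span) simp
  have "closure ?N = UNIV"
  proof (rule ccontr)
    assume "closure ?N \<noteq> UNIV"
    then obtain x where x: "x \<notin> closure ?N" by blast
    have "closure ?N \<noteq> {}" using subspace_0[OF sub] by auto
    from x obtain d where d: "d > 0" "\<And>z. z \<in> closure ?N \<Longrightarrow> d \<le> dist x z"
      using closure_approachable[of x "closure ?N"] by (auto simp: not_less dist_commute)
    define Q where "Q = (\<lambda>z. (z - x, 0::real)) ` closure ?N"
    have "convex Q"
    proof (rule convexI)
      fix p p' and a b :: real assume p: "p \<in> Q" "p' \<in> Q" and ab: "0 \<le> a" "0 \<le> b" "a + b = 1"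
      from p obtain z z' where z: "z \<in> closure ?N" "z' \<in> closure ?N" "p = (z - x, 0)" "p' = (z' - x, 0)"
        by (auto simp: Q_def)
      have "a *\<^sub>R (z - x) + b *\<^sub>R (z' - x) = (a *\<^sub>R z + b *\<^sub>R z') - (a + b) *\<^sub>R x"
        by (simp add: algebra_simps)
      then have "a *\<^sub>R p + b *\<^sub>R p' = ((a *\<^sub>R z + b *\<^sub>R z') - x, 0)"
        using z ab by simp
      moreover have "a *\<^sub>R z + b *\<^sub>R z' \<in> closure ?N"
        using z sub by (simp add: subspace_add subspace_scale)
      ultimately show "a *\<^sub>R p + b *\<^sub>R p' \<in> Q" by (auto simp: Q_def)
    qed
    moreover have "convex_on UNIV (\<lambda>u::'b. norm u - d)"
      by (rule convex_on_norm_diff)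
    ultimately obtain l c where l: "linear_functional_on UNIV l" "\<And>u. - (norm u - d) \<le> l u + c"
      "\<And>z b. (z, b) \<in> Q \<Longrightarrow> l z + c \<le> b"
      using d(2) \<open>closure ?N \<noteq> {}\<close>
      by (rule_tac Hahn_Banach_sandwich[of UNIV Q "\<lambda>u. norm u - d"])
         (auto simp: Q_def dist_norm norm_minus_commute)
    have lin: "linear l" using l(1) by (simp add: linear_functional_on_UNIV_iff)
    have le: "\<bar>l u\<bar> \<le> norm u" for u
      by (rule linear_bounded_below_norm[OF lin, of "c - d"]) (use l(2) in \<open>simp add: algebra_simps\<close>)
    have lz: "l z + c \<le> l x" if "z \<in> closure ?N" for z
      using l(3)[of "z - x" 0] that linear_diff[OF lin] by (auto simp: Q_def)
    have c: "d \<le> c" using l(2)[of 0] linear_0[OF lin] by simp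
    \<comment> \<open>\<open>l\<close> is bounded above on a subspace, hence vanishes there\<close>
    have l0: "l z = 0" if z: "z \<in> closure ?N" for z
    proof (rule ccontr)
      assume "l z \<noteq> 0"
      have "((l x + 1) / l z) *\<^sub>R z \<in> closure ?N" using subspace_scale[OF sub z] .
      from lz[OF this] show False using c d(1) \<open>l z \<noteq> 0\<close> by (simp add: linear_scale[OF lin])
    qed
    have bl: "bounded_linear l" by (rule bounded_linear_of_le_norm[OF lin le])
    define \<phi> where "\<phi> = Blinfun l"
    have \<phi>: "blinfun_apply \<phi> = l" by (simp add: \<phi>_def bounded_linear_Blinfun_apply[OF bl])
    have "l x \<noteq> 0" using lz[OF subspace_0[OF sub]] l0[OF subspace_0[OF sub]] c d(1) by simp
    then have "\<phi> \<noteq> 0" using \<phi> by auto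
    then have "norm \<phi> / 3 > 0" by simp
    then obtain n where n: "dist \<phi> (t n) < norm \<phi> / 3" using t unfolding dense_seq_def by blast
    have "y n \<in> closure ?N" using rat_span_superset[of "y n" "range y"] closure_subset by blast
    then have "blinfun_apply (t n) (y n) = blinfun_apply (t n - \<phi>) (y n)"
      using l0 \<phi> by (simp add: blinfun.diff_left)
    also have "\<dots> \<le> norm (t n - \<phi>) * norm (y n)"
      using norm_blinfun[of "t n - \<phi>" "y n"] by simp
    also have "\<dots> \<le> norm (t n - \<phi>)" using y(1)[of n] by (simp add: mult_left_le)
    finally have "norm (t n) \<le> 2 * dist \<phi> (t n)" using y(2)[of n] by (simp add: dist_norm norm_minus_commute)
    moreover have "norm \<phi> \<le> norm (t n) + dist \<phi> (t n)"
      using norm_triangle_ineq[of "t n" "\<phi> - t n"] by (simp add: dist_norm)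
    ultimately show False using n by simp
  qed
  then have "\<exists>z\<in>?N. dist x z < e" if "e > 0" for x e
    using that closure_approachable[of x ?N] by (auto simp: dist_commute)
  from dense_seq_of_countable[OF countable_rat_span[of "range y"] this] show ?thesis by blast
qed

definition eval_blinfun :: "'b::real_normed_vector \<Rightarrow> ('b \<Rightarrow>\<^sub>L real) \<Rightarrow>\<^sub>L real" where
  "eval_blinfun x = Blinfun (\<lambda>f. blinfun_apply f x)"

lemma eval_blinfun_apply [simp]: "blinfun_apply (eval_blinfun x) f = blinfun_apply f x"
proof -
  have "bounded_linear (\<lambda>f :: 'a \<Rightarrow>\<^sub>L real. blinfun_apply f x)"
    by (rule blinfun.bounded_linear_left)
  then show ?thesis by (simp add: eval_blinfun_def bounded_linear_Blinfun_apply)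
qed

lemma norm_eval_blinfun [simp]: "norm (eval_blinfun x) = norm x"
proof (rule antisym)
  show "norm (eval_blinfun x) \<le> norm x"
  proof (rule norm_blinfun_bound)
    show "norm (blinfun_apply (eval_blinfun x) f) \<le> norm x * norm f" for f
      using norm_blinfun[of f x] by (simp add: mult.commute)
  qed simp
  obtain \<phi> :: "'a \<Rightarrow>\<^sub>L real" where \<phi>: "norm \<phi> \<le> 1" "blinfun_apply \<phi> x = norm x"
    by (rule norming_functional_exists[of x])
  have "norm x \<le> norm (eval_blinfun x) * norm \<phi>"
    using norm_blinfun[of "eval_blinfun x" \<phi>] \<phi>(2) by simp
  also have "\<dots> \<le> norm (eval_blinfun x)" using \<phi>(1) by (simp add: mult_left_le)
  finally show "norm x \<le> norm (eval_blinfun x)" .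
qed

lemma eval_blinfun_diff: "eval_blinfun (x - y) = eval_blinfun x - eval_blinfun y"
  by (rule blinfun_eqI) (simp add: blinfun.diff_left blinfun.diff_right)

text \<open>The inverse of the canonical embedding into the bidual; it is measurable because it is isometric.\<close>

lemma reflexive_eval_inverse:
  fixes T :: "'b::real_normed_vector itself"
  assumes "reflexive_space T"
  obtains J :: "(('b::real_normed_vector \<Rightarrow>\<^sub>L real) \<Rightarrow>\<^sub>L real) \<Rightarrow> 'b"
  where "\<And>\<Lambda> f. blinfun_apply f (J \<Lambda>) = blinfun_apply \<Lambda> f" "\<And>\<Lambda>. norm (J \<Lambda>) = norm \<Lambda>"
    "J \<in> borel_measurable borel"
proof -
  have "\<forall>\<Lambda> :: ('b \<Rightarrow>\<^sub>L real) \<Rightarrow>\<^sub>L real. \<exists>x. \<Lambda> = eval_blinfun x"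
    using assms unfolding reflexive_space_def by (metis blinfun_eqI eval_blinfun_apply)
  then obtain J where J: "\<And>\<Lambda> :: ('b \<Rightarrow>\<^sub>L real) \<Rightarrow>\<^sub>L real. \<Lambda> = eval_blinfun (J \<Lambda>)" by metis
  have app: "blinfun_apply f (J \<Lambda>) = blinfun_apply \<Lambda> f" for \<Lambda> f
    using J[of \<Lambda>] by (metis eval_blinfun_apply)
  have nrm: "norm (J \<Lambda>) = norm \<Lambda>" for \<Lambda> using J[of \<Lambda>] by (metis norm_eval_blinfun)
  have "dist (J \<Lambda>) (J \<Lambda>') = dist \<Lambda> \<Lambda>'" for \<Lambda> \<Lambda>'
    using J[of \<Lambda>] J[of \<Lambda>'] by (metis dist_norm eval_blinfun_diff norm_eval_blinfun)
  then have "continuous_on UNIV J" unfolding continuous_on_iff by auto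
  then show ?thesis using that[OF app nrm] borel_measurable_continuous_onI by blast
qed

lemma reflexive_dense_seq_dual:
  fixes T :: "'b::{real_normed_vector, second_countable_topology} itself"
  assumes "reflexive_space T"
  shows "\<exists>t. dense_seq (t :: nat \<Rightarrow> 'b \<Rightarrow>\<^sub>L real)"
    "\<exists>u. dense_seq (u :: nat \<Rightarrow> ('b \<Rightarrow>\<^sub>L real) \<Rightarrow>\<^sub>L real)"
proof -
  obtain s :: "nat \<Rightarrow> 'b" where s: "dense_seq s" using dense_seq_exists by blast
  have "dense_seq (\<lambda>n. eval_blinfun (s n))"
    unfolding dense_seq_def
  proof (intro conjI allI impI)
    show "eval_blinfun (s 0) = 0"
      using s norm_eval_blinfun[of "s 0"] by (simp add: dense_seq_def del: norm_eval_blinfun)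
    fix \<Lambda> :: "('b \<Rightarrow>\<^sub>L real) \<Rightarrow>\<^sub>L real" and e :: real assume "e > 0"
    obtain x where x: "\<Lambda> = eval_blinfun x"
      using assms unfolding reflexive_space_def by (metis blinfun_eqI eval_blinfun_apply)
    obtain n where "dist x (s n) < e" using s \<open>e > 0\<close> unfolding dense_seq_def by blast
    then show "\<exists>n. dist \<Lambda> (eval_blinfun (s n)) < e"
      by (intro exI[of _ n]) (simp add: x dist_norm flip: eval_blinfun_diff)
  qed
  then show "\<exists>u :: nat \<Rightarrow> ('b \<Rightarrow>\<^sub>L real) \<Rightarrow>\<^sub>L real. dense_seq u" by blast
  then show "\<exists>t :: nat \<Rightarrow> 'b \<Rightarrow>\<^sub>L real. dense_seq t" using dense_seq_of_dense_seq_dual by blast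
qed

text \<open>Rational linearity and the Lipschitz bound pass to limits along a dense set. This assembles a
functional from countably many of its values, as needed for densities that are only determined
up to null sets.\<close>

lemma rational_functional_extension:
  fixes s :: "nat \<Rightarrow> 'b::real_normed_vector" and a :: "'b \<Rightarrow> real"
  assumes s: "dense_seq s" and sS: "\<And>n. s n \<in> S"
    and S_add: "\<And>x y. x \<in> S \<Longrightarrow> y \<in> S \<Longrightarrow> x + y \<in> S"
    and S_scale: "\<And>x r. x \<in> S \<Longrightarrow> r \<in> \<rat> \<Longrightarrow> r *\<^sub>R x \<in> S"
    and a_add: "\<And>x y. x \<in> S \<Longrightarrow> y \<in> S \<Longrightarrow> a (x + y) = a x + a y"
    and a_scale: "\<And>x r. x \<in> S \<Longrightarrow> r \<in> \<rat> \<Longrightarrow> a (r *\<^sub>R x) = r * a x"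
    and a_le: "\<And>x. x \<in> S \<Longrightarrow> \<bar>a x\<bar> \<le> D * norm x" and D: "D \<ge> 0"
  shows "\<exists>v :: 'b \<Rightarrow>\<^sub>L real. (\<forall>x\<in>S. blinfun_apply v x = a x) \<and> norm v \<le> D"
proof -
  have a_diff: "\<bar>a x - a y\<bar> \<le> D * norm (x - y)" if "x \<in> S" "y \<in> S" for x y
  proof -
    have "(-1) *\<^sub>R y \<in> S" using that S_scale[of y "-1"] by simp
    then have "a (x + (-1) *\<^sub>R y) = a x - a y" "x + (-1) *\<^sub>R y \<in> S"
      using that a_add[of x "(-1) *\<^sub>R y"] a_scale[of y "-1"] S_add[of x "(-1) *\<^sub>R y"] by simp_all
    then show ?thesis using a_le[of "x + (-1) *\<^sub>R y"] by simp
  qed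
  define \<sigma> where "\<sigma> x n = s (near_idx s n x)" for x n
  have \<sigma>: "\<sigma> x n \<in> S" "(\<lambda>n. \<sigma> x n) \<longlonglongrightarrow> x" for x n
    using sS near_idx_tendsto[OF s] by (auto simp: \<sigma>_def)
  have "convergent (\<lambda>n. a (\<sigma> x n))" for x
  proof -
    have "Cauchy (\<lambda>n. a (\<sigma> x n))"
    proof (rule metric_CauchyI)
      fix e :: real assume e: "e > 0"
      then have "e / (D + 1) > 0" using D by simp
      moreover have "Cauchy (\<sigma> x)" using \<sigma>(2)[of x] by (rule LIMSEQ_imp_Cauchy)
      ultimately obtain N where N: "\<And>m n. m \<ge> N \<Longrightarrow> n \<ge> N \<Longrightarrow> dist (\<sigma> x m) (\<sigma> x n) < e / (D + 1)"
        by (meson metric_CauchyD)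
      have "dist (a (\<sigma> x m)) (a (\<sigma> x n)) < e" if "m \<ge> N" "n \<ge> N" for m n
      proof -
        have "dist (a (\<sigma> x m)) (a (\<sigma> x n)) \<le> (D + 1) * dist (\<sigma> x m) (\<sigma> x n)"
          using a_diff[OF \<sigma>(1) \<sigma>(1), of x m x n] by (simp add: dist_norm algebra_simps) (smt (verit) norm_ge_zero)
        also have "\<dots> < e" using N[OF that] D by (simp add: field_simps)
        finally show ?thesis .
      qed
      then show "\<exists>M. \<forall>m\<ge>M. \<forall>n\<ge>M. dist (a (\<sigma> x m)) (a (\<sigma> x n)) < e" by blast
    qed
    then show ?thesis by (simp add: Cauchy_convergent_iff)
  qed
  then obtain v where v: "\<And>x. (\<lambda>n. a (\<sigma> x n)) \<longlonglongrightarrow> v x" unfolding convergent_def by metis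
  have v_lim: "(\<lambda>n. a (w n)) \<longlonglongrightarrow> v x" if w: "\<And>n. w n \<in> S" "w \<longlonglongrightarrow> x" for w x
  proof -
    have "(\<lambda>n. D * norm (w n - \<sigma> x n)) \<longlonglongrightarrow> D * norm (x - x)"
      by (intro tendsto_intros w \<sigma>)
    then have "(\<lambda>n. D * norm (w n - \<sigma> x n)) \<longlonglongrightarrow> 0" by simp
    then have "(\<lambda>n. a (w n) - a (\<sigma> x n)) \<longlonglongrightarrow> 0"
      by (rule Lim_null_comparison[rotated]) (use a_diff w \<sigma> in auto)
    from tendsto_add[OF this v[of x]] show ?thesis by simp
  qed
  have v_add: "v (x + y) = v x + v y" for x y
  proof (rule LIMSEQ_unique)
    show "(\<lambda>n. a (\<sigma> x n + \<sigma> y n)) \<longlonglongrightarrow> v (x + y)"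
      by (intro v_lim S_add tendsto_add \<sigma>)
    show "(\<lambda>n. a (\<sigma> x n + \<sigma> y n)) \<longlonglongrightarrow> v x + v y"
      using tendsto_add[OF v[of x] v[of y]] a_add \<sigma> by simp
  qed
  have v_scale: "v (r *\<^sub>R x) = r * v x" for r x
  proof -
    obtain q where q: "\<forall>n. q n \<in> \<rat>" "q \<longlonglongrightarrow> r" by (rule rational_sequence_tendsto[of r])
    have "(\<lambda>n. a (q n *\<^sub>R \<sigma> x n)) \<longlonglongrightarrow> v (r *\<^sub>R x)"
      by (intro v_lim S_scale tendsto_scaleR \<sigma> q(1)[rule_format] q(2))
    moreover have "(\<lambda>n. a (q n *\<^sub>R \<sigma> x n)) \<longlonglongrightarrow> r * v x"
      using tendsto_mult[OF q(2) v[of x]] a_scale \<sigma> q(1) by simp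
    ultimately show ?thesis by (rule LIMSEQ_unique)
  qed
  have v_le: "\<bar>v x\<bar> \<le> D * norm x" for x
  proof (rule LIMSEQ_le)
    show "(\<lambda>n. \<bar>a (\<sigma> x n)\<bar>) \<longlonglongrightarrow> \<bar>v x\<bar>" by (intro tendsto_intros v)
    show "(\<lambda>n. D * norm (\<sigma> x n)) \<longlonglongrightarrow> D * norm x" by (intro tendsto_intros \<sigma>)
    show "\<exists>N. \<forall>n\<ge>N. \<bar>a (\<sigma> x n)\<bar> \<le> D * norm (\<sigma> x n)" using a_le \<sigma> by blast
  qed
  have v_S: "v x = a x" if "x \<in> S" for x
    using v_lim[of "\<lambda>n. x" x] that by (simp add: LIMSEQ_const_iff)
  have bl: "bounded_linear v"
     by (rule bounded_linear_intro[of _ D]) (use v_add v_scale v_le in \<open>auto simp: mult.commute\<close>)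
  have "norm (Blinfun v) \<le> D"
    using v_le D by (intro norm_blinfun_bound) (auto simp: bounded_linear_Blinfun_apply[OF bl])
  then show ?thesis
    using v_S by (intro exI[of _ "Blinfun v"]) (simp add: bounded_linear_Blinfun_apply[OF bl])
qed

section \<open>Lebesgue--Bochner functions and their energies\<close>

text \<open>With this normalisation the energies for conjugate exponents are conjugate to each other
under the integral pairing, by Young's inequality and its case of equality.\<close>

definition Lp_energy :: "'w measure \<Rightarrow> real \<Rightarrow> ('w \<Rightarrow> 'b::real_normed_vector) \<Rightarrow> real" where
  "Lp_energy M p f = (\<integral>\<omega>. norm (f \<omega>) powr p \<partial>M) / p"

lemma Lp_funD:
  assumes "f \<in> Lp_fun M p"
  shows "f \<in> borel_measurable M" "integrable M (\<lambda>\<omega>. norm (f \<omega>) powr p)"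
  using assms by (auto simp: Lp_fun_def)

lemma Lp_energy_nonneg: "p > 0 \<Longrightarrow> 0 \<le> Lp_energy M p f"
  by (simp add: Lp_energy_def)

lemma powr_convex_nonneg:
  fixes a b x y p :: real
  assumes "p \<ge> 1" "a \<ge> 0" "b \<ge> 0" "a + b = 1" "x \<ge> 0" "y \<ge> 0"
  shows "(a * x + b * y) powr p \<le> a * x powr p + b * y powr p"
proof -
  have le: "c powr p \<le> c" if "0 \<le> c" "c \<le> 1" for c :: real
    using that assms(1) powr_mono'[of 1 p c] by (cases "c = 0") auto
  have edge: "(c * z) powr p \<le> c * z powr p" if "0 \<le> c" "c \<le> 1" "z \<ge> 0" for c z :: real
    using le[OF that(1,2)] that by (simp add: powr_mult mult_right_mono)
  show ?thesis
  proof (cases "x = 0 \<or> y = 0")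
    case True
    then show ?thesis using edge[of a x] edge[of b y] assms by auto
  next
    case False
    then have "x \<in> {0<..}" "y \<in> {0<..}" using assms by auto
    then show ?thesis using powr_convex[OF assms(1)] assms(2-4)
      unfolding convex_on_def by (metis real_scaleR_def)
  qed
qed

lemma norm_powr_add_le:
  fixes x y :: "'b::real_normed_vector"
  assumes "p \<ge> 1"
  shows "norm (x + y) powr p \<le> 2 powr p * (norm x powr p + norm y powr p)"
proof -
  have "norm (x + y) powr p \<le> (2 * max (norm x) (norm y)) powr p"
    using assms norm_triangle_ineq[of x y] by (intro powr_mono2) auto
  also have "\<dots> = 2 powr p * max (norm x) (norm y) powr p"
    by (simp add: powr_mult)
  also have "max (norm x) (norm y) powr p \<le> norm x powr p + norm y powr p"
    by (auto simp: max_def)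
  finally show ?thesis by (simp add: mult_left_mono)
qed

lemma Lp_fun_scale: 
  fixes f :: "'w \<Rightarrow> 'b::real_normed_vector"
  assumes f: "f \<in> Lp_fun M p" shows "(\<lambda>\<omega>. a *\<^sub>R f \<omega>) \<in> Lp_fun M p"
proof -
  have "(\<lambda>\<omega>. a *\<^sub>R f \<omega>) \<in> borel_measurable M"
    by (rule borel_measurable_continuous_on[OF _ Lp_funD(1)[OF f]]) (intro continuous_intros)
  moreover have "integrable M (\<lambda>\<omega>. \<bar>a\<bar> powr p * norm (f \<omega>) powr p)"
    using Lp_funD(2)[OF f] by (rule integrable_mult_right)
  ultimately show ?thesis by (simp add: Lp_fun_def powr_mult)
qed

lemma Lp_energy_scale: "Lp_energy M p (\<lambda>\<omega>. a *\<^sub>R f \<omega>) = \<bar>a\<bar> powr p * Lp_energy M p f"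
  by (simp add: Lp_energy_def powr_mult)

lemma Lp_fun_add:
  fixes f g :: "'w \<Rightarrow> 'b::real_normed_vector"
  assumes s: "dense_seq (s :: nat \<Rightarrow> 'b)" and p: "p \<ge> 1"
    and f: "f \<in> Lp_fun M p" and g: "g \<in> Lp_fun M p"
  shows "(\<lambda>\<omega>. f \<omega> + g \<omega>) \<in> Lp_fun M p"
proof -
  have m: "(\<lambda>\<omega>. f \<omega> + g \<omega>) \<in> borel_measurable M"
    using borel_measurable_lincomb_dense[OF s Lp_funD(1)[OF f] Lp_funD(1)[OF g], of 1 1] by simp
  have "integrable M (\<lambda>\<omega>. norm (f \<omega> + g \<omega>) powr p)"
  proof (rule Bochner_Integration.integrable_bound)
    show "integrable M (\<lambda>\<omega>. 2 powr p * (norm (f \<omega>) powr p + norm (g \<omega>) powr p))"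
      using Lp_funD(2)[OF f] Lp_funD(2)[OF g] by simp
    show "(\<lambda>\<omega>. norm (f \<omega> + g \<omega>) powr p) \<in> borel_measurable M"
      using m by measurable
  qed (use norm_powr_add_le[OF p] in auto)
  with m show ?thesis by (simp add: Lp_fun_def)
qed

lemma subspace_Lp_fun:
  fixes s :: "nat \<Rightarrow> 'b::real_normed_vector"
  assumes "dense_seq s" "p \<ge> 1"
  shows "subspace (Lp_fun M p :: ('w \<Rightarrow> 'b) set)"
proof (rule subspaceI)
  show "0 \<in> (Lp_fun M p :: ('w \<Rightarrow> 'b) set)" using assms(2) by (simp add: Lp_fun_def zero_fun_def)
  fix f g :: "'w \<Rightarrow> 'b" assume "f \<in> Lp_fun M p" "g \<in> Lp_fun M p"
  then show "f + g \<in> Lp_fun M p" using Lp_fun_add[OF assms] by (simp add: plus_fun_def)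
next
  fix c and f :: "'w \<Rightarrow> 'b" assume "f \<in> Lp_fun M p"
  then show "c *\<^sub>R f \<in> Lp_fun M p" using Lp_fun_scale[of f] by (simp add: scaleR_fun_def)
qed

lemma Lp_fun_diff:
  fixes f g :: "'w \<Rightarrow> 'b::real_normed_vector"
  assumes s: "dense_seq (s :: nat \<Rightarrow> 'b)" and p: "p \<ge> 1"
    and f: "f \<in> Lp_fun M p" and g: "g \<in> Lp_fun M p"
  shows "(\<lambda>\<omega>. f \<omega> - g \<omega>) \<in> Lp_fun M p"
  using Lp_fun_add[OF s p f Lp_fun_scale[OF g, of "-1"]] by simp

lemma convex_on_Lp_energy:
  fixes s :: "nat \<Rightarrow> 'b::real_normed_vector"
  assumes s: "dense_seq s" and p: "p \<ge> 1"
  shows "convex_on (Lp_fun M p) (Lp_energy M p :: ('w \<Rightarrow> 'b) \<Rightarrow> real)"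
  unfolding convex_on_def
proof (intro conjI ballI allI impI)
  show "convex (Lp_fun M p :: ('w \<Rightarrow> 'b) set)"
    by (rule subspace_imp_convex[OF subspace_Lp_fun[OF assms]])
  fix f g :: "'w \<Rightarrow> 'b" and a b :: real
  assume f: "f \<in> Lp_fun M p" and g: "g \<in> Lp_fun M p" and ab: "0 \<le> a" "0 \<le> b" "a + b = 1"
  note if_ = Lp_funD(2)[OF f] and ig = Lp_funD(2)[OF g]
  have fg: "(\<lambda>\<omega>. a *\<^sub>R f \<omega> + b *\<^sub>R g \<omega>) \<in> Lp_fun M p"
    by (intro Lp_fun_add[OF s p] Lp_fun_scale f g)
  have "(\<integral>\<omega>. norm (a *\<^sub>R f \<omega> + b *\<^sub>R g \<omega>) powr p \<partial>M) \<le>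
      (\<integral>\<omega>. a * norm (f \<omega>) powr p + b * norm (g \<omega>) powr p \<partial>M)"
  proof (rule integral_mono)
    show "integrable M (\<lambda>\<omega>. norm (a *\<^sub>R f \<omega> + b *\<^sub>R g \<omega>) powr p)" by (rule Lp_funD(2)[OF fg])
    show "integrable M (\<lambda>\<omega>. a * norm (f \<omega>) powr p + b * norm (g \<omega>) powr p)"
      using if_ ig by simp
    fix \<omega>
    have "norm (a *\<^sub>R f \<omega> + b *\<^sub>R g \<omega>) powr p \<le> (a * norm (f \<omega>) + b * norm (g \<omega>)) powr p"
      using ab p norm_triangle_ineq[of "a *\<^sub>R f \<omega>" "b *\<^sub>R g \<omega>"] by (intro powr_mono2) auto
    also have "\<dots> \<le> a * norm (f \<omega>) powr p + b * norm (g \<omega>) powr p"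
      using ab p by (intro powr_convex_nonneg) auto
    finally show "norm (a *\<^sub>R f \<omega> + b *\<^sub>R g \<omega>) powr p \<le> a * norm (f \<omega>) powr p + b * norm (g \<omega>) powr p" .
  qed
  also have "\<dots> = a * (\<integral>\<omega>. norm (f \<omega>) powr p \<partial>M) + b * (\<integral>\<omega>. norm (g \<omega>) powr p \<partial>M)"
    using if_ ig by simp
  finally have "(\<integral>\<omega>. norm (a *\<^sub>R f \<omega> + b *\<^sub>R g \<omega>) powr p \<partial>M) / p \<le>
      (a * (\<integral>\<omega>. norm (f \<omega>) powr p \<partial>M) + b * (\<integral>\<omega>. norm (g \<omega>) powr p \<partial>M)) / p"
    using p by (intro divide_right_mono) auto
  then show "Lp_energy M p (a *\<^sub>R f + b *\<^sub>R g) \<le> a * Lp_energy M p f + b * Lp_energy M p g"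
    by (simp add: Lp_energy_def plus_fun_def scaleR_fun_def add_divide_distrib)
qed

lemma bounded_Lp_fun:
  fixes f :: "'w \<Rightarrow> 'b::real_normed_vector"
  assumes "finite_measure M" "p \<ge> 0" and [measurable]: "f \<in> borel_measurable M"
    and "\<And>\<omega>. \<omega> \<in> space M \<Longrightarrow> norm (f \<omega>) \<le> B"
  shows "f \<in> Lp_fun M p"
proof -
  interpret finite_measure M by fact
  have "integrable M (\<lambda>\<omega>. norm (f \<omega>) powr p)"
    using assms(2,4) by (intro integrable_const_bound[of _ "B powr p"]) (auto intro!: powr_mono2)
  then show ?thesis by (simp add: Lp_fun_def)
qed

lemma Lp_fun_indicator:
  fixes f :: "'w \<Rightarrow> 'b::real_normed_vector"
  assumes s: "dense_seq (s :: nat \<Rightarrow> 'b)" and f: "f \<in> Lp_fun M p" and [measurable]: "E \<in> sets M"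
  shows "(\<lambda>\<omega>. indicator E \<omega> *\<^sub>R f \<omega>) \<in> Lp_fun M p"
proof -
  note [measurable] = Lp_funD(1)[OF f]
  have m: "(\<lambda>\<omega>. indicat_real E \<omega> *\<^sub>R f \<omega>) \<in> borel_measurable M"
    by (rule borel_measurable_scaleR_dense[OF s]) measurable
  have "integrable M (\<lambda>\<omega>. norm (indicat_real E \<omega> *\<^sub>R f \<omega>) powr p)"
  proof (rule Bochner_Integration.integrable_bound[OF Lp_funD(2)[OF f]])
    show "(\<lambda>\<omega>. norm (indicat_real E \<omega> *\<^sub>R f \<omega>) powr p) \<in> borel_measurable M"
      using m by measurable
  qed (auto simp: indicator_def)
  with m show ?thesis by (simp add: Lp_fun_def)
qed

lemma conjugate_exponent_gt_1:
  fixes p q :: real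
  assumes "1 < p" "1 / p + 1 / q = 1" shows "1 < q"
proof -
  have "0 < 1 / p" "1 / p < 1" using assms(1) by auto
  then have "0 < 1 / q" "1 / q < 1" using assms(2) by linarith+
  then show ?thesis by (simp add: zero_less_divide_iff divide_less_eq_1)
qed

lemma pairing_Young:
  fixes v :: "'b::real_normed_vector \<Rightarrow>\<^sub>L real"
  assumes "1 < p" "1 / p + 1 / q = 1"
  shows "\<bar>blinfun_apply v x\<bar> \<le> norm x powr p / p + norm v powr q / q"
  using norm_blinfun[of v x] Youngs_inequality[OF assms(1) conjugate_exponent_gt_1[OF assms] assms(2), of "norm x" "norm v"]
  by (simp add: mult.commute)

lemma integrable_pairing:
  fixes v :: "'w \<Rightarrow> 'b::real_normed_vector \<Rightarrow>\<^sub>L real"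
  assumes s: "dense_seq (s :: nat \<Rightarrow> 'b)" and pq: "1 < p" "1 / p + 1 / q = 1"
    and v: "v \<in> Lp_fun M q" and f: "f \<in> Lp_fun M p"
  shows "integrable M (\<lambda>\<omega>. blinfun_apply (v \<omega>) (f \<omega>))"
    "\<bar>\<integral>\<omega>. blinfun_apply (v \<omega>) (f \<omega>) \<partial>M\<bar> \<le> Lp_energy M p f + Lp_energy M q v"
proof -
  have int: "integrable M (\<lambda>\<omega>. norm (f \<omega>) powr p / p + norm (v \<omega>) powr q / q)"
    using Lp_funD(2)[OF f] Lp_funD(2)[OF v] by simp
  have le: "norm (blinfun_apply (v \<omega>) (f \<omega>)) \<le> norm (f \<omega>) powr p / p + norm (v \<omega>) powr q / q" for \<omega>
    using pairing_Young[OF pq] by simp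
  show 1: "integrable M (\<lambda>\<omega>. blinfun_apply (v \<omega>) (f \<omega>))"
  proof (rule Bochner_Integration.integrable_bound[OF int])
    show "(\<lambda>\<omega>. blinfun_apply (v \<omega>) (f \<omega>)) \<in> borel_measurable M"
      by (rule borel_measurable_blinfun_apply_dense[OF s Lp_funD(1)[OF v] Lp_funD(1)[OF f]])
  qed (use le in \<open>auto intro!: always_eventually order_trans[OF _ abs_ge_self]\<close>)
  have "\<bar>\<integral>\<omega>. blinfun_apply (v \<omega>) (f \<omega>) \<partial>M\<bar> \<le> (\<integral>\<omega>. \<bar>blinfun_apply (v \<omega>) (f \<omega>)\<bar> \<partial>M)"
    by (rule integral_abs_bound)
  also have "\<dots> \<le> (\<integral>\<omega>. norm (f \<omega>) powr p / p + norm (v \<omega>) powr q / q \<partial>M)"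
    using 1 int le by (intro integral_mono) auto
  also have "\<dots> = Lp_energy M p f + Lp_energy M q v"
    using Lp_funD(2)[OF f] Lp_funD(2)[OF v] by (simp add: Lp_energy_def)
  finally show "\<bar>\<integral>\<omega>. blinfun_apply (v \<omega>) (f \<omega>) \<partial>M\<bar> \<le> Lp_energy M p f + Lp_energy M q v" .
qed

text \<open>Smallness on sets of small probability gives continuity at the empty set, hence countable
additivity, as well as absolute continuity; the rest is the Radon--Nikodym theorem.\<close>

lemma (in prob_space) additive_density_exists:
  fixes \<alpha> :: "'a set \<Rightarrow> real"
  assumes nonneg: "\<And>E. E \<in> sets M \<Longrightarrow> 0 \<le> \<alpha> E"
    and add: "\<And>E F. E \<in> sets M \<Longrightarrow> F \<in> sets M \<Longrightarrow> E \<inter> F = {} \<Longrightarrow> \<alpha> (E \<union> F) = \<alpha> E + \<alpha> F"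
    and small: "\<And>e. e > 0 \<Longrightarrow> \<exists>d>0. \<forall>E\<in>sets M. prob E < d \<longrightarrow> \<alpha> E < e"
  obtains D where "integrable M D" "\<And>\<omega>. 0 \<le> D \<omega>"
    "\<And>E. E \<in> sets M \<Longrightarrow> \<alpha> E = set_lebesgue_integral M E D"
proof -
  define N where "N = measure_of (space M) (sets M) (\<lambda>E. ennreal (\<alpha> E))"
  have sets_N [simp]: "sets N = sets M" and space_N [simp]: "space N = space M" by (auto simp: N_def)
  have empty: "\<alpha> {} = 0" using add[of "{}" "{}"] by simp
  have pos: "positive (sets M) (\<lambda>E. ennreal (\<alpha> E))" by (simp add: positive_def empty)
  have "countably_additive (sets M) (\<lambda>E. ennreal (\<alpha> E))"
  proof (rule sets.empty_continuous_imp_countably_additive[OF pos])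
    show "additive (sets M) (\<lambda>E. ennreal (\<alpha> E))"
      by (auto simp: additive_def add nonneg ennreal_plus)
    show "\<forall>A\<in>sets M. ennreal (\<alpha> A) \<noteq> \<infinity>" by simp
    fix A :: "nat \<Rightarrow> 'a set" assume A: "range A \<subseteq> sets M" "decseq A" "(\<Inter>i. A i) = {}"
    have "(\<lambda>i. prob (A i)) \<longlonglongrightarrow> prob (\<Inter>i. A i)"
      using A by (intro finite_Lim_measure_decseq) auto
    then have lim: "(\<lambda>i. prob (A i)) \<longlonglongrightarrow> 0" by (simp add: A)
    have "(\<lambda>i. \<alpha> (A i)) \<longlonglongrightarrow> 0"
    proof (rule LIMSEQ_I)
      fix e :: real assume "e > 0"
      then obtain d where d: "d > 0" "\<And>E. E \<in> sets M \<Longrightarrow> prob E < d \<Longrightarrow> \<alpha> E < e" using small by blast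
      obtain n0 where "\<And>n. n \<ge> n0 \<Longrightarrow> norm (prob (A n) - 0) < d" using LIMSEQ_D[OF lim d(1)] by blast
      then have "norm (\<alpha> (A n) - 0) < e" if "n \<ge> n0" for n
        using d(2)[of "A n"] nonneg[of "A n"] A(1) that by (simp add: range_subsetD)
      then show "\<exists>no. \<forall>n\<ge>no. norm (\<alpha> (A n) - 0) < e" by blast
    qed
    then show "(\<lambda>i. ennreal (\<alpha> (A i))) \<longlonglongrightarrow> 0"
      using tendsto_ennrealI[of "\<lambda>i. \<alpha> (A i)" 0] by simp
  qed
  then have em: "emeasure N E = ennreal (\<alpha> E)" if "E \<in> sets M" for E
    unfolding N_def using that pos by (intro emeasure_measure_of_sigma sets.sigma_algebra_axioms)
  have "absolutely_continuous M N"
    unfolding absolutely_continuous_def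
  proof
    fix E assume E: "E \<in> null_sets M"
    have "\<alpha> E \<le> 0"
    proof (rule field_le_epsilon)
      fix e :: real assume "e > 0"
      then obtain d where d: "d > 0" "\<forall>E\<in>sets M. prob E < d \<longrightarrow> \<alpha> E < e" using small by blast
      moreover have "prob E = 0" using E by (simp add: null_sets_def measure_def)
      ultimately show "\<alpha> E \<le> 0 + e" using E by (auto intro: less_imp_le simp: null_sets_def)
    qed
    then show "E \<in> null_sets N" using E em[of E] by (auto simp: null_sets_def ennreal_neg)
  qed
  from Radon_Nikodym[OF this] obtain f where f [measurable]: "f \<in> borel_measurable M" and fN: "density M f = N"
    by auto
  have fE: "(\<integral>\<^sup>+\<omega>. f \<omega> * indicator E \<omega> \<partial>M) = ennreal (\<alpha> E)" if "E \<in> sets M" for E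
    using emeasure_density[OF f that] em[OF that] by (simp add: fN)
  define D where "D \<omega> = enn2real (f \<omega>)" for \<omega>
  have "(\<integral>\<^sup>+\<omega>. f \<omega> \<partial>M) = ennreal (\<alpha> (space M))"
    using fE[of "space M"] by (simp cong: nn_integral_cong_simp)
  then have "AE \<omega> in M. f \<omega> \<noteq> \<infinity>" by (intro nn_integral_noteq_infinite) auto
  then have fD: "AE \<omega> in M. f \<omega> = ennreal (D \<omega>)"
    by eventually_elim (simp add: D_def less_top)
  have [measurable]: "D \<in> borel_measurable M" unfolding D_def by measurable
  have nnD: "(\<integral>\<^sup>+\<omega>. ennreal (indicator E \<omega> * D \<omega>) \<partial>M) = ennreal (\<alpha> E)" if "E \<in> sets M" for E
  proof -
    have "(\<integral>\<^sup>+\<omega>. ennreal (indicator E \<omega> * D \<omega>) \<partial>M) = (\<integral>\<^sup>+\<omega>. f \<omega> * indicator E \<omega> \<partial>M)"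
      by (rule nn_integral_cong_AE) (use fD in \<open>eventually_elim, auto split: split_indicator\<close>)
    then show ?thesis using fE[OF that] by simp
  qed
  have D0: "0 \<le> D \<omega>" for \<omega> by (simp add: D_def)
  show ?thesis
  proof (rule that)
    have "(\<integral>\<^sup>+\<omega>. ennreal (D \<omega>) \<partial>M) = ennreal (\<alpha> (space M))"
      using nnD[of "space M"] by (simp cong: nn_integral_cong_simp)
    then show "integrable M D" using D0 by (intro integrableI_nonneg) auto
    show "0 \<le> D \<omega>" for \<omega> by (rule D0)
    show "\<alpha> E = set_lebesgue_integral M E D" if [measurable]: "E \<in> sets M" for E
    proof -
      have "(\<integral>\<omega>. indicator E \<omega> * D \<omega> \<partial>M) = enn2real (ennreal (\<alpha> E))"
        using nnD[OF that] D0 by (subst integral_eq_nn_integral) auto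
      then show ?thesis using nonneg[OF that] by (simp add: set_lebesgue_integral_def)
    qed
  qed
qed

text \<open>Pettis' criterion in a separable dual: a closed ball is the intersection of countably many slabs, given by
evaluations at a dense sequence, so distances to fixed functionals are measurable.\<close>

lemma borel_measurable_blinfunI:
  fixes w :: "'w \<Rightarrow> 'b::real_normed_vector \<Rightarrow>\<^sub>L real"
  assumes s: "dense_seq (s :: nat \<Rightarrow> 'b)" and t: "dense_seq (t :: nat \<Rightarrow> 'b \<Rightarrow>\<^sub>L real)"
    and w [measurable]: "\<And>n. (\<lambda>\<omega>. blinfun_apply (w \<omega>) (s n)) \<in> borel_measurable M"
  shows "w \<in> borel_measurable M"
proof -
  have norm_le_iff: "norm \<phi> \<le> r \<longleftrightarrow> 0 \<le> r \<and> (\<forall>n. \<bar>blinfun_apply \<phi> (s n)\<bar> \<le> r * norm (s n))"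
    for \<phi> :: "'b \<Rightarrow>\<^sub>L real" and r
  proof safe
    assume "norm \<phi> \<le> r"
    then show "0 \<le> r" using norm_ge_zero order_trans by blast
    show "\<bar>blinfun_apply \<phi> (s n)\<bar> \<le> r * norm (s n)" for n
      using norm_blinfun[of \<phi> "s n"] mult_right_mono[OF \<open>norm \<phi> \<le> r\<close>, of "norm (s n)"] by simp
  next
    assume r: "0 \<le> r" "\<forall>n. \<bar>blinfun_apply \<phi> (s n)\<bar> \<le> r * norm (s n)"
    show "norm \<phi> \<le> r"
    proof (rule norm_blinfun_bound[OF r(1)])
      fix x
      show "norm (blinfun_apply \<phi> x) \<le> r * norm x"
      proof (rule LIMSEQ_le)
        show "(\<lambda>n. norm (blinfun_apply \<phi> (s (near_idx s n x)))) \<longlonglongrightarrow> norm (blinfun_apply \<phi> x)"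
          by (intro tendsto_intros near_idx_tendsto s)
        show "(\<lambda>n. r * norm (s (near_idx s n x))) \<longlonglongrightarrow> r * norm x"
          by (intro tendsto_intros near_idx_tendsto s)
      qed (use r(2) in auto)
    qed
  qed
  have [measurable]: "(\<lambda>\<omega>. dist (w \<omega>) \<phi>) \<in> borel_measurable M" for \<phi>
  proof (rule borel_measurableI_le)
    fix r
    have "{\<omega> \<in> space M. dist (w \<omega>) \<phi> \<le> r} =
        {\<omega> \<in> space M. 0 \<le> r \<and> (\<forall>n. \<bar>blinfun_apply (w \<omega>) (s n) - blinfun_apply \<phi> (s n)\<bar> \<le> r * norm (s n))}"
      by (auto simp: dist_norm norm_le_iff blinfun.diff_left)
    also have "\<dots> \<in> sets M" by measurable
    finally show "{\<omega> \<in> space M. dist (w \<omega>) \<phi> \<le> r} \<in> sets M" .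
  qed
  show ?thesis
  proof (rule borel_measurable_LIMSEQ_metric)
    fix n
    have "(\<lambda>\<omega>. near_idx t n (w \<omega>)) \<in> measurable M (count_space UNIV)"
      unfolding near_idx_def by measurable
    then show "(\<lambda>\<omega>. t (near_idx t n (w \<omega>))) \<in> borel_measurable M"
      by (rule measurable_compose) simp
  next
    show "(\<lambda>n. t (near_idx t n (w \<omega>))) \<longlonglongrightarrow> w \<omega>" for \<omega> by (rule near_idx_tendsto[OF t])
  qed
qed

section \<open>Vector-valued densities\<close>

text \<open>A bound on a dense sequence extends to the whole space, so \<open>\<phi>\<close> cannot stay below \<open>(1 - e) * norm \<phi>\<close>
in all directions \<open>s k\<close>.\<close>

lemma ex_near_norming_index:
  fixes \<phi> :: "'b::real_normed_vector \<Rightarrow>\<^sub>L real"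
  assumes s: "dense_seq (s :: nat \<Rightarrow> 'b)" and e: "0 < e"
  shows "\<exists>k. (1 - e) * norm \<phi> * norm (s k) \<le> \<bar>blinfun_apply \<phi> (s k)\<bar> \<and> (\<phi> \<noteq> 0 \<longrightarrow> s k \<noteq> 0)"
proof (cases "\<phi> = 0")
  case False
  show ?thesis
  proof (rule ccontr)
    assume "\<not> ?thesis"
    with False have no: "\<And>k. s k \<noteq> 0 \<Longrightarrow> \<bar>blinfun_apply \<phi> (s k)\<bar> \<le> (1 - e) * norm \<phi> * norm (s k)"
      by (meson linear)
    have le: "\<bar>blinfun_apply \<phi> (s k)\<bar> \<le> (1 - e) * norm \<phi> * norm (s k)" for k
      using no[of k] by (cases "s k = 0") (auto simp: blinfun.zero_right)
    have lim: "norm (blinfun_apply \<phi> x) \<le> (1 - e) * norm \<phi> * norm x" for x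
    proof (rule LIMSEQ_le)
      show "(\<lambda>n. norm (blinfun_apply \<phi> (s (near_idx s n x)))) \<longlonglongrightarrow> norm (blinfun_apply \<phi> x)"
        by (intro tendsto_intros near_idx_tendsto s)
      show "(\<lambda>n. (1 - e) * norm \<phi> * norm (s (near_idx s n x))) \<longlonglongrightarrow> (1 - e) * norm \<phi> * norm x"
        by (intro tendsto_intros near_idx_tendsto s)
    qed (use le in auto)
    show False
    proof (cases "(1 - e) * norm \<phi> \<ge> 0")
      case True
      then have "norm \<phi> \<le> (1 - e) * norm \<phi>" using lim by (intro norm_blinfun_bound) auto
      then have "e * norm \<phi> \<le> 0" by (simp add: algebra_simps)
      then show False using e False by (simp add: mult_le_0_iff)
    next
      case neg: False
      have "blinfun_apply \<phi> x = 0" for x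
      proof -
        have "(1 - e) * norm \<phi> * norm x \<le> 0" 
          by (rule mult_nonpos_nonneg) (use neg in linarith, simp)
        then show ?thesis using lim[of x] by simp
      qed
      then have "\<phi> = 0" by (intro blinfun_eqI) simp
      then show False using False by simp
    qed
  qed
qed (simp add: blinfun.zero_left)

text \<open>Bounding \<open>l\<close> by the energy plus a constant is the form in which affine minorants of convex
functions arise. Rescaling the argument shows that it implies continuity. The constant is kept
because it reappears as the bound on the energy of the representing function.\<close>

locale energy_bounded_functional = prob_space M for M :: "'w measure" +
  fixes p q c :: real and l :: "('w \<Rightarrow> 'b::real_normed_vector) \<Rightarrow> real"
    and s :: "nat \<Rightarrow> 'b" and t :: "nat \<Rightarrow> 'b \<Rightarrow>\<^sub>L real"
  assumes p: "1 < p" and conj: "1 / p + 1 / q = 1"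
    and s: "dense_seq s" and t: "dense_seq t"
    and lin: "linear_functional_on (Lp_fun M p) l"
    and le_energy: "\<And>f. f \<in> Lp_fun M p \<Longrightarrow> l f \<le> c + Lp_energy M p f"
begin

abbreviation \<F> :: "('w \<Rightarrow> 'b) set" where
  "\<F> \<equiv> Lp_fun M p"

lemma l_add: "f \<in> \<F> \<Longrightarrow> g \<in> \<F> \<Longrightarrow> l (\<lambda>\<omega>. f \<omega> + g \<omega>) = l f + l g"
  using lin by (simp add: linear_functional_on_def plus_fun_def)

lemma l_scale: "f \<in> \<F> \<Longrightarrow> l (\<lambda>\<omega>. r *\<^sub>R f \<omega>) = r * l f"
  using lin by (simp add: linear_functional_on_def scaleR_fun_def)

lemma F_add: "f \<in> \<F> \<Longrightarrow> g \<in> \<F> \<Longrightarrow> (\<lambda>\<omega>. f \<omega> + g \<omega>) \<in> \<F>"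
  by (rule Lp_fun_add[OF s]) (use p in auto)

lemma F_diff: "f \<in> \<F> \<Longrightarrow> g \<in> \<F> \<Longrightarrow> (\<lambda>\<omega>. f \<omega> - g \<omega>) \<in> \<F>"
  by (rule Lp_fun_diff[OF s]) (use p in auto)

lemma F_zero: "(\<lambda>\<omega>. 0) \<in> \<F>"
  using p by (simp add: Lp_fun_def)

lemma l_zero: "l (\<lambda>\<omega>. 0) = 0"
  using l_scale[OF F_zero, of 0] by simp

lemma l_diff: "f \<in> \<F> \<Longrightarrow> g \<in> \<F> \<Longrightarrow> l (\<lambda>\<omega>. f \<omega> - g \<omega>) = l f - l g"
  using l_add[of f "\<lambda>\<omega>. (-1) *\<^sub>R g \<omega>"] Lp_fun_scale[of g M p "-1"] l_scale[of g "-1"] by simp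

lemma F_indicator: "E \<in> sets M \<Longrightarrow> (\<lambda>\<omega>. indicator E \<omega> *\<^sub>R y) \<in> \<F>" for y :: 'b
  using Lp_fun_indicator[OF s bounded_Lp_fun[of M p "\<lambda>\<omega>. y" "norm y"]] p finite_measure_axioms by simp

lemma c_nonneg: "0 \<le> c"
  using le_energy[OF F_zero] p by (simp add: l_zero Lp_energy_def)

lemma l_le:
  assumes f: "f \<in> \<F>" and \<tau>: "\<tau> > 0"
  shows "\<bar>l f\<bar> \<le> c / \<tau> + \<tau> powr (p - 1) * Lp_energy M p f"
proof -
  have *: "l f \<le> c / \<tau> + \<tau> powr (p - 1) * Lp_energy M p f" if f: "f \<in> \<F>" for f
  proof -
    have "\<tau> * l f \<le> c + \<tau> powr p * Lp_energy M p f"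
      using le_energy[OF Lp_fun_scale[OF f, of \<tau>]] \<tau> by (simp add: l_scale[OF f] Lp_energy_scale)
    also have "\<tau> powr p = \<tau> * \<tau> powr (p - 1)"
      using \<tau> by (simp add: powr_mult_base)
    finally show ?thesis using \<tau> by (simp add: field_simps)
  qed
  from *[OF f] *[OF Lp_fun_scale[OF f, of "-1"]] show ?thesis
    using l_scale[OF f, of "-1"] Lp_energy_scale[of M p "-1" f] by simp
qed

lemma l_tendsto_0:
  assumes f: "\<And>n. f n \<in> \<F>" and lim: "(\<lambda>n. Lp_energy M p (f n)) \<longlonglongrightarrow> 0"
  shows "(\<lambda>n::nat. l (f n)) \<longlonglongrightarrow> 0"
proof (rule LIMSEQ_I)
  fix e :: real assume e: "e > 0"
  define \<tau> where "\<tau> = 2 * (c + 1) / e"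
  have \<tau>: "\<tau> > 0" using e c_nonneg by (simp add: \<tau>_def)
  have c\<tau>: "c / \<tau> < e / 2" using e c_nonneg by (simp add: \<tau>_def field_simps)
  have "(\<lambda>n. \<tau> powr (p - 1) * Lp_energy M p (f n)) \<longlonglongrightarrow> \<tau> powr (p - 1) * 0"
    by (intro tendsto_intros lim)
  then have "(\<lambda>n. \<tau> powr (p - 1) * Lp_energy M p (f n)) \<longlonglongrightarrow> 0" by simp
  from LIMSEQ_D[OF this, of "e / 2"] e
  obtain N where "\<And>n. n \<ge> N \<Longrightarrow> norm (\<tau> powr (p - 1) * Lp_energy M p (f n) - 0) < e / 2"
    by auto
  then have N: "\<And>n. n \<ge> N \<Longrightarrow> \<tau> powr (p - 1) * Lp_energy M p (f n) < e / 2"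
    by (metis abs_ge_self diff_zero le_less_trans real_norm_def)
  have "norm (l (f n) - 0) < e" if "n \<ge> N" for n
    using l_le[OF f \<tau>, of n] N[OF that] c\<tau> unfolding real_norm_def diff_0_right by linarith
  then show "\<exists>N. \<forall>n\<ge>N. norm (l (f n) - 0) < e" by blast
qed

lemma l_cong_AE:
  assumes f: "f \<in> \<F>" and g: "g \<in> \<F>" and eq: "AE \<omega> in M. f \<omega> = g \<omega>"
  shows "l f = l g"
proof -
  have "(\<integral>\<omega>. norm (f \<omega> - g \<omega>) powr p \<partial>M) = 0"
    by (rule integral_eq_zero_AE) (use eq in \<open>eventually_elim, simp\<close>)
  then have "Lp_energy M p (\<lambda>\<omega>. f \<omega> - g \<omega>) = 0" by (simp add: Lp_energy_def)
  then have "(\<lambda>n::nat. l (\<lambda>\<omega>. f \<omega> - g \<omega>)) \<longlonglongrightarrow> 0"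
    using F_diff[OF f g] by (intro l_tendsto_0) auto
  then have "l (\<lambda>\<omega>. f \<omega> - g \<omega>) = 0" by (simp add: LIMSEQ_const_iff)
  then show ?thesis using l_diff[OF f g] by simp
qed

lemma l_sum:
  assumes "finite K" "\<And>k. k \<in> K \<Longrightarrow> f k \<in> \<F>"
  shows "(\<lambda>\<omega>. \<Sum>k\<in>K. f k \<omega>) \<in> \<F> \<and> l (\<lambda>\<omega>. \<Sum>k\<in>K. f k \<omega>) = (\<Sum>k\<in>K. l (f k))"
  using assms by (induction K) (auto simp: l_zero F_zero F_add l_add)

text \<open>The total variation of the vector measure that maps \<open>E\<close> to the functional
\<open>y \<mapsto> l (indicator E *\<^sub>R y)\<close>. Its density dominates the densities of all scalar measures
\<open>E \<mapsto> l (indicator E *\<^sub>R y)\<close> at once.\<close>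

definition variation :: "'w set \<Rightarrow> real" where
  "variation E = (SUP f\<in>{f \<in> \<F>. \<forall>\<omega>. norm (f \<omega>) \<le> indicator E \<omega>}. l f)"

lemma energy_le_prob:
  assumes f: "f \<in> \<F>" "\<forall>\<omega>. norm (f \<omega>) \<le> indicator E \<omega>" and [measurable]: "E \<in> sets M"
  shows "Lp_energy M p f \<le> prob E / p"
proof -
  have "(\<integral>\<omega>. norm (f \<omega>) powr p \<partial>M) \<le> (\<integral>\<omega>. indicator E \<omega> \<partial>M)"
  proof (rule integral_mono)
    show "integrable M (\<lambda>\<omega>. norm (f \<omega>) powr p)" by (rule Lp_funD(2)[OF f(1)])
    show "integrable M (indicat_real E)" by (simp add: less_top[symmetric])
    fix \<omega>
    have "norm (f \<omega>) powr p \<le> indicat_real E \<omega> powr p" using f(2) p by (intro powr_mono2) auto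
    then show "norm (f \<omega>) powr p \<le> indicat_real E \<omega>" using p by (auto simp: indicator_def)
  qed
  then show ?thesis using p by (simp add: Lp_energy_def divide_right_mono)
qed

lemma l_le_variation:
  assumes f: "f \<in> \<F>" "\<And>\<omega>. norm (f \<omega>) \<le> indicator E \<omega>" and E: "E \<in> sets M"
  shows "l f \<le> variation E"
  unfolding variation_def
proof (rule cSUP_upper)
  show "bdd_above (l ` {f \<in> \<F>. \<forall>\<omega>. norm (f \<omega>) \<le> indicator E \<omega>})"
    using energy_le_prob[OF _ _ E] le_energy
    by (intro bdd_aboveI2[of _ _ "c + prob E / p"]) (fastforce intro: order_trans)
qed (use f in auto)

lemma variation_le:
  assumes "\<And>f. f \<in> \<F> \<Longrightarrow> (\<And>\<omega>. norm (f \<omega>) \<le> indicator E \<omega>) \<Longrightarrow> l f \<le> b"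
  shows "variation E \<le> b"
  unfolding variation_def using F_zero assms by (intro cSUP_least) auto

lemma variation_nonneg: "E \<in> sets M \<Longrightarrow> 0 \<le> variation E"
  using l_le_variation[OF F_zero, of E] by (simp add: l_zero)

lemma variation_small:
  assumes e: "e > 0" shows "\<exists>d>0. \<forall>E\<in>sets M. prob E < d \<longrightarrow> variation E < e"
proof -
  define \<tau> where "\<tau> = 2 * (c + 1) / e"
  have \<tau>: "\<tau> > 0" using e c_nonneg by (simp add: \<tau>_def)
  have c\<tau>: "c / \<tau> < e / 2" using e c_nonneg by (simp add: \<tau>_def field_simps)
  define d where "d = e / 2 / \<tau> powr (p - 1) * p"
  have d: "d > 0" "\<tau> powr (p - 1) * (d / p) = e / 2" using e p \<tau> by (auto simp: d_def)
  have "variation E < e" if E: "E \<in> sets M" "prob E < d" for E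
  proof -
    have "variation E \<le> c / \<tau> + \<tau> powr (p - 1) * (prob E / p)"
    proof (rule variation_le)
      fix f assume f: "f \<in> \<F>" "\<And>\<omega>. norm (f \<omega>) \<le> indicator E \<omega>"
      have "\<tau> powr (p - 1) * Lp_energy M p f \<le> \<tau> powr (p - 1) * (prob E / p)"
        using energy_le_prob[OF f(1) _ E(1)] f(2) by (intro mult_left_mono) auto
      then show "l f \<le> c / \<tau> + \<tau> powr (p - 1) * (prob E / p)" using l_le[OF f(1) \<tau>] by simp
    qed
    also have "\<tau> powr (p - 1) * (prob E / p) \<le> \<tau> powr (p - 1) * (d / p)"
      using E(2) p by (intro mult_left_mono divide_right_mono) auto
    finally show ?thesis using c\<tau> d(2) by linarith
  qed
  with d(1) show ?thesis by blast
qed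

lemma variation_add:
  assumes E: "E \<in> sets M" and F: "F \<in> sets M" and disj: "E \<inter> F = {}"
  shows "variation (E \<union> F) = variation E + variation F"
proof (rule antisym)
  show "variation (E \<union> F) \<le> variation E + variation F"
  proof (rule variation_le)
    fix f assume f: "f \<in> \<F>" "\<And>\<omega>. norm (f \<omega>) \<le> indicator (E \<union> F) \<omega>"
    have fE: "(\<lambda>\<omega>. indicat_real E \<omega> *\<^sub>R f \<omega>) \<in> \<F>" "(\<lambda>\<omega>. indicat_real F \<omega> *\<^sub>R f \<omega>) \<in> \<F>"
      by (rule Lp_fun_indicator[OF s f(1)], fact)+
    have "f = (\<lambda>\<omega>. indicat_real E \<omega> *\<^sub>R f \<omega> + indicat_real F \<omega> *\<^sub>R f \<omega>)"
    proof
      fix \<omega> show "f \<omega> = indicat_real E \<omega> *\<^sub>R f \<omega> + indicat_real F \<omega> *\<^sub>R f \<omega>"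
        using f(2)[of \<omega>] disj by (auto simp: indicator_def split: if_splits)
    qed
    then have "l f = l (\<lambda>\<omega>. indicat_real E \<omega> *\<^sub>R f \<omega>) + l (\<lambda>\<omega>. indicat_real F \<omega> *\<^sub>R f \<omega>)"
      using l_add[OF fE] by simp
    moreover have "norm (indicat_real G \<omega> *\<^sub>R f \<omega>) \<le> indicator G \<omega>" for G \<omega>
      using order_trans[OF f(2)[of \<omega>] indicator_le_1] by (auto simp: indicator_def split: if_splits)
    ultimately show "l f \<le> variation E + variation F"
      using l_le_variation[OF fE(1) _ E] l_le_variation[OF fE(2) _ F] by fastforce
  qed
  have "l f + l g \<le> variation (E \<union> F)"
    if f: "f \<in> \<F>" "\<And>\<omega>. norm (f \<omega>) \<le> indicator E \<omega>"
      and g: "g \<in> \<F>" "\<And>\<omega>. norm (g \<omega>) \<le> indicator F \<omega>" for f g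
  proof -
    have "norm (f \<omega> + g \<omega>) \<le> indicator (E \<union> F) \<omega>" for \<omega>
    proof -
      have "indicat_real (E \<union> F) \<omega> = indicator E \<omega> + indicator F \<omega>"
        using disj by (auto simp: indicator_def)
      then show ?thesis
        using f(2)[of \<omega>] g(2)[of \<omega>] norm_triangle_ineq[of "f \<omega>" "g \<omega>"] by linarith
    qed
    then have "l (\<lambda>\<omega>. f \<omega> + g \<omega>) \<le> variation (E \<union> F)"
      using E F by (intro l_le_variation F_add f g) auto
    then show ?thesis by (simp add: l_add f g)
  qed
  then have "l g \<le> variation (E \<union> F) - l f"
    if "f \<in> \<F>" "\<And>\<omega>. norm (f \<omega>) \<le> indicator E \<omega>"
      "g \<in> \<F>" "\<And>\<omega>. norm (g \<omega>) \<le> indicator F \<omega>" for f g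
    using that by (simp add: le_diff_eq add.commute)
  then have "variation F \<le> variation (E \<union> F) - l f"
    if "f \<in> \<F>" "\<And>\<omega>. norm (f \<omega>) \<le> indicator E \<omega>" for f
    using that by (intro variation_le) auto
  then have "l f \<le> variation (E \<union> F) - variation F"
    if "f \<in> \<F>" "\<And>\<omega>. norm (f \<omega>) \<le> indicator E \<omega>" for f
    using that by (simp add: le_diff_eq add.commute)
  then have "variation E \<le> variation (E \<union> F) - variation F" by (intro variation_le) auto
  then show "variation E + variation F \<le> variation (E \<union> F)" by simp
qed

lemma l_indicator_le:
  assumes E: "E \<in> sets M"
  shows "\<bar>l (\<lambda>\<omega>. indicator E \<omega> *\<^sub>R y)\<bar> \<le> norm y * variation E"
proof -
  have *: "l (\<lambda>\<omega>. indicator E \<omega> *\<^sub>R y) \<le> norm y * variation E" for y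
  proof (cases "y = 0")
    case False
    have "l (\<lambda>\<omega>. indicator E \<omega> *\<^sub>R sgn y) \<le> variation E"
      using E by (intro l_le_variation F_indicator) (auto simp: indicator_def norm_sgn)
    then have "norm y * l (\<lambda>\<omega>. indicator E \<omega> *\<^sub>R sgn y) \<le> norm y * variation E"
      by (intro mult_left_mono) auto
    moreover have "norm y * l (\<lambda>\<omega>. indicator E \<omega> *\<^sub>R sgn y) = l (\<lambda>\<omega>. norm y *\<^sub>R (indicator E \<omega> *\<^sub>R sgn y))"
      using l_scale[OF F_indicator[OF E]] by simp
    moreover have "norm y *\<^sub>R (indicat_real E \<omega> *\<^sub>R sgn y) = indicator E \<omega> *\<^sub>R y" for \<omega>
      using False by (simp add: sgn_div_norm)
    ultimately show ?thesis by simp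
  qed (simp add: l_zero)
  have "l (\<lambda>\<omega>. indicator E \<omega> *\<^sub>R (- y)) = - l (\<lambda>\<omega>. indicator E \<omega> *\<^sub>R y)"
    using l_scale[OF F_indicator[OF E], of "-1" y] by simp
  then show ?thesis using *[of y] *[of "- y"] by simp
qed

text \<open>Adding \<open>norm y\<close> times the variation makes the scalar measure for \<open>y\<close> nonnegative, so that it has a
density by \<open>additive_density_exists\<close>.\<close>

lemma densities:
  obtains D d where "integrable M D" "\<And>\<omega>. 0 \<le> D \<omega>" "\<And>y. integrable M (d y)"
    "\<And>y E. E \<in> sets M \<Longrightarrow> l (\<lambda>\<omega>. indicator E \<omega> *\<^sub>R y) = set_lebesgue_integral M E (d y)"
    "\<And>y. AE \<omega> in M. \<bar>d y \<omega>\<bar> \<le> D \<omega> * norm y"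
proof -
  obtain D where D: "integrable M D" "\<And>\<omega>. 0 \<le> D \<omega>"
    "\<And>E. E \<in> sets M \<Longrightarrow> variation E = set_lebesgue_integral M E D"
    by (rule additive_density_exists[of variation])
       (auto intro: variation_nonneg variation_add variation_small)
  have si: "set_integrable M E f" if "integrable M f" "E \<in> sets M" for E and f :: "'w \<Rightarrow> real"
    unfolding set_integrable_def using that by (rule integrable_mult_indicator[rotated])
  have "\<exists>g. integrable M g \<and> (\<forall>E\<in>sets M. l (\<lambda>\<omega>. indicator E \<omega> *\<^sub>R y) = set_lebesgue_integral M E g)" for y
  proof -
    \<comment> \<open>nonnegative, unlike the set function to be represented\<close>
    let ?\<alpha> = "\<lambda>E. norm y * variation E + l (\<lambda>\<omega>. indicator E \<omega> *\<^sub>R y)"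
    have \<alpha>_add: "?\<alpha> (E \<union> F) = ?\<alpha> E + ?\<alpha> F"
      if EF: "E \<in> sets M" "F \<in> sets M" "E \<inter> F = {}" for E F
    proof -
      have "l (\<lambda>\<omega>. indicator (E \<union> F) \<omega> *\<^sub>R y) = l (\<lambda>\<omega>. indicator E \<omega> *\<^sub>R y + indicator F \<omega> *\<^sub>R y)"
        using EF(3) by (intro arg_cong[of _ _ l] ext) (auto simp: indicator_def)
      then show ?thesis
        by (simp add: variation_add[OF EF] l_add F_indicator EF algebra_simps)
    qed
    have \<alpha>_small: "\<exists>d>0. \<forall>E\<in>sets M. prob E < d \<longrightarrow> ?\<alpha> E < e" if e: "e > 0" for e
    proof -
      have "0 < e / (2 * (norm y + 1))" using e by (intro divide_pos_pos) (auto simp: add_nonneg_pos)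
      from variation_small[OF this] obtain d where d: "d > 0"
        "\<And>E. E \<in> sets M \<Longrightarrow> prob E < d \<Longrightarrow> variation E < e / (2 * (norm y + 1))" by blast
      have "?\<alpha> E < e" if E: "E \<in> sets M" "prob E < d" for E
      proof -
        have "?\<alpha> E \<le> 2 * norm y * variation E" using l_indicator_le[OF E(1), of y] by simp
        also have "\<dots> \<le> 2 * (norm y + 1) * variation E"
          using variation_nonneg[OF E(1)] by (intro mult_right_mono) auto
        also have "\<dots> < 2 * (norm y + 1) * (e / (2 * (norm y + 1)))"
          using d(2)[OF E] by (intro mult_strict_left_mono) (auto simp: add_nonneg_pos)
        also have "\<dots> = e" using norm_ge_zero[of y] by (simp add: field_simps add_nonneg_eq_0_iff)
        finally show ?thesis .
      qed
      with d(1) show ?thesis by blast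
    qed
    have \<alpha>_nonneg: "0 \<le> ?\<alpha> E" if "E \<in> sets M" for E using l_indicator_le[OF that, of y] by simp
    obtain a where a: "integrable M a" "\<And>E. E \<in> sets M \<Longrightarrow> ?\<alpha> E = set_lebesgue_integral M E a"
      by (rule additive_density_exists[of ?\<alpha>, OF \<alpha>_nonneg \<alpha>_add \<alpha>_small]) blast+
    have "integrable M (\<lambda>\<omega>. a \<omega> - norm y * D \<omega>)" using a(1) D(1) by simp
    moreover have "l (\<lambda>\<omega>. indicator E \<omega> *\<^sub>R y) = set_lebesgue_integral M E (\<lambda>\<omega>. a \<omega> - norm y * D \<omega>)"
      if E: "E \<in> sets M" for E
    proof -
      have "set_lebesgue_integral M E (\<lambda>\<omega>. a \<omega> - norm y * D \<omega>) =
          set_lebesgue_integral M E a - norm y * set_lebesgue_integral M E D"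
        using si[OF a(1) E] si[OF D(1) E] by (subst set_integral_diff) auto
      then show ?thesis using a(2)[OF E] D(3)[OF E] by simp
    qed
    ultimately show ?thesis by blast
  qed
  then obtain d where d: "\<And>y. integrable M (d y)"
    "\<And>y E. E \<in> sets M \<Longrightarrow> l (\<lambda>\<omega>. indicator E \<omega> *\<^sub>R y) = set_lebesgue_integral M E (d y)"
    by metis
  have "AE \<omega> in M. \<bar>d y \<omega>\<bar> \<le> D \<omega> * norm y" for y
  proof -
    have "AE \<omega> in M. 0 \<le> D \<omega> * norm y - d y \<omega>"
    proof (rule density_nonneg)
      show "integrable M (\<lambda>\<omega>. D \<omega> * norm y - d y \<omega>)" using D(1) d(1) by simp
      fix E assume E: "E \<in> sets M"
      have "set_lebesgue_integral M E (\<lambda>\<omega>. D \<omega> * norm y - d y \<omega>) =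
          norm y * variation E - l (\<lambda>\<omega>. indicator E \<omega> *\<^sub>R y)"
        using si[OF d(1) E] si[OF D(1) E] by (subst set_integral_diff) (auto simp: D(3) d(2) E)
      then show "0 \<le> set_lebesgue_integral M E (\<lambda>\<omega>. D \<omega> * norm y - d y \<omega>)"
        using l_indicator_le[OF E, of y] by simp
    qed
    moreover have "AE \<omega> in M. 0 \<le> D \<omega> * norm y + d y \<omega>"
    proof (rule density_nonneg)
      show "integrable M (\<lambda>\<omega>. D \<omega> * norm y + d y \<omega>)" using D(1) d(1) by simp
      fix E assume E: "E \<in> sets M"
      have "set_lebesgue_integral M E (\<lambda>\<omega>. D \<omega> * norm y + d y \<omega>) =
          norm y * variation E + l (\<lambda>\<omega>. indicator E \<omega> *\<^sub>R y)"
        using si[OF d(1) E] si[OF D(1) E] by (subst set_integral_add) (auto simp: D(3) d(2) E)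
      then show "0 \<le> set_lebesgue_integral M E (\<lambda>\<omega>. D \<omega> * norm y + d y \<omega>)"
        using l_indicator_le[OF E, of y] by simp
    qed
    ultimately show ?thesis by eventually_elim auto
  qed
  with that D(1,2) d show ?thesis by blast
qed

text \<open>The scalar densities depend linearly on \<open>y\<close> up to null sets. On a countable rational subspace all
exceptional sets can be discarded together, and the remaining values extend to functionals.\<close>

lemma dual_valued_density:
  obtains D v where "integrable M D" "v \<in> borel_measurable M" "\<And>\<omega>. norm (v \<omega>) \<le> D \<omega>"
    "\<And>n E. E \<in> sets M \<Longrightarrow>
      l (\<lambda>\<omega>. indicator E \<omega> *\<^sub>R s n) = set_lebesgue_integral M E (\<lambda>\<omega>. blinfun_apply (v \<omega>) (s n))"
proof -
  obtain D d where D: "integrable M D" "\<And>\<omega>. 0 \<le> D \<omega>" and d: "\<And>y. integrable M (d y)"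
    "\<And>y E. E \<in> sets M \<Longrightarrow> l (\<lambda>\<omega>. indicator E \<omega> *\<^sub>R y) = set_lebesgue_integral M E (d y)"
    and dD: "\<And>y. AE \<omega> in M. \<bar>d y \<omega>\<bar> \<le> D \<omega> * norm y"
    by (rule densities) blast
  have si: "set_integrable M E f" if "integrable M f" "E \<in> sets M" for E and f :: "'w \<Rightarrow> real"
    unfolding set_integrable_def using that by (rule integrable_mult_indicator[rotated])
  have d_add: "AE \<omega> in M. d (x + y) \<omega> = d x \<omega> + d y \<omega>" for x y
  proof (rule density_unique_real)
    show "integrable M (d (x + y))" "integrable M (\<lambda>\<omega>. d x \<omega> + d y \<omega>)" using d(1) by auto
    fix E assume E: "E \<in> sets M"
    have "l (\<lambda>\<omega>. indicator E \<omega> *\<^sub>R (x + y)) = l (\<lambda>\<omega>. indicator E \<omega> *\<^sub>R x) + l (\<lambda>\<omega>. indicator E \<omega> *\<^sub>R y)"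
      using l_add[OF F_indicator[OF E] F_indicator[OF E]] by (simp add: scaleR_add_right)
    then show "set_lebesgue_integral M E (d (x + y)) = set_lebesgue_integral M E (\<lambda>\<omega>. d x \<omega> + d y \<omega>)"
      using si[OF d(1) E] by (subst set_integral_add) (auto simp: d(2)[OF E])
  qed
  have d_scale: "AE \<omega> in M. d (r *\<^sub>R x) \<omega> = r * d x \<omega>" for r x
  proof (rule density_unique_real)
    show "integrable M (d (r *\<^sub>R x))" "integrable M (\<lambda>\<omega>. r * d x \<omega>)" using d(1) by auto
    fix E assume E: "E \<in> sets M"
    have "l (\<lambda>\<omega>. indicator E \<omega> *\<^sub>R (r *\<^sub>R x)) = r * l (\<lambda>\<omega>. indicator E \<omega> *\<^sub>R x)"
      using l_scale[OF F_indicator[OF E, of x], of r] by (simp add: mult.commute)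
    then show "set_lebesgue_integral M E (d (r *\<^sub>R x)) = set_lebesgue_integral M E (\<lambda>\<omega>. r * d x \<omega>)"
      unfolding d(2)[OF E] by simp
  qed
  define S where "S = rat_span (range s)"
  have S: "countable S" by (auto simp: S_def intro: countable_rat_span)
  have sS: "s n \<in> S" for n by (simp add: S_def rat_span_superset)
  define good where "good \<omega> \<longleftrightarrow> (\<forall>x\<in>S. \<bar>d x \<omega>\<bar> \<le> D \<omega> * norm x) \<and>
    (\<forall>x\<in>S. \<forall>y\<in>S. d (x + y) \<omega> = d x \<omega> + d y \<omega>) \<and>
    (\<forall>x\<in>S. \<forall>r\<in>\<rat>. d (r *\<^sub>R x) \<omega> = r * d x \<omega>)" for \<omega>
  have "AE \<omega> in M. good \<omega>"
    unfolding good_def using S countable_rat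
    by (intro AE_conjI AE_ball_countable'[rotated]) (auto intro: dD d_add d_scale)
  then obtain N where N: "{\<omega> \<in> space M. \<not> good \<omega>} \<subseteq> N" "N \<in> null_sets M"
    by (auto elim!: AE_E simp: null_sets_def)
  have ex: "\<exists>v :: 'b \<Rightarrow>\<^sub>L real. (\<forall>x\<in>S. blinfun_apply v x = d x \<omega>) \<and> norm v \<le> D \<omega>" if "good \<omega>" for \<omega>
    using that unfolding good_def
    by (intro rational_functional_extension[OF s sS])
       (auto simp: S_def rat_span_add rat_span_scale D(2))
  define v where "v \<omega> = (if \<omega> \<in> space M - N then SOME v :: 'b \<Rightarrow>\<^sub>L real. (\<forall>x\<in>S. blinfun_apply v x = d x \<omega>) \<and> norm v \<le> D \<omega> else 0)" for \<omega>
  have v: "(\<forall>x\<in>S. blinfun_apply (v \<omega>) x = d x \<omega>) \<and> norm (v \<omega>) \<le> D \<omega>" if "\<omega> \<in> space M - N" for \<omega>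
  proof -
    have "good \<omega>" using that N(1) by blast
    from someI_ex[OF ex[OF this]] show ?thesis using that by (simp add: v_def)
  qed
  show ?thesis
  proof (rule that[OF D(1)])
    show "v \<in> borel_measurable M"
    proof (rule borel_measurable_blinfunI[OF s t])
      fix n
      have [measurable]: "N \<in> sets M" "d (s n) \<in> borel_measurable M" using N(2) d(1)[of "s n"] by auto
      have "(\<lambda>\<omega>. if \<omega> \<in> space M - N then d (s n) \<omega> else 0) \<in> borel_measurable M" by measurable
      moreover have "blinfun_apply (v \<omega>) (s n) = (if \<omega> \<in> space M - N then d (s n) \<omega> else 0)" for \<omega>
        using v[of \<omega>] sS[of n] by (auto simp: v_def blinfun.zero_left)
      ultimately show "(\<lambda>\<omega>. blinfun_apply (v \<omega>) (s n)) \<in> borel_measurable M" by simp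
    qed
    show "norm (v \<omega>) \<le> D \<omega>" for \<omega>
      using v[of \<omega>] D(2)[of \<omega>] by (cases "\<omega> \<in> space M - N") (auto simp: v_def)
    fix n E assume E: "E \<in> sets M"
    have "AE \<omega> in M. \<omega> \<notin> N" using N(2) by (rule AE_not_in)
    then have ae: "AE \<omega> in M. d (s n) \<omega> = blinfun_apply (v \<omega>) (s n)"
      using AE_space by eventually_elim (use v sS in auto)
    have "set_lebesgue_integral M E (d (s n)) = set_lebesgue_integral M E (\<lambda>\<omega>. blinfun_apply (v \<omega>) (s n))"
      unfolding set_lebesgue_integral_def
    proof (intro integral_cong_AE)
      have [measurable]: "d (s n) \<in> borel_measurable M" "E \<in> sets M" using d(1)[of "s n"] E by auto
      have [measurable]: "(\<lambda>\<omega>. blinfun_apply (v \<omega>) (s n)) \<in> borel_measurable M"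
        by (rule borel_measurable_continuous_on[OF _ \<open>v \<in> borel_measurable M\<close>]) (intro continuous_intros)
      show "(\<lambda>\<omega>. indicat_real E \<omega> *\<^sub>R d (s n) \<omega>) \<in> borel_measurable M" by measurable
      show "(\<lambda>\<omega>. indicat_real E \<omega> *\<^sub>R blinfun_apply (v \<omega>) (s n)) \<in> borel_measurable M" by measurable
    qed (use ae in \<open>eventually_elim, simp\<close>)
    then show "l (\<lambda>\<omega>. indicator E \<omega> *\<^sub>R s n) = set_lebesgue_integral M E (\<lambda>\<omega>. blinfun_apply (v \<omega>) (s n))"
      by (simp add: d(2)[OF E])
  qed
qed

end

section \<open>Representation of energy-bounded functionals\<close>

context energy_bounded_functional
begin

text \<open>The approximants are bounded by \<open>2 * norm (f \<omega>)\<close> and differ from \<open>f \<omega>\<close> by at most \<open>norm (f \<omega>)\<close>, so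
dominated convergence applies to their energies.\<close>

lemma near_fun:
  assumes f: "f \<in> \<F>"
  shows "(\<lambda>\<omega>. s (near_idx s n (f \<omega>))) \<in> \<F>"
    "(\<lambda>n. l (\<lambda>\<omega>. s (near_idx s n (f \<omega>)))) \<longlonglongrightarrow> l f"
proof -
  note [measurable] = Lp_funD(1)[OF f]
  have m: "(\<lambda>\<omega>. s (near_idx s n (f \<omega>))) \<in> borel_measurable M" for n
    by (rule measurable_compose[where N = "count_space UNIV"]) auto
  have mem: "(\<lambda>\<omega>. s (near_idx s n (f \<omega>))) \<in> \<F>" for n
  proof -
    have "integrable M (\<lambda>\<omega>. norm (s (near_idx s n (f \<omega>))) powr p)"
    proof (rule Bochner_Integration.integrable_bound)
      show "integrable M (\<lambda>\<omega>. 2 powr p * norm (f \<omega>) powr p)" using Lp_funD(2)[OF f] by simp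
      show "(\<lambda>\<omega>. norm (s (near_idx s n (f \<omega>))) powr p) \<in> borel_measurable M" using m by measurable
      have "norm (s (near_idx s n (f \<omega>))) powr p \<le> 2 powr p * norm (f \<omega>) powr p" for \<omega>
        using powr_mono2[OF _ _ norm_near_idx_le[OF s, of n "f \<omega>"], of p] p by (simp add: powr_mult)
      then show "AE \<omega> in M. norm (norm (s (near_idx s n (f \<omega>))) powr p) \<le> norm (2 powr p * norm (f \<omega>) powr p)"
        by simp
    qed
    with m show ?thesis by (simp add: Lp_fun_def)
  qed
  then show "(\<lambda>\<omega>. s (near_idx s n (f \<omega>))) \<in> \<F>" .
  have "(\<lambda>n. \<integral>\<omega>. norm (s (near_idx s n (f \<omega>)) - f \<omega>) powr p \<partial>M) \<longlonglongrightarrow> (\<integral>\<omega>. 0 \<partial>M)"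
  proof (rule integral_dominated_convergence)
    show "integrable M (\<lambda>\<omega>. norm (f \<omega>) powr p)" by (rule Lp_funD(2)[OF f])
    show "(\<lambda>\<omega>. norm (s (near_idx s n (f \<omega>)) - f \<omega>) powr p) \<in> borel_measurable M" for n
      by (rule borel_measurable_integrable[OF Lp_funD(2)[OF F_diff[OF mem f]]])
    show "AE \<omega> in M. (\<lambda>n. norm (s (near_idx s n (f \<omega>)) - f \<omega>) powr p) \<longlonglongrightarrow> 0"
    proof (rule AE_I2)
      fix \<omega>
      have "(\<lambda>n. norm (s (near_idx s n (f \<omega>)) - f \<omega>)) \<longlonglongrightarrow> norm (f \<omega> - f \<omega>)"
        by (intro tendsto_intros near_idx_tendsto s)
      then have "(\<lambda>n. norm (s (near_idx s n (f \<omega>)) - f \<omega>) powr p) \<longlonglongrightarrow> 0 powr p"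
        using p by (intro tendsto_powr') auto
      then show "(\<lambda>n. norm (s (near_idx s n (f \<omega>)) - f \<omega>) powr p) \<longlonglongrightarrow> 0" by simp
    qed
    have "norm (s (near_idx s n (f \<omega>)) - f \<omega>) \<le> norm (f \<omega>)" for n \<omega>
      using near_idx(2)[of 0 n "f \<omega>" s] s by (simp add: dense_seq_def dist_norm norm_minus_commute)
    then show "AE \<omega> in M. norm (norm (s (near_idx s n (f \<omega>)) - f \<omega>) powr p) \<le> norm (f \<omega>) powr p" for n
      using p by (auto intro!: powr_mono2)
  qed simp
  then have "(\<lambda>n. Lp_energy M p (\<lambda>\<omega>. s (near_idx s n (f \<omega>)) - f \<omega>)) \<longlonglongrightarrow> 0"
    using tendsto_divide[OF _ tendsto_const, of _ 0 sequentially p] p by (simp add: Lp_energy_def)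
  from l_tendsto_0[OF F_diff[OF mem f] this]
  have "(\<lambda>n. l (\<lambda>\<omega>. s (near_idx s n (f \<omega>))) - l f) \<longlonglongrightarrow> 0" by (simp add: l_diff[OF mem f])
  then show "(\<lambda>n. l (\<lambda>\<omega>. s (near_idx s n (f \<omega>)))) \<longlonglongrightarrow> l f" by (rule LIM_zero_cancel)
qed

lemma represented_if_integrable:
  assumes v: "v \<in> borel_measurable M" "integrable M (\<lambda>\<omega>. norm (v \<omega>))"
    and vE: "\<And>n E. E \<in> sets M \<Longrightarrow>
      l (\<lambda>\<omega>. indicator E \<omega> *\<^sub>R s n) = set_lebesgue_integral M E (\<lambda>\<omega>. blinfun_apply (v \<omega>) (s n))"
    and f: "f \<in> \<F>" and int: "integrable M (\<lambda>\<omega>. norm (v \<omega>) * norm (f \<omega>))"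
  shows "l f = (\<integral>\<omega>. blinfun_apply (v \<omega>) (f \<omega>) \<partial>M)"
proof (rule LIMSEQ_unique[OF near_fun(2)[OF f]])
  note [measurable] = Lp_funD(1)[OF f]
  have vm: "(\<lambda>\<omega>. blinfun_apply (v \<omega>) (g \<omega>)) \<in> borel_measurable M" if "g \<in> borel_measurable M" for g
    by (rule borel_measurable_blinfun_apply_dense[OF s v(1) that])
  have step: "l (\<lambda>\<omega>. s (near_idx s n (f \<omega>))) = (\<integral>\<omega>. blinfun_apply (v \<omega>) (s (near_idx s n (f \<omega>))) \<partial>M)" for n
  proof -
    define A where "A k = {\<omega> \<in> space M. near_idx s n (f \<omega>) = k}" for k
    have [measurable]: "A k \<in> sets M" for k unfolding A_def by measurable
    have sum_A: "(\<Sum>k\<le>n. indicator (A k) \<omega> * h k) = h (near_idx s n (f \<omega>))"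
      if \<omega>: "\<omega> \<in> space M" for \<omega> and h :: "nat \<Rightarrow> real"
    proof -
      have "(\<Sum>k\<le>n. indicator (A k) \<omega> * h k) = (\<Sum>k\<le>n. if k = near_idx s n (f \<omega>) then h k else 0)"
        using \<omega> by (intro sum.cong) (auto simp: A_def indicator_def)
      then show ?thesis using near_idx(1)[of s n "f \<omega>"] by simp
    qed
    have sum_A': "(\<Sum>k\<le>n. indicat_real (A k) \<omega> *\<^sub>R s k) = s (near_idx s n (f \<omega>))"
      if \<omega>: "\<omega> \<in> space M" for \<omega>
    proof -
      have "(\<Sum>k\<le>n. indicat_real (A k) \<omega> *\<^sub>R s k) = (\<Sum>k\<le>n. if k = near_idx s n (f \<omega>) then s k else 0)"
        using \<omega> by (intro sum.cong) (auto simp: A_def indicator_def)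
      then show ?thesis using near_idx(1)[of s n "f \<omega>"] by simp
    qed
    have vs: "integrable M (\<lambda>\<omega>. indicator (A k) \<omega> * blinfun_apply (v \<omega>) (s k))" for k
    proof (rule Bochner_Integration.integrable_bound)
      show "integrable M (\<lambda>\<omega>. norm (v \<omega>) * norm (s k))" using v(2) by simp
      have [measurable]: "(\<lambda>\<omega>. blinfun_apply (v \<omega>) (s k)) \<in> borel_measurable M" by (rule vm) simp
      show "(\<lambda>\<omega>. indicator (A k) \<omega> * blinfun_apply (v \<omega>) (s k)) \<in> borel_measurable M" by measurable
      have "\<bar>blinfun_apply (v \<omega>) (s k)\<bar> \<le> norm (v \<omega>) * norm (s k)" for \<omega>
        using norm_blinfun[of "v \<omega>" "s k"] by simp
      then show "AE \<omega> in M. norm (indicator (A k) \<omega> * blinfun_apply (v \<omega>) (s k)) \<le> norm (norm (v \<omega>) * norm (s k))"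
        by (auto simp: indicator_def)
    qed
    have sm: "(\<lambda>\<omega>. \<Sum>k\<le>n. indicat_real (A k) \<omega> *\<^sub>R s k) \<in> \<F> \<and>
        l (\<lambda>\<omega>. \<Sum>k\<le>n. indicat_real (A k) \<omega> *\<^sub>R s k) = (\<Sum>k\<le>n. l (\<lambda>\<omega>. indicat_real (A k) \<omega> *\<^sub>R s k))"
      by (rule l_sum) (auto intro: F_indicator)
    have "l (\<lambda>\<omega>. s (near_idx s n (f \<omega>))) = l (\<lambda>\<omega>. \<Sum>k\<le>n. indicat_real (A k) \<omega> *\<^sub>R s k)"
      using sm sum_A' by (intro l_cong_AE near_fun(1)[OF f]) auto
    also have "\<dots> = (\<Sum>k\<le>n. \<integral>\<omega>. indicator (A k) \<omega> * blinfun_apply (v \<omega>) (s k) \<partial>M)"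
      using sm by (simp add: vE set_lebesgue_integral_def)
    also have "\<dots> = (\<integral>\<omega>. (\<Sum>k\<le>n. indicator (A k) \<omega> * blinfun_apply (v \<omega>) (s k)) \<partial>M)"
      using vs by (subst Bochner_Integration.integral_sum) auto
    also have "\<dots> = (\<integral>\<omega>. blinfun_apply (v \<omega>) (s (near_idx s n (f \<omega>))) \<partial>M)"
      using sum_A by (intro Bochner_Integration.integral_cong) auto
    finally show ?thesis .
  qed
  show "(\<lambda>n. l (\<lambda>\<omega>. s (near_idx s n (f \<omega>)))) \<longlonglongrightarrow> (\<integral>\<omega>. blinfun_apply (v \<omega>) (f \<omega>) \<partial>M)"
    unfolding step
  proof (rule integral_dominated_convergence)
    show "(\<lambda>\<omega>. blinfun_apply (v \<omega>) (f \<omega>)) \<in> borel_measurable M" by (rule vm) measurable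
    show "(\<lambda>\<omega>. blinfun_apply (v \<omega>) (s (near_idx s n (f \<omega>)))) \<in> borel_measurable M" for n
      by (rule vm[OF Lp_funD(1)[OF near_fun(1)[OF f]]])
    show "integrable M (\<lambda>\<omega>. 2 * (norm (v \<omega>) * norm (f \<omega>)))" using int by simp
    show "AE \<omega> in M. (\<lambda>n. blinfun_apply (v \<omega>) (s (near_idx s n (f \<omega>)))) \<longlonglongrightarrow> blinfun_apply (v \<omega>) (f \<omega>)"
      by (intro AE_I2 tendsto_intros near_idx_tendsto s)
    have "norm (blinfun_apply (v \<omega>) (s (near_idx s n (f \<omega>)))) \<le> 2 * (norm (v \<omega>) * norm (f \<omega>))" for n \<omega>
      using order_trans[OF norm_blinfun mult_left_mono[OF norm_near_idx_le[OF s, of n "f \<omega>"] norm_ge_zero], of "v \<omega>"]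
      by simp
    then show "AE \<omega> in M. norm (blinfun_apply (v \<omega>) (s (near_idx s n (f \<omega>)))) \<le> 2 * (norm (v \<omega>) * norm (f \<omega>))" for n
      by simp
  qed
qed

lemma conj_powr: "(x powr (q - 1)) powr p = x powr q" "q > 1"
proof -
  show "q > 1" by (rule conjugate_exponent_gt_1[OF p conj])
  then have "p + q = p * q" using conj p by (simp add: field_simps)
  then have "(q - 1) * p = q" by (simp add: algebra_simps)
  then show "(x powr (q - 1)) powr p = x powr q" by (simp add: powr_powr)
qed

text \<open>Test \<open>l\<close> with the function of norm \<open>norm (v \<omega>) powr (q - 1)\<close> that nearly aligns with \<open>v \<omega>\<close>, truncated
where \<open>v\<close> is large. It realises equality in Young's inequality up to the factor \<open>1 - e\<close>, so that
the bound on \<open>l\<close> becomes a bound on the energy of \<open>v\<close>.\<close>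

lemma truncated_energy_le:
  assumes v: "v \<in> borel_measurable M" "integrable M (\<lambda>\<omega>. norm (v \<omega>))"
    and vE: "\<And>n E. E \<in> sets M \<Longrightarrow>
      l (\<lambda>\<omega>. indicator E \<omega> *\<^sub>R s n) = set_lebesgue_integral M E (\<lambda>\<omega>. blinfun_apply (v \<omega>) (s n))"
  shows "(\<integral>\<omega>. indicator {\<omega>. norm (v \<omega>) \<le> real N} \<omega> * norm (v \<omega>) powr q \<partial>M) \<le> q * c"
    "integrable M (\<lambda>\<omega>. indicator {\<omega>. norm (v \<omega>) \<le> real N} \<omega> * norm (v \<omega>) powr q)"
proof -
  note [measurable] = v(1)
  have q: "q > 1" by (rule conj_powr(2))
  define A where "A = {\<omega>. norm (v \<omega>) \<le> real N}"
  define I where "I = (\<integral>\<omega>. indicator A \<omega> * norm (v \<omega>) powr q \<partial>M)"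
  have indA [measurable]: "indicat_real A \<in> borel_measurable M"
    unfolding A_def indicator_def by measurable
  have int: "integrable M (\<lambda>\<omega>. indicator A \<omega> * norm (v \<omega>) powr q)"
    by (rule integrable_const_bound[of _ "real N powr q"])
       (use q in \<open>auto simp: A_def indicator_def intro!: powr_mono2\<close>)
  then show "integrable M (\<lambda>\<omega>. indicator {\<omega>. norm (v \<omega>) \<le> real N} \<omega> * norm (v \<omega>) powr q)"
    by (simp add: A_def)
  have I0: "0 \<le> I" by (simp add: I_def)
  have main: "(1 - e) * I \<le> c + I / p" if e: "0 < e" "e < 1" for e
  proof -
    define good where "good \<omega> k \<longleftrightarrow> (1 - e) * norm (v \<omega>) * norm (s k) \<le> \<bar>blinfun_apply (v \<omega>) (s k)\<bar> \<and>
      (v \<omega> \<noteq> 0 \<longrightarrow> s k \<noteq> 0)" for \<omega> k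
    define k where "k \<omega> = (LEAST k. good \<omega> k)" for \<omega>
    have good_k: "good \<omega> (k \<omega>)" for \<omega>
    proof -
      have "\<exists>k. good \<omega> k" unfolding good_def by (rule ex_near_norming_index[OF s e(1)])
      then show ?thesis unfolding k_def by (rule LeastI_ex)
    qed
    have [measurable]: "(\<lambda>\<omega>. blinfun_apply (v \<omega>) (s j)) \<in> borel_measurable M" for j
      by (rule borel_measurable_continuous_on[OF _ v(1)]) (intro continuous_intros)
    have [measurable]: "Measurable.pred M (\<lambda>\<omega>. v \<omega> \<noteq> 0)"
    proof -
      have "Measurable.pred M (\<lambda>\<omega>. norm (v \<omega>) \<noteq> 0)" by measurable
      then show ?thesis by simp
    qed
    have k_m [measurable]: "k \<in> measurable M (count_space UNIV)"
      unfolding k_def good_def by measurable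
    define u where "u \<omega> = sgn (blinfun_apply (v \<omega>) (s (k \<omega>))) *\<^sub>R sgn (s (k \<omega>))" for \<omega>
    have u_m: "u \<in> borel_measurable M"
      unfolding u_def
    proof (rule measurable_compose_countable[OF _ k_m])
      fix j
      have "(\<lambda>\<omega>. sgn (blinfun_apply (v \<omega>) (s j))) \<in> borel_measurable M" by measurable
      then show "(\<lambda>\<omega>. sgn (blinfun_apply (v \<omega>) (s j)) *\<^sub>R sgn (s j)) \<in> borel_measurable M"
        by (rule borel_measurable_continuous_on[rotated]) (intro continuous_intros)
    qed
    have u_le: "norm (u \<omega>) \<le> 1" for \<omega> by (simp add: u_def norm_sgn abs_sgn_eq)
    have vu: "(1 - e) * norm (v \<omega>) \<le> blinfun_apply (v \<omega>) (u \<omega>)" for \<omega>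
    proof (cases "v \<omega> = 0")
      case False
      then have sk: "s (k \<omega>) \<noteq> 0" and g: "(1 - e) * norm (v \<omega>) * norm (s (k \<omega>)) \<le> \<bar>blinfun_apply (v \<omega>) (s (k \<omega>))\<bar>"
        using good_k[of \<omega>] by (auto simp: good_def)
      define a where "a = blinfun_apply (v \<omega>) (s (k \<omega>))"
      have "blinfun_apply (v \<omega>) (u \<omega>) = a * sgn a / norm (s (k \<omega>))"
        unfolding u_def a_def[symmetric] sgn_div_norm[of "s (k \<omega>)"] blinfun.scaleR_right
        by (simp add: a_def divide_inverse)
      then have vu: "blinfun_apply (v \<omega>) (u \<omega>) = \<bar>blinfun_apply (v \<omega>) (s (k \<omega>))\<bar> / norm (s (k \<omega>))"
        by (simp add: a_def flip: abs_sgn)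
      have "0 < norm (s (k \<omega>))" using sk by simp
      from pos_le_divide_eq[OF this] g show ?thesis unfolding vu by blast
    qed (simp add: blinfun.zero_left)
    define h where "h \<omega> = indicat_real A \<omega> * norm (v \<omega>) powr (q - 1)" for \<omega>
    have [measurable]: "h \<in> borel_measurable M" unfolding h_def by measurable
    have h: "0 \<le> h \<omega>" "h \<omega> \<le> real N powr (q - 1)" for \<omega>
      using q by (auto simp: h_def A_def indicator_def intro!: powr_mono2)
    have hv: "h \<omega> * norm (v \<omega>) = indicator A \<omega> * norm (v \<omega>) powr q" for \<omega>
      using powr_mult_base[of "norm (v \<omega>)" "q - 1"] by (simp add: h_def mult_ac)
    define f where "f \<omega> = h \<omega> *\<^sub>R u \<omega>" for \<omega>
    have f_m: "f \<in> borel_measurable M"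
      unfolding f_def by (rule borel_measurable_scaleR_dense[OF s u_m]) measurable
    have f_le: "norm (f \<omega>) \<le> h \<omega>" for \<omega>
      using h(1)[of \<omega>] u_le[of \<omega>] by (simp add: f_def mult_left_le)
    have fF: "f \<in> \<F>"
      using f_le h(2) p f_m finite_measure_axioms
      by (intro bounded_Lp_fun[of M p f "real N powr (q - 1)"]) (auto intro: order_trans)
    have "l f = (\<integral>\<omega>. blinfun_apply (v \<omega>) (f \<omega>) \<partial>M)"
    proof (rule represented_if_integrable[OF v vE fF])
      show "integrable M (\<lambda>\<omega>. norm (v \<omega>) * norm (f \<omega>))"
      proof (rule Bochner_Integration.integrable_bound[OF int])
        show "(\<lambda>\<omega>. norm (v \<omega>) * norm (f \<omega>)) \<in> borel_measurable M" using f_m by measurable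
        have "norm (v \<omega>) * norm (f \<omega>) \<le> indicator A \<omega> * norm (v \<omega>) powr q" for \<omega>
          using mult_right_mono[OF f_le[of \<omega>] norm_ge_zero[of "v \<omega>"]] hv[of \<omega>] by (simp add: mult.commute)
        then show "AE \<omega> in M. norm (norm (v \<omega>) * norm (f \<omega>)) \<le> norm (indicator A \<omega> * norm (v \<omega>) powr q)"
          by (auto intro!: AE_I2)
      qed
    qed
    moreover have "(1 - e) * I \<le> (\<integral>\<omega>. blinfun_apply (v \<omega>) (f \<omega>) \<partial>M)"
    proof -
      have "(1 - e) * I = (\<integral>\<omega>. (1 - e) * (indicator A \<omega> * norm (v \<omega>) powr q) \<partial>M)"
        by (simp add: I_def)
      also have "\<dots> \<le> (\<integral>\<omega>. blinfun_apply (v \<omega>) (f \<omega>) \<partial>M)"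
      proof (rule integral_mono)
        show "integrable M (\<lambda>\<omega>. (1 - e) * (indicator A \<omega> * norm (v \<omega>) powr q))" using int by simp
        show "integrable M (\<lambda>\<omega>. blinfun_apply (v \<omega>) (f \<omega>))"
        proof (rule Bochner_Integration.integrable_bound[OF int])
          show "(\<lambda>\<omega>. blinfun_apply (v \<omega>) (f \<omega>)) \<in> borel_measurable M"
            by (rule borel_measurable_blinfun_apply_dense[OF s v(1) f_m])
          have "\<bar>blinfun_apply (v \<omega>) (f \<omega>)\<bar> \<le> indicator A \<omega> * norm (v \<omega>) powr q" for \<omega>
            using norm_blinfun[of "v \<omega>" "f \<omega>"] mult_right_mono[OF f_le[of \<omega>] norm_ge_zero[of "v \<omega>"]] hv[of \<omega>]
            by (simp add: mult.commute)
          then show "AE \<omega> in M. norm (blinfun_apply (v \<omega>) (f \<omega>)) \<le> norm (indicator A \<omega> * norm (v \<omega>) powr q)"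
            by (auto intro!: AE_I2)
        qed
        fix \<omega>
        have "(1 - e) * (indicator A \<omega> * norm (v \<omega>) powr q) = h \<omega> * ((1 - e) * norm (v \<omega>))"
          by (simp flip: hv)
        also have "\<dots> \<le> h \<omega> * blinfun_apply (v \<omega>) (u \<omega>)"
          using vu h(1) by (rule mult_left_mono)
        finally show "(1 - e) * (indicator A \<omega> * norm (v \<omega>) powr q) \<le> blinfun_apply (v \<omega>) (f \<omega>)"
          by (simp add: f_def blinfun.scaleR_right)
      qed
      finally show ?thesis .
    qed
    moreover have "Lp_energy M p f \<le> I / p"
    proof -
      have "(\<integral>\<omega>. norm (f \<omega>) powr p \<partial>M) \<le> I"
        unfolding I_def
      proof (rule integral_mono[OF Lp_funD(2)[OF fF] int])
        fix \<omega>
        have "norm (f \<omega>) powr p \<le> h \<omega> powr p" using f_le p by (intro powr_mono2) auto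
        also have "\<dots> = indicator A \<omega> * norm (v \<omega>) powr q"
          using p by (auto simp: h_def indicator_def conj_powr(1))
        finally show "norm (f \<omega>) powr p \<le> indicator A \<omega> * norm (v \<omega>) powr q" .
      qed
      then show ?thesis using p by (simp add: Lp_energy_def divide_right_mono)
    qed
    ultimately show ?thesis using le_energy[OF fF] by simp
  qed
  have "I \<le> c + I / p"
  proof (rule field_le_epsilon)
    fix \<epsilon> :: real assume \<epsilon>: "0 < \<epsilon>"
    define e where "e = min (1/2) (\<epsilon> / (I + 1))"
    have e: "0 < e" "e < 1" "e \<le> \<epsilon> / (I + 1)" using \<epsilon> I0 by (auto simp: e_def)
    have "e * (I + 1) \<le> \<epsilon>" using e(3) I0 by (subst (asm) pos_le_divide_eq) auto
    then have "e * I \<le> \<epsilon>" using e(1) by (simp add: algebra_simps)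
    then show "I \<le> c + I / p + \<epsilon>" using main[OF e(1,2)] by (simp add: algebra_simps)
  qed
  then have "I * (1 - 1 / p) \<le> c" by (simp add: algebra_simps)
  moreover have "1 - 1 / p = 1 / q" using conj by simp
  ultimately have "I * (1 / q) \<le> c" by simp
  then have "I \<le> q * c" using q by (simp add: field_simps)
  then show "(\<integral>\<omega>. indicator {\<omega>. norm (v \<omega>) \<le> real N} \<omega> * norm (v \<omega>) powr q \<partial>M) \<le> q * c"
    by (simp add: I_def A_def)
qed

theorem representation:
  obtains v where "v \<in> Lp_fun M q" "Lp_energy M q v \<le> c"
    "\<And>f. f \<in> \<F> \<Longrightarrow> l f = (\<integral>\<omega>. blinfun_apply (v \<omega>) (f \<omega>) \<partial>M)"
proof -
  obtain D v where D: "integrable M D" and vm [measurable]: "v \<in> borel_measurable M"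
    and vD: "\<And>\<omega>. norm (v \<omega>) \<le> D \<omega>"
    and vE: "\<And>n E. E \<in> sets M \<Longrightarrow>
      l (\<lambda>\<omega>. indicator E \<omega> *\<^sub>R s n) = set_lebesgue_integral M E (\<lambda>\<omega>. blinfun_apply (v \<omega>) (s n))"
    by (rule dual_valued_density) blast
  have q: "q > 1" by (rule conj_powr(2))
  have v1: "integrable M (\<lambda>\<omega>. norm (v \<omega>))"
    by (rule Bochner_Integration.integrable_bound[OF D]) (use vD in \<open>auto intro!: AE_I2 intro: order_trans abs_ge_self\<close>)
  note trunc = truncated_energy_le[OF vm v1 vE]
  let ?g = "\<lambda>N \<omega>. indicator {\<omega>. norm (v \<omega>) \<le> real N} \<omega> * norm (v \<omega>) powr q"
  have mono: "mono (\<lambda>N. ?g N \<omega>)" for \<omega>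
    by (rule monoI) (auto simp: indicator_def)
  have lim: "(\<lambda>N. ?g N \<omega>) \<longlonglongrightarrow> norm (v \<omega>) powr q" for \<omega>
  proof (rule tendsto_eventually)
    obtain N0 where "norm (v \<omega>) \<le> real N0" using real_arch_simple by blast
    then show "\<forall>\<^sub>F N in sequentially. ?g N \<omega> = norm (v \<omega>) powr q"
      by (intro eventually_sequentiallyI[of N0]) (auto simp: indicator_def)
  qed
  have "incseq (\<lambda>N. integral\<^sup>L M (?g N))"
    using mono by (intro monoI integral_mono trunc(2)) (auto dest: monoD)
  from incseq_convergent[OF this] trunc(1) obtain I where I: "(\<lambda>N. integral\<^sup>L M (?g N)) \<longlonglongrightarrow> I"
    by blast
  have m: "(\<lambda>\<omega>. norm (v \<omega>) powr q) \<in> borel_measurable M" by measurable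
  have int: "integrable M (\<lambda>\<omega>. norm (v \<omega>) powr q)" "(\<integral>\<omega>. norm (v \<omega>) powr q \<partial>M) = I"
    using integrable_monotone_convergence[OF trunc(2) _ _ I m] integral_monotone_convergence[OF trunc(2) _ _ I m] mono lim
    by auto
  have "I \<le> q * c" using I trunc(1) by (intro LIMSEQ_le_const2[OF I]) auto
  then have en: "Lp_energy M q v \<le> c" using q int(2) by (simp add: Lp_energy_def field_simps)
  have vq: "v \<in> Lp_fun M q" using int(1) vm by (simp add: Lp_fun_def)
  show ?thesis
  proof (rule that[OF vq en])
    fix f assume f: "f \<in> \<F>"
    note [measurable] = Lp_funD(1)[OF f]
    show "l f = (\<integral>\<omega>. blinfun_apply (v \<omega>) (f \<omega>) \<partial>M)"
    proof (rule represented_if_integrable[OF vm v1 vE f])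
      show "integrable M (\<lambda>\<omega>. norm (v \<omega>) * norm (f \<omega>))"
      proof (rule Bochner_Integration.integrable_bound)
        show "integrable M (\<lambda>\<omega>. norm (f \<omega>) powr p / p + norm (v \<omega>) powr q / q)"
          using Lp_funD(2)[OF f] int(1) by simp
        show "(\<lambda>\<omega>. norm (v \<omega>) * norm (f \<omega>)) \<in> borel_measurable M" by measurable
        show "AE \<omega> in M. norm (norm (v \<omega>) * norm (f \<omega>)) \<le> norm (norm (f \<omega>) powr p / p + norm (v \<omega>) powr q / q)"
          using Youngs_inequality[OF p q conj] by (auto intro!: AE_I2 order_trans[OF _ abs_ge_self] simp: mult.commute)
      qed
    qed
  qed
qed

end

section \<open>Self-dual functions and their contact sets\<close>

text \<open>The set \<open>H\<close> plays the role of the epigraph of a function that dominates its own conjugate with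
respect to \<open>\<beta>\<close>; the last conclusion says that it equals its conjugate on \<open>W\<close>. Given \<open>z\<close>, let \<open>m\<close> be half
the supremum of \<open>\<beta>\<close> over pairs of points of its orbit, and let \<open>(z, a)\<close> be compatible with \<open>H\<close>.
If \<open>a \<ge> m\<close>, the whole orbit at height \<open>a\<close> can be added to \<open>H\<close>, so it belongs to \<open>H\<close> already. If
\<open>a < m\<close>, the orbit belongs to \<open>H\<close> at height \<open>m\<close>, and compatibility of \<open>(z, a)\<close> with these points yields \<open>2 * m \<le> a + m\<close>, a contradiction. The form of the
assumption \<open>transfer\<close> makes compatibility with \<open>H\<close> an invariant property.\<close>

lemma maximal_invariant_clique:
  fixes \<beta> :: "'z \<Rightarrow> 'z \<Rightarrow> real" and R :: "'z \<Rightarrow> 'z \<Rightarrow> bool" and H0 :: "('z \<times> real) set"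
  assumes sym: "\<And>z w. \<beta> z w = \<beta> w z"
    and R_refl: "\<And>z. z \<in> W \<Longrightarrow> R z z" and R_sym: "\<And>z w. R z w \<Longrightarrow> R w z"
    and R_trans: "\<And>x y z. R x y \<Longrightarrow> R y z \<Longrightarrow> R x z"
    and R_W: "\<And>z w. z \<in> W \<Longrightarrow> R z w \<Longrightarrow> w \<in> W"
    and bound: "\<And>z. z \<in> W \<Longrightarrow> \<exists>K. \<forall>x y. R z x \<longrightarrow> R z y \<longrightarrow> \<beta> x y \<le> K"
    and transfer: "\<And>z z' w e. z \<in> W \<Longrightarrow> R z z' \<Longrightarrow> w \<in> W \<Longrightarrow> e > 0 \<Longrightarrow> \<exists>w'. R w w' \<and> \<beta> z w \<le> \<beta> z' w' + e"
    and H0_W: "H0 \<subseteq> W \<times> UNIV"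
    and H0_clique: "\<And>z a w b. (z, a) \<in> H0 \<Longrightarrow> (w, b) \<in> H0 \<Longrightarrow> \<beta> z w \<le> a + b"
    and H0_inv: "\<And>z a w. (z, a) \<in> H0 \<Longrightarrow> R z w \<Longrightarrow> (w, a) \<in> H0"
  obtains H where "H0 \<subseteq> H" "H \<subseteq> W \<times> UNIV"
    "\<And>z a w b. (z, a) \<in> H \<Longrightarrow> (w, b) \<in> H \<Longrightarrow> \<beta> z w \<le> a + b"
    "\<And>z a w. (z, a) \<in> H \<Longrightarrow> R z w \<Longrightarrow> (w, a) \<in> H"
    "\<And>z a. z \<in> W \<Longrightarrow> (\<And>w b. (w, b) \<in> H \<Longrightarrow> \<beta> z w \<le> a + b) \<Longrightarrow> (z, a) \<in> H"
proof -
  define clique where "clique H \<longleftrightarrow> (\<forall>z a w b. (z, a) \<in> H \<longrightarrow> (w, b) \<in> H \<longrightarrow> \<beta> z w \<le> a + b)" for H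
  define invar where "invar H \<longleftrightarrow> (\<forall>z a w. (z, a) \<in> H \<longrightarrow> R z w \<longrightarrow> (w, a) \<in> H)" for H :: "('z \<times> real) set"
  define \<A> where "\<A> = {H. H0 \<subseteq> H \<and> H \<subseteq> W \<times> UNIV \<and> clique H \<and> invar H}"
  have "H0 \<in> \<A>" using H0_W H0_clique H0_inv by (auto simp: \<A>_def clique_def invar_def)
  have "\<exists>H\<in>\<A>. \<forall>X\<in>\<A>. H \<subseteq> X \<longrightarrow> X = H"
  proof (rule subset_Zorn_nonempty)
    show "\<A> \<noteq> {}" using \<open>H0 \<in> \<A>\<close> by blast
    fix \<C> assume \<C>: "\<C> \<noteq> {}" "subset.chain \<A> \<C>"
    have lin: "X \<subseteq> Y \<or> Y \<subseteq> X" if "X \<in> \<C>" "Y \<in> \<C>" for X Y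
      using \<C>(2) that by (auto simp: subset.chain_def)
    have "\<C> \<subseteq> \<A>" using \<C>(2) by (simp add: subset.chain_def)
    have "clique (\<Union>\<C>)"
      unfolding clique_def
    proof (intro allI impI, elim UnionE)
      fix z a w b X Y assume "(z, a) \<in> X" "X \<in> \<C>" "(w, b) \<in> Y" "Y \<in> \<C>"
      with lin[of X Y] obtain Z where "Z \<in> \<C>" "(z, a) \<in> Z" "(w, b) \<in> Z" by blast
      moreover have "clique Z" using \<open>Z \<in> \<C>\<close> \<open>\<C> \<subseteq> \<A>\<close> by (auto simp: \<A>_def)
      ultimately show "\<beta> z w \<le> a + b" unfolding clique_def by blast
    qed
    moreover have "invar (\<Union>\<C>)" using \<open>\<C> \<subseteq> \<A>\<close> by (fastforce simp: \<A>_def invar_def)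
    moreover have "H0 \<subseteq> \<Union>\<C>" using \<C>(1) \<open>\<C> \<subseteq> \<A>\<close> by (auto simp: \<A>_def)
    moreover have "\<Union>\<C> \<subseteq> W \<times> UNIV" using \<open>\<C> \<subseteq> \<A>\<close> by (auto simp: \<A>_def)
    ultimately show "\<Union>\<C> \<in> \<A>" by (simp add: \<A>_def)
  qed
  then obtain H where H: "H \<in> \<A>" and max: "\<And>X. X \<in> \<A> \<Longrightarrow> H \<subseteq> X \<Longrightarrow> X = H" by blast
  have H_clique: "\<beta> z w \<le> a + b" if "(z, a) \<in> H" "(w, b) \<in> H" for z a w b
    using H that by (auto simp: \<A>_def clique_def)
  have H_inv: "(w, a) \<in> H" if "(z, a) \<in> H" "R z w" for z a w
    using H that by (auto simp: \<A>_def invar_def)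
  have H_W: "H \<subseteq> W \<times> UNIV" using H by (simp add: \<A>_def)
  \<comment> \<open>by maximality, an orbit can be added at a common height as soon as this keeps the clique property\<close>
  have add_orbit: "(x, a) \<in> H"
    if z: "z \<in> W" and x: "R z x" and HO: "\<And>x w b. R z x \<Longrightarrow> (w, b) \<in> H \<Longrightarrow> \<beta> x w \<le> a + b"
      and OO: "\<And>x y. R z x \<Longrightarrow> R z y \<Longrightarrow> \<beta> x y \<le> a + a" for z x a
  proof -
    let ?X = "H \<union> {(x, a) |x. R z x}"
    have "?X \<in> \<A>"
      unfolding \<A>_def
    proof (intro CollectI conjI)
      show "H0 \<subseteq> ?X" using H by (auto simp: \<A>_def)
      show "?X \<subseteq> W \<times> UNIV" using H_W R_W[OF z] by auto
      have "\<beta> w x \<le> b + a" if "R z x" "(w, b) \<in> H" for x w b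
        using HO[OF that] sym[of w x] by simp
      then show "clique ?X"
        unfolding clique_def using H_clique HO OO by blast
      show "invar ?X" unfolding invar_def using H_inv R_trans by blast
    qed
    from max[OF this] x show ?thesis by blast
  qed
  have "(z, a) \<in> H" if z: "z \<in> W" and rel: "\<And>w b. (w, b) \<in> H \<Longrightarrow> \<beta> z w \<le> a + b" for z a
  proof -
    have rel_orbit: "\<beta> x w \<le> a + b" if x: "R z x" and wb: "(w, b) \<in> H" for x w b
    proof (rule field_le_epsilon)
      fix e :: real assume "e > 0"
      moreover have "w \<in> W" using wb H_W by blast
      ultimately obtain w' where "R w w'" "\<beta> x w \<le> \<beta> z w' + e"
        using transfer[of x z w e] R_W[OF z x] R_sym[OF x] by blast
      then show "\<beta> x w \<le> a + b + e" using rel[OF H_inv[OF wb]] by fastforce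
    qed
    have "\<beta> x y \<le> a + a" if xy: "R z x" "R z y" for x y
    proof (rule ccontr)
      assume "\<not> \<beta> x y \<le> a + a"
      define S where "S = {\<beta> x y |x y. R z x \<and> R z y}"
      obtain K where "\<forall>x y. R z x \<longrightarrow> R z y \<longrightarrow> \<beta> x y \<le> K" using bound[OF z] by blast
      then have bdd: "bdd_above S" unfolding S_def bdd_above_def by blast
      define m where "m = Sup S / 2"
      have le_m: "\<beta> x y \<le> m + m" if "R z x" "R z y" for x y
      proof -
        have "\<beta> x y \<le> Sup S" using that by (intro cSup_upper bdd) (auto simp: S_def)
        then show ?thesis by (simp add: m_def)
      qed
      have "a < m" using \<open>\<not> \<beta> x y \<le> a + a\<close> le_m[OF xy] by linarith
      then have "\<beta> x w \<le> m + b" if "R z x" "(w, b) \<in> H" for x w b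
        using rel_orbit[OF that] by linarith
      then have "(x, m) \<in> H" if "R z x" for x
        using le_m by (intro add_orbit[OF z that])
      then have "\<beta> x y \<le> a + m" if "R z x" "R z y" for x y
        using rel_orbit that by blast
      then have "Sup S \<le> a + m" using R_refl[OF z] by (intro cSup_least) (auto simp: S_def)
      then show False using \<open>a < m\<close> by (simp add: m_def)
    qed
    then show ?thesis using rel_orbit by (intro add_orbit[OF z R_refl[OF z]]) auto
  qed
  moreover have "H0 \<subseteq> H" using H by (simp add: \<A>_def)
  ultimately show ?thesis using that[of H] H_clique H_inv H_W by blast
qed

text \<open>A space paired with itself by \<open>\<beta>\<close>, as a product of a space and its dual is. The last assumption is
both the representation of functionals and a bound of \<open>\<Phi>\<close> by its conjugate: \<open>\<Phi> w\<close> is at most every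
constant \<open>c\<close> for which \<open>\<beta> z w + c\<close> is minorised by \<open>- \<Phi> z\<close>.\<close>

locale self_dual_pairing =
  fixes Z :: "'z::real_vector set" and \<beta> :: "'z \<Rightarrow> 'z \<Rightarrow> real" and \<Phi> :: "'z \<Rightarrow> real"
  assumes Z: "subspace Z"
    and \<beta>_sym: "\<And>z w. \<beta> z w = \<beta> w z"
    and \<beta>_add: "\<And>x y z. x \<in> Z \<Longrightarrow> y \<in> Z \<Longrightarrow> z \<in> Z \<Longrightarrow> \<beta> (x + y) z = \<beta> x z + \<beta> y z"
    and \<beta>_scale: "\<And>r x z. x \<in> Z \<Longrightarrow> z \<in> Z \<Longrightarrow> \<beta> (r *\<^sub>R x) z = r * \<beta> x z"
    and \<Phi>_convex: "convex_on Z \<Phi>"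
    and \<Phi>_nonneg: "\<And>z. z \<in> Z \<Longrightarrow> 0 \<le> \<Phi> z"
    and \<Phi>_ge: "\<And>z. z \<in> Z \<Longrightarrow> - \<Phi> z \<le> \<beta> z z / 2"
    and \<Phi>_zero: "\<And>z w. z \<in> Z \<Longrightarrow> w \<in> Z \<Longrightarrow> \<Phi> z = 0 \<Longrightarrow> \<beta> w z = 0"
    and dual: "\<And>l c. linear_functional_on Z l \<Longrightarrow> (\<And>z. z \<in> Z \<Longrightarrow> - \<Phi> z \<le> l z + c) \<Longrightarrow>
      \<exists>w\<in>Z. \<Phi> w \<le> c \<and> (\<forall>z\<in>Z. l z = \<beta> z w)"
begin

lemma \<beta>_diff: "x \<in> Z \<Longrightarrow> y \<in> Z \<Longrightarrow> z \<in> Z \<Longrightarrow> \<beta> (x - y) z = \<beta> x z - \<beta> y z"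
  using \<beta>_add[of x "(-1) *\<^sub>R y" z] \<beta>_scale[of y z "-1"] subspace_scale[OF Z, of y "-1"] by simp

lemma \<beta>_add_right: "x \<in> Z \<Longrightarrow> y \<in> Z \<Longrightarrow> z \<in> Z \<Longrightarrow> \<beta> z (x + y) = \<beta> z x + \<beta> z y"
  using \<beta>_add \<beta>_sym by metis

lemma \<beta>_diff_right: "x \<in> Z \<Longrightarrow> y \<in> Z \<Longrightarrow> z \<in> Z \<Longrightarrow> \<beta> z (x - y) = \<beta> z x - \<beta> z y"
  using \<beta>_diff \<beta>_sym by metis

lemma \<beta>_diff_self: "x \<in> Z \<Longrightarrow> y \<in> Z \<Longrightarrow> \<beta> (x - y) (x - y) = \<beta> x x + \<beta> y y - 2 * \<beta> x y"
  using \<beta>_sym[of x y] by (simp add: \<beta>_diff \<beta>_diff_right subspace_diff[OF Z])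

text \<open>\<open>H\<close> is the epigraph of a self-conjugate function \<open>h\<close>, and \<open>T\<close> moves it so that \<open>z0\<close> becomes the
origin: the function \<open>h - \<beta> z z / 2\<close> is translated. The image stays above \<open>- \<Phi>\<close>, and an affine
function in between is represented by a point \<open>w0\<close>. Self-conjugacy puts \<open>z0 + w0\<close> into the contact
set, at a place where relatedness to \<open>z0\<close> is only possible if \<open>\<Phi> w0 = 0\<close>.\<close>

theorem contact_set_maximal:
  assumes H_Z: "H \<subseteq> Z \<times> UNIV" and H_ne: "H \<noteq> {}"
    and H_clique: "\<And>z a w b. (z, a) \<in> H \<Longrightarrow> (w, b) \<in> H \<Longrightarrow> \<beta> z w \<le> a + b"
    and H_max: "\<And>z a. z \<in> Z \<Longrightarrow> (\<And>w b. (w, b) \<in> H \<Longrightarrow> \<beta> z w \<le> a + b) \<Longrightarrow> (z, a) \<in> H"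
    and z0: "z0 \<in> Z"
    and related: "\<And>z. (z, \<beta> z z / 2) \<in> H \<Longrightarrow> 0 \<le> \<beta> (z - z0) (z - z0)"
  shows "(z0, \<beta> z0 z0 / 2) \<in> H"
proof -
  have HZ: "z \<in> Z" if "(z, a) \<in> H" for z a using that H_Z by blast
  \<comment> \<open>\<open>b - \<beta> z z0 + \<beta> z0 z0 / 2\<close> differs from \<open>\<beta> (z - z0) (z - z0) / 2\<close> by as much as \<open>b\<close> from \<open>\<beta> z z / 2\<close>\<close>
  define T where "T = (\<lambda>(z, b). (z - z0, b - \<beta> z z0 + \<beta> z0 z0 / 2))"
  have T: "T (z, b) = (z - z0, b - \<beta> z z0 + \<beta> z0 z0 / 2)" for z b by (simp add: T_def)
  have "convex (T ` H)"
  proof (rule convexI)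
    fix P P' and a b :: real assume P: "P \<in> T ` H" "P' \<in> T ` H" and ab: "0 \<le> a" "0 \<le> b" "a + b = 1"
    from P obtain z c z' c' where z: "(z, c) \<in> H" "(z', c') \<in> H" "P = T (z, c)" "P' = T (z', c')"
      by auto
    have ZZ: "z \<in> Z" "z' \<in> Z" "a *\<^sub>R z \<in> Z" "b *\<^sub>R z' \<in> Z" "a *\<^sub>R z + b *\<^sub>R z' \<in> Z"
      using HZ z(1,2) Z by (auto intro: subspace_add subspace_scale)
    have "(a *\<^sub>R z + b *\<^sub>R z', a * c + b * c') \<in> H"
    proof (rule H_max)
      fix w d assume w: "(w, d) \<in> H"
      have "\<beta> (a *\<^sub>R z + b *\<^sub>R z') w = a * \<beta> z w + b * \<beta> z' w"
        using ZZ HZ[OF w] by (simp add: \<beta>_add \<beta>_scale)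
      also have "\<dots> \<le> a * (c + d) + b * (c' + d)"
        using ab H_clique[OF z(1) w] H_clique[OF z(2) w] by (intro add_mono mult_left_mono) auto
      also have "\<dots> = a * c + b * c' + (a + b) * d" by (simp add: algebra_simps)
      finally show "\<beta> (a *\<^sub>R z + b *\<^sub>R z') w \<le> a * c + b * c' + d" using ab by simp
    qed (use ZZ in simp)
    moreover have "a *\<^sub>R P + b *\<^sub>R P' = T (a *\<^sub>R z + b *\<^sub>R z', a * c + b * c')"
    proof -
      have "a *\<^sub>R (z - z0) + b *\<^sub>R (z' - z0) = a *\<^sub>R z + b *\<^sub>R z' - (a + b) *\<^sub>R z0"
        by (simp add: algebra_simps)
      moreover have "a * (c - \<beta> z z0 + \<beta> z0 z0 / 2) + b * (c' - \<beta> z' z0 + \<beta> z0 z0 / 2) =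
          a * c + b * c' - (a * \<beta> z z0 + b * \<beta> z' z0) + (a + b) * (\<beta> z0 z0 / 2)"
        by (simp add: algebra_simps)
      ultimately show ?thesis
        using ab ZZ z0 by (simp add: z(3,4) T \<beta>_add \<beta>_scale)
    qed
    ultimately show "a *\<^sub>R P + b *\<^sub>R P' \<in> T ` H" by (metis image_eqI)
  qed
  moreover have "T ` H \<noteq> {}" using H_ne by simp
  moreover have "y \<in> Z" "- \<Phi> y \<le> b" if "(y, b) \<in> T ` H" for y b
  proof -
    from that obtain z a where z: "(z, a) \<in> H" "y = z - z0" "b = a - \<beta> z z0 + \<beta> z0 z0 / 2"
      by (auto simp: T_def)
    show y: "y \<in> Z" using z HZ z0 Z by (auto intro: subspace_diff)
    have "\<beta> z z / 2 \<le> a" using H_clique[OF z(1) z(1)] by simp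
    then have "\<beta> y y / 2 \<le> b" using z(2,3) HZ[OF z(1)] z0 by (simp add: \<beta>_diff_self)
    then show "- \<Phi> y \<le> b" using \<Phi>_ge[OF y] by simp
  qed
  ultimately obtain l c where l: "linear_functional_on Z l" "\<And>u. u \<in> Z \<Longrightarrow> - \<Phi> u \<le> l u + c"
    "\<And>y b. (y, b) \<in> T ` H \<Longrightarrow> l y + c \<le> b"
    using Hahn_Banach_sandwich[OF Z _ _ _ \<Phi>_convex, of "T ` H"] by blast
  obtain w0 where w0: "w0 \<in> Z" "\<Phi> w0 \<le> c" "\<And>z. z \<in> Z \<Longrightarrow> l z = \<beta> z w0"
    using dual[OF l(1,2)] by blast
  define a where "a = - c + \<beta> w0 z0 + \<beta> z0 z0 / 2"
  have wZ: "z0 + w0 \<in> Z" using z0 w0(1) by (rule subspace_add[OF Z])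
  have in_H: "(z0 + w0, a) \<in> H"
  proof (rule H_max[OF wZ])
    fix z b assume z: "(z, b) \<in> H"
    have "T (z, b) \<in> T ` H" using z by (rule imageI)
    then have "l (z - z0) + c \<le> b - \<beta> z z0 + \<beta> z0 z0 / 2" by (simp add: T l(3))
    then have "\<beta> z w0 - \<beta> z0 w0 + c \<le> b - \<beta> z z0 + \<beta> z0 z0 / 2"
      using HZ[OF z] z0 w0 Z by (simp add: subspace_diff \<beta>_diff)
    then show "\<beta> (z0 + w0) z \<le> a + b"
      using HZ[OF z] z0 w0(1) \<beta>_sym[of z0 z] \<beta>_sym[of w0 z] \<beta>_sym[of w0 z0]
      by (simp add: a_def \<beta>_add)
  qed
  have sq: "\<beta> (z0 + w0) (z0 + w0) = \<beta> z0 z0 + \<beta> w0 w0 + 2 * \<beta> w0 z0"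
    using z0 w0(1) wZ \<beta>_sym[of z0 w0] by (simp add: \<beta>_add \<beta>_add_right)
  \<comment> \<open>all inequalities in \<open>- c \<ge> \<beta> w0 w0 / 2 \<ge> - \<Phi> w0 \<ge> - c\<close> are equalities\<close>
  have "\<beta> w0 w0 / 2 \<le> - c" using H_clique[OF in_H in_H] sq by (simp add: a_def)
  then have eq: "\<beta> w0 w0 / 2 = - c" "\<Phi> w0 = c" using \<Phi>_ge[OF w0(1)] w0(2) by linarith+
  then have "a = \<beta> (z0 + w0) (z0 + w0) / 2" using sq by (simp add: a_def)
  with in_H have "(z0 + w0, \<beta> (z0 + w0) (z0 + w0) / 2) \<in> H" by metis
  from related[OF this] have "0 \<le> \<beta> w0 w0" by simp
  then have "\<Phi> w0 = 0" using eq \<Phi>_nonneg[OF w0(1)] by simp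
  then have 0: "\<beta> z w0 = 0" if "z \<in> Z" for z using \<Phi>_zero w0(1) that by blast
  have "a = \<beta> z0 z0 / 2" using eq \<open>\<Phi> w0 = 0\<close> 0[OF z0] \<beta>_sym[of w0 z0] by (simp add: a_def)
  show ?thesis
  proof (rule H_max[OF z0])
    fix z b assume z: "(z, b) \<in> H"
    have "\<beta> (z0 + w0) z = \<beta> z0 z"
      using \<beta>_add[OF z0 w0(1) HZ[OF z]] 0[OF HZ[OF z]] \<beta>_sym[of w0 z] by simp
    then show "\<beta> z0 z \<le> \<beta> z0 z0 / 2 + b" using H_clique[OF in_H z] \<open>a = \<beta> z0 z0 / 2\<close> by simp
  qed
qed

end

section \<open>Classes of functions and closed convex hulls\<close>

lemma Lp_class_mem:
  assumes "f \<in> Lp_fun M p"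
  shows "Lp_class M p f \<in> Lp M p" "f \<in> Lp_class M p f"
proof -
  show "Lp_class M p f \<in> Lp M p" unfolding Lp_def Lp_class_def using assms by (rule quotientI)
  show "f \<in> Lp_class M p f" using assms by (simp add: Lp_class_def Lp_eq_def)
qed

lemma Lp_rep_class:
  assumes "f \<in> Lp_fun M p"
  shows "Lp_rep (Lp_class M p f) \<in> Lp_fun M p" "AE \<omega> in M. Lp_rep (Lp_class M p f) \<omega> = f \<omega>"
  using Lp_rep_AE[OF Lp_class_mem[OF assms]] by auto

lemma Lp_class_rep:
  assumes "X \<in> Lp M p"
  shows "Lp_rep X \<in> Lp_fun M p" "Lp_class M p (Lp_rep X) = X"
proof -
  obtain f where f: "f \<in> Lp_fun M p" "X = Lp_class M p f"
    using assms by (auto simp: Lp_def Lp_class_def elim: quotientE)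
  show "Lp_rep X \<in> Lp_fun M p" using Lp_rep_class(1)[OF f(1)] f(2) by simp
  then show "Lp_class M p (Lp_rep X) = X"
    unfolding f(2) using Lp_rep_class[OF f(1)] f by (intro Lp_class_eqI) (auto dest: Lp_funD)
qed

lemma Lp_lincomb_class:
  fixes f g :: "'w \<Rightarrow> 'b::real_normed_vector"
  assumes s: "dense_seq (s :: nat \<Rightarrow> 'b)" and f: "f \<in> Lp_fun M p" and g: "g \<in> Lp_fun M p"
  shows "Lp_lincomb M p a (Lp_class M p f) b (Lp_class M p g) = Lp_class M p (\<lambda>\<omega>. a *\<^sub>R f \<omega> + b *\<^sub>R g \<omega>)"
  unfolding Lp_lincomb_def
proof (rule Lp_class_eqI)
  show "AE \<omega> in M. a *\<^sub>R Lp_rep (Lp_class M p f) \<omega> + b *\<^sub>R Lp_rep (Lp_class M p g) \<omega> = a *\<^sub>R f \<omega> + b *\<^sub>R g \<omega>"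
    using Lp_rep_class(2)[OF f] Lp_rep_class(2)[OF g] by eventually_elim simp
  show "(\<lambda>\<omega>. a *\<^sub>R Lp_rep (Lp_class M p f) \<omega> + b *\<^sub>R Lp_rep (Lp_class M p g) \<omega>) \<in> borel_measurable M"
    by (intro borel_measurable_lincomb_dense[OF s] Lp_funD(1)[OF Lp_rep_class(1)] f g)
  show "(\<lambda>\<omega>. a *\<^sub>R f \<omega> + b *\<^sub>R g \<omega>) \<in> borel_measurable M"
    by (intro borel_measurable_lincomb_dense[OF s] Lp_funD(1)[OF f] Lp_funD(1)[OF g])
qed

lemma Lp_diff_class:
  fixes f g :: "'w \<Rightarrow> 'b::real_normed_vector"
  assumes s: "dense_seq (s :: nat \<Rightarrow> 'b)" and f: "f \<in> Lp_fun M p" and g: "g \<in> Lp_fun M p"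
  shows "Lp_diff M p (Lp_class M p f) (Lp_class M p g) = Lp_class M p (\<lambda>\<omega>. f \<omega> - g \<omega>)"
  using Lp_lincomb_class[OF assms, of 1 "-1"] by (simp add: Lp_lincomb_def Lp_diff_def)

lemma Lp_norm_diff_class:
  fixes f g :: "'w \<Rightarrow> 'b::real_normed_vector"
  assumes s: "dense_seq (s :: nat \<Rightarrow> 'b)" and p: "p \<ge> 1" and f: "f \<in> Lp_fun M p" and g: "g \<in> Lp_fun M p"
  shows "Lp_norm M p (Lp_diff M p (Lp_class M p f) (Lp_class M p g)) =
    (p * Lp_energy M p (\<lambda>\<omega>. f \<omega> - g \<omega>)) powr (1 / p)"
  unfolding Lp_diff_class[OF s f g]
  using Lp_norm_eq[OF Lp_class_mem[OF Lp_fun_diff[OF s p f g]]] p by (simp add: Lp_energy_def)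

lemma mp_mapsD:
  assumes "g \<in> mp_maps M" shows "g \<in> measurable M M" "distr M M g = M"
  using assms by (auto simp: mp_maps_def)

lemma Lp_fun_comp:
  assumes g: "g \<in> mp_maps M" and f: "f \<in> Lp_fun M p"
  shows "f \<circ> g \<in> Lp_fun M p"
proof -
  note gm = mp_mapsD[OF g] and fm = Lp_funD[OF f]
  have "integrable (distr M M g) (\<lambda>\<omega>. norm (f \<omega>) powr p)" using fm(2) gm(2) by simp
  then have "integrable M (\<lambda>\<omega>. norm (f (g \<omega>)) powr p)"
    by (rule integrable_distr[OF gm(1)])
  then show ?thesis using measurable_comp[OF gm(1) fm(1)] by (simp add: Lp_fun_def)
qed

lemma integral_comp_mp_maps:
  fixes h :: "'w \<Rightarrow> real"
  assumes g: "g \<in> mp_maps M" and h: "h \<in> borel_measurable M"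
  shows "(\<integral>\<omega>. h (g \<omega>) \<partial>M) = (\<integral>\<omega>. h \<omega> \<partial>M)"
  using integral_distr[OF mp_mapsD(1)[OF g] h] mp_mapsD(2)[OF g] by simp

lemma Lp_energy_comp:
  assumes g: "g \<in> mp_maps M" and f: "f \<in> Lp_fun M p"
  shows "Lp_energy M p (f \<circ> g) = Lp_energy M p f"
  using integral_comp_mp_maps[OF g borel_measurable_integrable[OF Lp_funD(2)[OF f]]]
  by (simp add: Lp_energy_def)

lemma Lp_comp_class:
  assumes "f \<in> Lp_fun M p" "g \<in> mp_maps M"
  shows "Lp_comp M p (Lp_class M p f) g = Lp_class M p (f \<circ> g)"
  using Lp_comp_eq[OF Lp_class_mem[OF assms(1)] assms(2)] .

context
  fixes M :: "'w measure" and p :: real and s :: "nat \<Rightarrow> 'b::real_normed_vector"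
    and D :: "('w \<Rightarrow> 'b) set set"
  assumes s: "dense_seq s" and p: "p \<ge> 1" and D: "D \<subseteq> Lp M p"
begin

abbreviation (input) "\<K> \<equiv> Lp_closed_convex_hull M p D"

lemma closed_convex_hull_subset: "D \<subseteq> \<K>"
  unfolding Lp_closed_convex_hull_def by (rule hull_subset)

lemma closed_convex_hull_minimal:
  "D \<subseteq> T \<Longrightarrow> T \<subseteq> Lp M p \<Longrightarrow> Lp_convex M p T \<Longrightarrow> Lp_closed M p T \<Longrightarrow> \<K> \<subseteq> T"
  unfolding Lp_closed_convex_hull_def by (rule hull_minimal) auto

lemma closed_convex_hull_convex: "Lp_convex M p \<K>"
  unfolding Lp_convex_def
proof (intro ballI allI impI)
  fix X Y and a b :: real
  assume "X \<in> \<K>" "Y \<in> \<K>" "0 \<le> a" "0 \<le> b" "a + b = 1"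
  then show "Lp_lincomb M p a X b Y \<in> \<K>"
    unfolding Lp_closed_convex_hull_def hull_def by (auto simp: Lp_convex_def)
qed

lemma closed_convex_hull_closed: "Lp_closed M p \<K>"
  unfolding Lp_closed_def
proof (intro allI impI)
  fix Y X
  assume *: "(\<forall>n::nat. Y n \<in> \<K>) \<and> X \<in> Lp M p \<and> (\<lambda>n. Lp_norm M p (Lp_diff M p (Y n) X)) \<longlonglongrightarrow> 0"
  have "X \<in> T" if T: "T \<subseteq> Lp M p" "Lp_convex M p T" "Lp_closed M p T" "D \<subseteq> T" for T
  proof -
    have "\<forall>n. Y n \<in> T" using * closed_convex_hull_minimal[OF T(4,1,2,3)] by blast
    then show ?thesis using * T(3) unfolding Lp_closed_def by blast
  qed
  then show "X \<in> \<K>" unfolding Lp_closed_convex_hull_def hull_def by blast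
qed

lemma closed_convex_hull_seq:
  assumes "\<And>n::nat. Y n \<in> \<K>" "X \<in> Lp M p" "(\<lambda>n. Lp_norm M p (Lp_diff M p (Y n) X)) \<longlonglongrightarrow> 0"
  shows "X \<in> \<K>"
  using closed_convex_hull_closed[unfolded Lp_closed_def, rule_format, of Y X] assms by simp

lemma closed_convex_hull_lincomb:
  assumes "f \<in> Lp_fun M p" "g \<in> Lp_fun M p" "Lp_class M p f \<in> \<K>" "Lp_class M p g \<in> \<K>"
    "0 \<le> a" "0 \<le> b" "a + b = 1"
  shows "Lp_class M p (\<lambda>\<omega>. a *\<^sub>R f \<omega> + b *\<^sub>R g \<omega>) \<in> \<K>"
  using closed_convex_hull_convex assms(3-) Lp_lincomb_class[OF s assms(1,2), of a b]
  unfolding Lp_convex_def by metis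

lemma closed_convex_hull_limit:
  assumes f: "\<And>n::nat. f n \<in> Lp_fun M p" "\<And>n. Lp_class M p (f n) \<in> \<K>" and g: "g \<in> Lp_fun M p"
    and lim: "(\<lambda>n. Lp_energy M p (\<lambda>\<omega>. f n \<omega> - g \<omega>)) \<longlonglongrightarrow> 0"
  shows "Lp_class M p g \<in> \<K>"
proof -
  have "(\<lambda>n. (p * Lp_energy M p (\<lambda>\<omega>. f n \<omega> - g \<omega>)) powr (1 / p)) \<longlonglongrightarrow> 0 powr (1 / p)"
    using tendsto_mult[OF tendsto_const lim, of p] p by (intro tendsto_powr') (auto simp: Lp_energy_nonneg)
  then have "(\<lambda>n. Lp_norm M p (Lp_diff M p (Lp_class M p (f n)) (Lp_class M p g))) \<longlonglongrightarrow> 0"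
    by (simp add: Lp_norm_diff_class[OF s p f(1) g])
  then show ?thesis by (rule closed_convex_hull_seq[OF f(2) Lp_class_mem(1)[OF g]])
qed

text \<open>Energy tends to zero exactly if the norm does; so a point outside a closed set keeps a positive
energy distance from it.\<close>

lemma closed_convex_hull_energy_gap:
  assumes g: "g \<in> Lp_fun M p" "Lp_class M p g \<notin> \<K>"
  shows "\<exists>d>0. \<forall>f\<in>Lp_fun M p. Lp_class M p f \<in> \<K> \<longrightarrow> d \<le> Lp_energy M p (\<lambda>\<omega>. f \<omega> - g \<omega>)"
proof (rule ccontr)
  assume *: "\<not> ?thesis"
  have "\<exists>f. f \<in> Lp_fun M p \<and> Lp_class M p f \<in> \<K> \<and> Lp_energy M p (\<lambda>\<omega>. f \<omega> - g \<omega>) < 1 / real (Suc n)" for n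
  proof -
    have "1 / real (Suc n) > 0" by simp
    with * show ?thesis by (meson not_le)
  qed
  then obtain f where f: "\<And>n. f n \<in> Lp_fun M p" "\<And>n. Lp_class M p (f n) \<in> \<K>"
    "\<And>n. Lp_energy M p (\<lambda>\<omega>. f n \<omega> - g \<omega>) < 1 / real (Suc n)" by metis
  have "(\<lambda>n. Lp_energy M p (\<lambda>\<omega>. f n \<omega> - g \<omega>)) \<longlonglongrightarrow> 0"
  proof (rule tendsto_sandwich[OF _ _ tendsto_const LIMSEQ_Suc[OF lim_1_over_n]])
    show "\<forall>\<^sub>F n in sequentially. 0 \<le> Lp_energy M p (\<lambda>\<omega>. f n \<omega> - g \<omega>)"
      using p by (intro always_eventually allI Lp_energy_nonneg) auto
    show "\<forall>\<^sub>F n in sequentially. Lp_energy M p (\<lambda>\<omega>. f n \<omega> - g \<omega>) \<le> 1 / real (Suc n)"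
      using f(3) by (intro always_eventually allI less_imp_le)
  qed
  from closed_convex_hull_limit[OF f(1,2) g(1) this] g(2) show False by blast
qed

text \<open>Composition with \<open>g\<close> is an isometry that commutes with linear combinations, so the classes that it maps
into the hull form a closed convex set.\<close>

lemma closed_convex_hull_comp:
  assumes g: "g \<in> mp_maps M" and DD: "\<And>X. X \<in> D \<Longrightarrow> Lp_comp M p X g \<in> D" and X: "X \<in> \<K>"
  shows "Lp_comp M p X g \<in> \<K>"
proof -
  define T where "T = {X \<in> Lp M p. Lp_comp M p X g \<in> \<K>}"
  have TI: "Lp_class M p f \<in> T \<longleftrightarrow> Lp_class M p (f \<circ> g) \<in> \<K>" if "f \<in> Lp_fun M p" for f
    using that by (simp add: T_def Lp_class_mem Lp_comp_class g)
  have "\<K> \<subseteq> T"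
  proof (rule closed_convex_hull_minimal)
    show "D \<subseteq> T" using D DD closed_convex_hull_subset by (auto simp: T_def)
    show "T \<subseteq> Lp M p" by (auto simp: T_def)
    show "Lp_convex M p T"
      unfolding Lp_convex_def
    proof (intro ballI allI impI)
      fix X Y and a b :: real assume XY: "X \<in> T" "Y \<in> T" and ab: "0 \<le> a" "0 \<le> b" "a + b = 1"
      define f h where "f = Lp_rep X" and "h = Lp_rep Y"
      have f: "f \<in> Lp_fun M p" "X = Lp_class M p f" and h: "h \<in> Lp_fun M p" "Y = Lp_class M p h"
        using XY by (simp_all add: f_def h_def T_def Lp_class_rep)
      have "Lp_class M p (f \<circ> g) \<in> \<K>" "Lp_class M p (h \<circ> g) \<in> \<K>" using XY TI f h by auto
      from closed_convex_hull_lincomb[OF Lp_fun_comp[OF g f(1)] Lp_fun_comp[OF g h(1)] this ab]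
      have "Lp_class M p (\<lambda>\<omega>. a *\<^sub>R (f \<circ> g) \<omega> + b *\<^sub>R (h \<circ> g) \<omega>) \<in> \<K>" .
      then have "Lp_class M p (\<lambda>\<omega>. a *\<^sub>R f \<omega> + b *\<^sub>R h \<omega>) \<in> T"
        using TI[OF Lp_fun_add[OF s p Lp_fun_scale[OF f(1)] Lp_fun_scale[OF h(1)]], of a b]
        by (simp add: comp_def)
      then show "Lp_lincomb M p a X b Y \<in> T" using Lp_lincomb_class[OF s f(1) h(1)] f(2) h(2) by simp
    qed
    show "Lp_closed M p T"
      unfolding Lp_closed_def
    proof (intro allI impI, elim conjE)
      fix Y X assume Y: "\<forall>n::nat. Y n \<in> T" and X: "X \<in> Lp M p"
        and lim: "(\<lambda>n. Lp_norm M p (Lp_diff M p (Y n) X)) \<longlonglongrightarrow> 0"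
      define y x where "y n = Lp_rep (Y n)" and "x = Lp_rep X" for n
      have y: "y n \<in> Lp_fun M p" "Y n = Lp_class M p (y n)" and x: "x \<in> Lp_fun M p" "X = Lp_class M p x" for n
        using Y X by (simp_all add: y_def x_def T_def Lp_class_rep)
      have "Lp_norm M p (Lp_diff M p (Lp_class M p (y n \<circ> g)) (Lp_class M p (x \<circ> g))) =
          Lp_norm M p (Lp_diff M p (Y n) X)" for n
        using Lp_energy_comp[OF g Lp_fun_diff[OF s p y(1)[of n] x(1)]]
        unfolding y(2)[of n] x(2) Lp_norm_diff_class[OF s p y(1) x(1)]
          Lp_norm_diff_class[OF s p Lp_fun_comp[OF g y(1)] Lp_fun_comp[OF g x(1)]]
        by (simp add: comp_def)
      then have "(\<lambda>n. Lp_norm M p (Lp_diff M p (Lp_class M p (y n \<circ> g)) (Lp_class M p (x \<circ> g)))) \<longlonglongrightarrow> 0"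
        using lim by simp
      moreover have "Lp_class M p (y n \<circ> g) \<in> \<K>" for n using Y y TI by auto
      moreover have "Lp_class M p (x \<circ> g) \<in> Lp M p" by (intro Lp_class_mem Lp_fun_comp g x)
      ultimately have "Lp_class M p (x \<circ> g) \<in> \<K>"
        using closed_convex_hull_seq[of "\<lambda>n. Lp_class M p (y n \<circ> g)"] by blast
      then show "X \<in> T" using TI x by simp
    qed
  qed
  then show ?thesis using X by (auto simp: T_def)
qed

end

section \<open>Duality for a reflexive target\<close>

lemma Lp_fun_integrable_norm:
  fixes f :: "'w \<Rightarrow> 'b::real_normed_vector"
  assumes "finite_measure M" "p \<ge> 1" and f: "f \<in> Lp_fun M p"
  shows "integrable M (\<lambda>\<omega>. norm (f \<omega>))"
proof -
  interpret finite_measure M by fact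
  note [measurable] = Lp_funD(1)[OF f]
  have le: "x \<le> 1 + x powr p" if "x \<ge> 0" for x :: real
  proof (cases "x \<le> 1")
    case False
    then show ?thesis using powr_mono[of 1 p x] assms(2) by simp
  qed (simp add: add_increasing2)
  show ?thesis
  proof (rule Bochner_Integration.integrable_bound)
    show "integrable M (\<lambda>\<omega>. 1 + norm (f \<omega>) powr p)" using Lp_funD(2)[OF f] by simp
    show "AE \<omega> in M. norm (norm (f \<omega>)) \<le> norm (1 + norm (f \<omega>) powr p)"
      using le by (intro AE_I2) (simp add: order_trans[OF le abs_ge_self])
  qed measurable
qed

text \<open>The dense sequences are parameters, so that a single choice serves all measurability
arguments in the target, its dual and its bidual.\<close>

locale reflexive_Lp = prob_space M for M :: "'w measure" +
  fixes p q :: real and s :: "nat \<Rightarrow> 'a::{banach, second_countable_topology}"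
    and t :: "nat \<Rightarrow> 'a \<Rightarrow>\<^sub>L real" and u :: "nat \<Rightarrow> ('a \<Rightarrow>\<^sub>L real) \<Rightarrow>\<^sub>L real"
  assumes borel: "standard_borel M" and nonatomic: "nonatomic M"
    and reflexive: "reflexive_space TYPE('a)"
    and p: "1 < p" and conj: "1 / p + 1 / q = 1"
    and s: "dense_seq s" and t: "dense_seq t" and u: "dense_seq u"
begin

abbreviation \<X> :: "('w \<Rightarrow> 'a) set" where "\<X> \<equiv> Lp_fun M p"
abbreviation \<V> :: "('w \<Rightarrow> 'a \<Rightarrow>\<^sub>L real) set" where "\<V> \<equiv> Lp_fun M q"
abbreviation \<Z> :: "(('w \<Rightarrow> 'a) \<times> ('w \<Rightarrow> 'a \<Rightarrow>\<^sub>L real)) set" where "\<Z> \<equiv> \<X> \<times> \<V>"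

lemma q: "1 < q" by (rule conjugate_exponent_gt_1[OF p conj])

lemma conj': "1 / q + 1 / p = 1" using conj by simp

lemma subspace_X: "subspace \<X>" by (rule subspace_Lp_fun[OF s]) (use p in simp)
lemma subspace_V: "subspace \<V>" by (rule subspace_Lp_fun[OF t]) (use q in simp)
lemma subspace_Z: "subspace \<Z>" by (intro subspace_Times subspace_X subspace_V)

definition pairing :: "('w \<Rightarrow> 'a \<Rightarrow>\<^sub>L real) \<Rightarrow> ('w \<Rightarrow> 'a) \<Rightarrow> real" where
  "pairing v f = (\<integral>\<omega>. blinfun_apply (v \<omega>) (f \<omega>) \<partial>M)"

lemma pairing_integrable: "v \<in> \<V> \<Longrightarrow> f \<in> \<X> \<Longrightarrow> integrable M (\<lambda>\<omega>. blinfun_apply (v \<omega>) (f \<omega>))"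
  by (rule integrable_pairing(1)[OF s p conj])

lemma pairing_le: "v \<in> \<V> \<Longrightarrow> f \<in> \<X> \<Longrightarrow> \<bar>pairing v f\<bar> \<le> Lp_energy M p f + Lp_energy M q v"
  unfolding pairing_def by (rule integrable_pairing(2)[OF s p conj])

lemma pairing_add_left: "v \<in> \<V> \<Longrightarrow> v' \<in> \<V> \<Longrightarrow> f \<in> \<X> \<Longrightarrow> pairing (v + v') f = pairing v f + pairing v' f"
  by (simp add: pairing_def plus_fun_def blinfun.add_left pairing_integrable)

lemma pairing_add_right: "v \<in> \<V> \<Longrightarrow> f \<in> \<X> \<Longrightarrow> f' \<in> \<X> \<Longrightarrow> pairing v (f + f') = pairing v f + pairing v f'"
  by (simp add: pairing_def plus_fun_def blinfun.add_right pairing_integrable)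

lemma pairing_scale_left: "pairing (r *\<^sub>R v) f = r * pairing v f"
  by (simp add: pairing_def scaleR_fun_def blinfun.scaleR_left)

lemma pairing_scale_right: "pairing v (r *\<^sub>R f) = r * pairing v f"
  by (simp add: pairing_def scaleR_fun_def blinfun.scaleR_right)

lemma pairing_zero: "pairing 0 f = 0" "pairing v 0 = 0"
  using pairing_scale_left[of 0 0 f] pairing_scale_right[of v 0 0] by auto

definition \<beta> :: "('w \<Rightarrow> 'a) \<times> ('w \<Rightarrow> 'a \<Rightarrow>\<^sub>L real) \<Rightarrow> ('w \<Rightarrow> 'a) \<times> ('w \<Rightarrow> 'a \<Rightarrow>\<^sub>L real) \<Rightarrow> real" where
  "\<beta> z w = pairing (snd z) (fst w) + pairing (snd w) (fst z)"

definition \<Phi> :: "('w \<Rightarrow> 'a) \<times> ('w \<Rightarrow> 'a \<Rightarrow>\<^sub>L real) \<Rightarrow> real" where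
  "\<Phi> z = Lp_energy M p (fst z) + Lp_energy M q (snd z)"

lemma \<beta>_self: "\<beta> z z / 2 = pairing (snd z) (fst z)"
  by (simp add: \<beta>_def)

lemma \<beta>_le: "z \<in> \<Z> \<Longrightarrow> w \<in> \<Z> \<Longrightarrow> \<bar>\<beta> z w\<bar> \<le> \<Phi> z + \<Phi> w"
  using pairing_le[of "snd z" "fst w"] pairing_le[of "snd w" "fst z"] unfolding \<beta>_def \<Phi>_def mem_Times_iff
  by linarith

lemma dual_of_X:
  assumes l: "linear_functional_on \<X> l" and le: "\<And>f. f \<in> \<X> \<Longrightarrow> l f \<le> c + Lp_energy M p f"
  shows "\<exists>v\<in>\<V>. Lp_energy M q v \<le> c \<and> (\<forall>f\<in>\<X>. l f = pairing v f)"
proof -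
  interpret energy_bounded_functional M p q c l s t
    by standard (use p conj s t l le in auto)
  show ?thesis by (rule representation) (auto simp: pairing_def)
qed

text \<open>Functionals on dual-valued functions are represented by bidual-valued ones, which reflexivity
pulls back to the target space.\<close>

lemma dual_of_V:
  assumes l: "linear_functional_on \<V> l" and le: "\<And>v. v \<in> \<V> \<Longrightarrow> l v \<le> c + Lp_energy M q v"
  shows "\<exists>f\<in>\<X>. Lp_energy M p f \<le> c \<and> (\<forall>v\<in>\<V>. l v = pairing v f)"
proof -
  interpret E: energy_bounded_functional M q p c l t u
    by standard (use q conj' t u l le in auto)
  obtain \<Lambda> where \<Lambda>: "\<Lambda> \<in> Lp_fun M p" "Lp_energy M p \<Lambda> \<le> c"
    "\<And>v. v \<in> \<V> \<Longrightarrow> l v = (\<integral>\<omega>. blinfun_apply (\<Lambda> \<omega>) (v \<omega>) \<partial>M)"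
    by (rule E.representation) blast
  obtain J :: "(('a \<Rightarrow>\<^sub>L real) \<Rightarrow>\<^sub>L real) \<Rightarrow> 'a"
    where J: "\<And>\<Lambda> f. blinfun_apply f (J \<Lambda>) = blinfun_apply \<Lambda> f" "\<And>\<Lambda>. norm (J \<Lambda>) = norm \<Lambda>"
      "J \<in> borel_measurable borel"
    by (rule reflexive_eval_inverse[OF reflexive]) blast
  have "(\<lambda>\<omega>. J (\<Lambda> \<omega>)) \<in> \<X>"
    using Lp_funD[OF \<Lambda>(1)] measurable_compose[OF _ J(3)] by (simp add: Lp_fun_def J(2))
  moreover have "Lp_energy M p (\<lambda>\<omega>. J (\<Lambda> \<omega>)) \<le> c"
    using \<Lambda>(2) by (simp add: Lp_energy_def J(2))
  ultimately show ?thesis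
    using \<Lambda>(3) by (intro bexI[of _ "\<lambda>\<omega>. J (\<Lambda> \<omega>)"]) (auto simp: pairing_def J(1))
qed

text \<open>A functional on the product splits into two. The constant \<open>c\<close> has to be split accordingly, which is why
\<open>c1\<close> is the least constant that works for the first summand.\<close>

lemma dual_of_Z:
  assumes l: "linear_functional_on \<Z> l" and ge: "\<And>z. z \<in> \<Z> \<Longrightarrow> - \<Phi> z \<le> l z + c"
  shows "\<exists>w\<in>\<Z>. \<Phi> w \<le> c \<and> (\<forall>z\<in>\<Z>. l z = \<beta> z w)"
proof -
  have zX: "(0 :: 'w \<Rightarrow> 'a) \<in> \<X>" and zV: "(0 :: 'w \<Rightarrow> 'a \<Rightarrow>\<^sub>L real) \<in> \<V>"
    using subspace_0 subspace_X subspace_V by auto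
  define l1 l2 where "l1 f = - l (f, 0)" and "l2 v = - l (0, v)" for f v
  have l_add: "l (z + w) = l z + l w" if "z \<in> \<Z>" "w \<in> \<Z>" for z w
    using l that unfolding linear_functional_on_def by blast
  have l_scale: "l (r *\<^sub>R z) = r * l z" if "z \<in> \<Z>" for r z
    using l that unfolding linear_functional_on_def by blast
  have l_split: "l (f, v) = - (l1 f + l2 v)" if "f \<in> \<X>" "v \<in> \<V>" for f v
    using l_add[of "(f, 0)" "(0, v)"] that zX zV by (simp add: l1_def l2_def)
  have lin1: "linear_functional_on \<X> l1"
    unfolding linear_functional_on_def
  proof (intro conjI ballI allI)
    show "l1 (f + g) = l1 f + l1 g" if "f \<in> \<X>" "g \<in> \<X>" for f g
      using l_add[of "(f, 0)" "(g, 0)"] that zV by (simp add: l1_def)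
    show "l1 (r *\<^sub>R f) = r * l1 f" if "f \<in> \<X>" for f r
      using l_scale[of "(f, 0)" r] that zV by (simp add: l1_def)
  qed
  have lin2: "linear_functional_on \<V> l2"
    unfolding linear_functional_on_def
  proof (intro conjI ballI allI)
    show "l2 (f + g) = l2 f + l2 g" if "f \<in> \<V>" "g \<in> \<V>" for f g
      using l_add[of "(0, f)" "(0, g)"] that zX by (simp add: l2_def)
    show "l2 (r *\<^sub>R f) = r * l2 f" if "f \<in> \<V>" for f r
      using l_scale[of "(0, f)" r] that zX by (simp add: l2_def)
  qed
  have le: "l1 f - Lp_energy M p f \<le> c - (l2 v - Lp_energy M q v)" if "f \<in> \<X>" "v \<in> \<V>" for f v
    using ge[of "(f, v)"] that l_split[OF that] by (simp add: \<Phi>_def)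
  define c1 where "c1 = (SUP f\<in>\<X>. l1 f - Lp_energy M p f)"
  have "l1 f \<le> c1 + Lp_energy M p f" if "f \<in> \<X>" for f
  proof -
    have "l1 f - Lp_energy M p f \<le> c1"
      unfolding c1_def using le[OF _ zV] that
      by (intro cSUP_upper bdd_aboveI2[of _ _ "c - (l2 0 - Lp_energy M q 0)"]) auto
    then show ?thesis by simp
  qed
  from dual_of_X[OF lin1 this] obtain v0 where v0: "v0 \<in> \<V>" "Lp_energy M q v0 \<le> c1" "\<And>f. f \<in> \<X> \<Longrightarrow> l1 f = pairing v0 f"
    by blast
  have "l2 v \<le> (c - c1) + Lp_energy M q v" if "v \<in> \<V>" for v
  proof -
    have "c1 \<le> c - (l2 v - Lp_energy M q v)"
      unfolding c1_def using zX le[OF _ that] by (intro cSUP_least) auto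
    then show ?thesis by simp
  qed
  from dual_of_V[OF lin2 this] obtain f0 where f0: "f0 \<in> \<X>" "Lp_energy M p f0 \<le> c - c1" "\<And>v. v \<in> \<V> \<Longrightarrow> l2 v = pairing v f0"
    by blast
  have neg: "Lp_energy M r ((-1) *\<^sub>R g) = Lp_energy M r g" for r and g :: "'w \<Rightarrow> 'c::real_normed_vector"
    using Lp_energy_scale[of M r "-1" g] by (simp add: scaleR_fun_def)
  show ?thesis
  proof (intro bexI conjI ballI)
    let ?w = "((-1) *\<^sub>R f0, (-1) *\<^sub>R v0)"
    show "?w \<in> \<Z>" using f0 v0 subspace_X subspace_V by (auto intro: subspace_neg)
    show "\<Phi> ?w \<le> c" unfolding \<Phi>_def fst_conv snd_conv neg using f0 v0 by simp
    show "l z = \<beta> z ?w" if "z \<in> \<Z>" for z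
      using l_split[of "fst z" "snd z"] that f0(3) v0(3)
      unfolding \<beta>_def fst_conv snd_conv pairing_scale_left pairing_scale_right by (auto simp: mem_Times_iff)
  qed
qed

text \<open>The sandwich theorem applied to the indicator function of \<open>K - f0\<close> and the energy lowered by \<open>d\<close>.\<close>

lemma separation:
  assumes K: "K \<subseteq> \<X>" "K \<noteq> {}" "convex K" and f0: "f0 \<in> \<X>"
    and d: "d > 0" "\<And>f. f \<in> K \<Longrightarrow> d \<le> Lp_energy M p (f - f0)"
  shows "\<exists>v\<in>\<V>. \<exists>\<sigma>. (\<forall>f\<in>K. pairing v f \<le> \<sigma>) \<and> \<sigma> < pairing v f0"
proof -
  define Q where "Q = (\<lambda>f. (f - f0, 0::real)) ` K"
  have "convex Q"
  proof (rule convexI)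
    fix P P' and a b :: real assume P: "P \<in> Q" "P' \<in> Q" and ab: "0 \<le> a" "0 \<le> b" "a + b = 1"
    from P obtain f g where f: "f \<in> K" "g \<in> K" "P = (f - f0, 0)" "P' = (g - f0, 0)" by (auto simp: Q_def)
    have "a *\<^sub>R (f - f0) + b *\<^sub>R (g - f0) = (a *\<^sub>R f + b *\<^sub>R g) - (a + b) *\<^sub>R f0"
      by (simp add: algebra_simps)
    then have "a *\<^sub>R P + b *\<^sub>R P' = ((a *\<^sub>R f + b *\<^sub>R g) - f0, 0)" using f ab by simp
    moreover have "a *\<^sub>R f + b *\<^sub>R g \<in> K" using convexD[OF K(3) f(1,2) ab] .
    ultimately show "a *\<^sub>R P + b *\<^sub>R P' \<in> Q" by (auto simp: Q_def)
  qed
  moreover have "Q \<noteq> {}" using K(2) by (simp add: Q_def)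
  moreover have "y \<in> \<X>" if "(y, b) \<in> Q" for y b
    using that K(1) f0 subspace_diff[OF subspace_X] by (auto simp: Q_def)
  moreover have "convex_on \<X> (\<lambda>f. Lp_energy M p f + - d)"
    by (intro convex_on_add convex_on_Lp_energy[OF s])
       (use p subspace_imp_convex[OF subspace_X] in \<open>auto simp: convex_on_const\<close>)
  moreover have "- (Lp_energy M p y + - d) \<le> b" if "(y, b) \<in> Q" for y b
    using that d(2) by (auto simp: Q_def)
  ultimately obtain l c where l: "linear_functional_on \<X> l"
    "\<And>f. f \<in> \<X> \<Longrightarrow> - (Lp_energy M p f + - d) \<le> l f + c" "\<And>y b. (y, b) \<in> Q \<Longrightarrow> l y + c \<le> b"
    using Hahn_Banach_sandwich[OF subspace_X, of Q "\<lambda>f. Lp_energy M p f + - d"] by blast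
  have l_scale: "l (r *\<^sub>R f) = r * l f" if "f \<in> \<X>" for r f
    using l(1) that unfolding linear_functional_on_def by blast
  have l_add: "l (f + g) = l f + l g" if "f \<in> \<X>" "g \<in> \<X>" for f g
    using l(1) that unfolding linear_functional_on_def by blast
  have lm: "linear_functional_on \<X> (\<lambda>f. - l f)"
    using l_add l_scale by (simp add: linear_functional_on_def)
  have "- l f \<le> (c - d) + Lp_energy M p f" if "f \<in> \<X>" for f using l(2)[OF that] by simp
  from dual_of_X[OF lm this] obtain v where v: "v \<in> \<V>" "\<And>f. f \<in> \<X> \<Longrightarrow> - l f = pairing v f" by blast
  have c: "d \<le> c"
    using l(2)[OF subspace_0[OF subspace_X]] l_scale[OF subspace_0[OF subspace_X], of 0] p
    by (simp add: Lp_energy_def zero_fun_def)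
  define w where "w = (-1) *\<^sub>R v"
  have wV: "w \<in> \<V>" unfolding w_def by (rule subspace_scale[OF subspace_V v(1)])
  have pairing_w: "pairing w f = l f" if "f \<in> \<X>" for f
    unfolding w_def pairing_scale_left using v(2)[OF that] by simp
  have "pairing w f \<le> pairing w f0 - d" if f: "f \<in> K" for f
  proof -
    have "l (f - f0) + c \<le> 0" using l(3)[of "f - f0" 0] f by (auto simp: Q_def)
    moreover have "l (f - f0) = l f - l f0"
      using f K(1) subspace_neg[OF subspace_X f0] l_add[of f "- f0"] l_scale[OF f0, of "-1"] by auto
    ultimately show ?thesis using f K(1) f0 c by (auto simp: pairing_w)
  qed
  then show ?thesis using wV d(1) by (intro bexI[of _ w] exI[of _ "pairing w f0 - d"]) auto
qed

sublocale self_dual_pairing \<Z> \<beta> \<Phi>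
proof
  show "subspace \<Z>" by (rule subspace_Z)
  show "\<beta> z w = \<beta> w z" for z w by (simp add: \<beta>_def)
  show "\<beta> (x + y) z = \<beta> x z + \<beta> y z" if "x \<in> \<Z>" "y \<in> \<Z>" "z \<in> \<Z>" for x y z
    using that by (auto simp: \<beta>_def pairing_add_left pairing_add_right)
  show "\<beta> (r *\<^sub>R x) z = r * \<beta> x z" for r x z
    by (simp add: \<beta>_def pairing_scale_left pairing_scale_right algebra_simps)
  show "convex_on \<Z> \<Phi>"
    unfolding convex_on_def
  proof (intro conjI ballI allI impI)
    show "convex \<Z>" by (rule subspace_imp_convex[OF subspace_Z])
    fix z w and a b :: real assume zw: "z \<in> \<Z>" "w \<in> \<Z>" and ab: "0 \<le> a" "0 \<le> b" "a + b = 1"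
    have "Lp_energy M p (a *\<^sub>R fst z + b *\<^sub>R fst w) \<le> a * Lp_energy M p (fst z) + b * Lp_energy M p (fst w)"
      using convex_on_Lp_energy[OF s, of p M] p zw ab unfolding convex_on_def mem_Times_iff by auto
    moreover have "Lp_energy M q (a *\<^sub>R snd z + b *\<^sub>R snd w) \<le> a * Lp_energy M q (snd z) + b * Lp_energy M q (snd w)"
      using convex_on_Lp_energy[OF t, of q M] q zw ab unfolding convex_on_def mem_Times_iff by auto
    ultimately show "\<Phi> (a *\<^sub>R z + b *\<^sub>R w) \<le> a * \<Phi> z + b * \<Phi> w"
      by (simp add: \<Phi>_def algebra_simps)
  qed
  show "0 \<le> \<Phi> z" for z using p q by (simp add: \<Phi>_def Lp_energy_nonneg)
  show "- \<Phi> z \<le> \<beta> z z / 2" if "z \<in> \<Z>" for z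
    using pairing_le[of "snd z" "fst z"] that unfolding \<beta>_self \<Phi>_def by auto
  show "\<beta> w z = 0" if z: "z \<in> \<Z>" and "w \<in> \<Z>" and 0: "\<Phi> z = 0" for z w
  proof -
    have "Lp_energy M p (fst z) = 0" "Lp_energy M q (snd z) = 0"
      using 0 Lp_energy_nonneg[of p M "fst z"] Lp_energy_nonneg[of q M "snd z"] p q
      unfolding \<Phi>_def by linarith+
    then have "(\<integral>\<omega>. norm (fst z \<omega>) powr p \<partial>M) = 0" "(\<integral>\<omega>. norm (snd z \<omega>) powr q \<partial>M) = 0"
      using p q by (simp_all add: Lp_energy_def)
    then have "AE \<omega> in M. norm (fst z \<omega>) powr p = 0" "AE \<omega> in M. norm (snd z \<omega>) powr q = 0"
      using integral_nonneg_eq_0_iff_AE[OF Lp_funD(2)[of "fst z" M p]]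
        integral_nonneg_eq_0_iff_AE[OF Lp_funD(2)[of "snd z" M q]] z by auto
    then have "AE \<omega> in M. fst z \<omega> = 0" "AE \<omega> in M. snd z \<omega> = 0" by simp_all
    then have "AE \<omega> in M. blinfun_apply (snd w \<omega>) (fst z \<omega>) = 0" "AE \<omega> in M. blinfun_apply (snd z \<omega>) (fst w \<omega>) = 0"
      by (eventually_elim, simp add: blinfun.zero_right blinfun.zero_left)+
    then show ?thesis by (simp add: \<beta>_def pairing_def integral_eq_zero_AE)
  qed
  show "\<exists>w\<in>\<Z>. \<Phi> w \<le> c \<and> (\<forall>z\<in>\<Z>. l z = \<beta> z w)"
    if "linear_functional_on \<Z> l" "\<And>z. z \<in> \<Z> \<Longrightarrow> - \<Phi> z \<le> l z + c" for l c
    using dual_of_Z that by blast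
qed

end

section \<open>Law invariance and the extension theorem\<close>

context reflexive_Lp
begin

definition law :: "('w \<Rightarrow> 'a) \<times> ('w \<Rightarrow> 'a \<Rightarrow>\<^sub>L real) \<Rightarrow> ('a \<times> ('a \<Rightarrow>\<^sub>L real)) measure" where
  "law z = distr M (borel \<Otimes>\<^sub>M borel) (\<lambda>\<omega>. (fst z \<omega>, snd z \<omega>))"

definition same_law :: "('w \<Rightarrow> 'a) \<times> ('w \<Rightarrow> 'a \<Rightarrow>\<^sub>L real) \<Rightarrow> ('w \<Rightarrow> 'a) \<times> ('w \<Rightarrow> 'a \<Rightarrow>\<^sub>L real) \<Rightarrow> bool" where
  "same_law z w \<longleftrightarrow> z \<in> \<Z> \<and> w \<in> \<Z> \<and> law z = law w"

definition rearrange :: "('w \<Rightarrow> 'a) \<times> ('w \<Rightarrow> 'a \<Rightarrow>\<^sub>L real) \<Rightarrow> ('w \<Rightarrow> 'w) \<Rightarrow> ('w \<Rightarrow> 'a) \<times> ('w \<Rightarrow> 'a \<Rightarrow>\<^sub>L real)" where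
  "rearrange z g = (fst z \<circ> g, snd z \<circ> g)"

definition norm1 :: "('w \<Rightarrow> 'a) \<times> ('w \<Rightarrow> 'a \<Rightarrow>\<^sub>L real) \<Rightarrow> real" where
  "norm1 z = (\<integral>\<omega>. norm (fst z \<omega>) \<partial>M) + (\<integral>\<omega>. norm (snd z \<omega>) \<partial>M)"

lemma ZD: "z \<in> \<Z> \<Longrightarrow> fst z \<in> \<X>" "z \<in> \<Z> \<Longrightarrow> snd z \<in> \<V>"
  by auto

lemma Z_measurable:
  assumes "z \<in> \<Z>"
  shows "fst z \<in> borel_measurable M" "snd z \<in> borel_measurable M"
    "(\<lambda>\<omega>. (fst z \<omega>, snd z \<omega>)) \<in> measurable M (borel \<Otimes>\<^sub>M borel)"
  using assms Lp_funD(1)[of "fst z" M p] Lp_funD(1)[of "snd z" M q] by (auto intro!: measurable_Pair)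

lemma Z_integrable_norm:
  assumes "z \<in> \<Z>"
  shows "integrable M (\<lambda>\<omega>. norm (fst z \<omega>))" "integrable M (\<lambda>\<omega>. norm (snd z \<omega>))"
  using Lp_fun_integrable_norm[OF finite_measure_axioms _ ZD(1)[OF assms]]
    Lp_fun_integrable_norm[OF finite_measure_axioms _ ZD(2)[OF assms]] p q by auto

lemma norm1_nonneg: "0 \<le> norm1 z"
  by (simp add: norm1_def)

lemma integral_same_law:
  fixes F :: "'a \<times> ('a \<Rightarrow>\<^sub>L real) \<Rightarrow> real"
  assumes "same_law z w" and F: "F \<in> borel_measurable (borel \<Otimes>\<^sub>M borel)"
  shows "(\<integral>\<omega>. F (fst z \<omega>, snd z \<omega>) \<partial>M) = (\<integral>\<omega>. F (fst w \<omega>, snd w \<omega>) \<partial>M)"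
proof -
  have z: "z \<in> \<Z>" "w \<in> \<Z>" "law z = law w" using assms(1) by (auto simp: same_law_def)
  have "(\<integral>\<omega>. F (fst x \<omega>, snd x \<omega>) \<partial>M) = (\<integral>y. F y \<partial>law x)" if "x \<in> \<Z>" for x
    unfolding law_def by (rule integral_distr[symmetric, OF Z_measurable(3)[OF that] F])
  then show ?thesis using z by simp
qed

lemma pairing_same_law:
  assumes "same_law z w" shows "pairing (snd z) (fst z) = pairing (snd w) (fst w)"
proof -
  have "(\<lambda>y :: 'a \<times> ('a \<Rightarrow>\<^sub>L real). blinfun_apply (snd y) (fst y)) \<in> borel_measurable (borel \<Otimes>\<^sub>M borel)"
    by (rule borel_measurable_blinfun_apply_dense[OF s]) auto
  from integral_same_law[OF assms this] show ?thesis by (simp add: pairing_def)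
qed

lemma \<beta>_same_law: "same_law z w \<Longrightarrow> \<beta> z z = \<beta> w w"
  using pairing_same_law by (simp add: \<beta>_def)

lemma \<Phi>_same_law:
  assumes "same_law z w" shows "\<Phi> z = \<Phi> w"
proof -
  have "(\<lambda>y :: 'a \<times> ('a \<Rightarrow>\<^sub>L real). norm (fst y) powr p) \<in> borel_measurable (borel \<Otimes>\<^sub>M borel)"
    "(\<lambda>y :: 'a \<times> ('a \<Rightarrow>\<^sub>L real). norm (snd y) powr q) \<in> borel_measurable (borel \<Otimes>\<^sub>M borel)"
    by measurable
  from integral_same_law[OF assms this(1)] integral_same_law[OF assms this(2)]
  show ?thesis by (simp add: \<Phi>_def Lp_energy_def)
qed

lemma same_law_refl: "z \<in> \<Z> \<Longrightarrow> same_law z z"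
  and same_law_sym: "same_law z w \<Longrightarrow> same_law w z"
  and same_law_trans: "same_law x y \<Longrightarrow> same_law y z \<Longrightarrow> same_law x z"
  by (auto simp: same_law_def)

lemma rearrange_Z: "z \<in> \<Z> \<Longrightarrow> g \<in> mp_maps M \<Longrightarrow> rearrange z g \<in> \<Z>"
  by (auto simp: rearrange_def Lp_fun_comp)

lemma same_law_rearrange:
  assumes z: "z \<in> \<Z>" and g: "g \<in> mp_maps M" shows "same_law z (rearrange z g)"
proof -
  have "law (rearrange z g) = distr M (borel \<Otimes>\<^sub>M borel) ((\<lambda>\<omega>. (fst z \<omega>, snd z \<omega>)) \<circ> g)"
    by (simp add: law_def rearrange_def comp_def)
  also have "\<dots> = distr (distr M M g) (borel \<Otimes>\<^sub>M borel) (\<lambda>\<omega>. (fst z \<omega>, snd z \<omega>))"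
    by (rule distr_distr[symmetric, OF Z_measurable(3)[OF z] mp_mapsD(1)[OF g]])
  also have "\<dots> = law z" by (simp add: mp_mapsD(2)[OF g] law_def)
  finally show ?thesis using z rearrange_Z[OF z g] by (simp add: same_law_def)
qed

lemma \<beta>_rearrange:
  assumes z: "z \<in> \<Z>" and w: "w \<in> \<Z>" and g: "g \<in> mp_maps M"
  shows "\<beta> (rearrange z g) (rearrange w g) = \<beta> z w"
proof -
  have "pairing (v \<circ> g) (f \<circ> g) = pairing v f" if "v \<in> \<V>" "f \<in> \<X>" for v f
    using integral_comp_mp_maps[OF g borel_measurable_integrable[OF pairing_integrable[OF that]]] by (simp add: pairing_def)
  then show ?thesis using z w by (auto simp: \<beta>_def rearrange_def)
qed

lemma norm1_rearrange:
  assumes z: "z \<in> \<Z>" and g: "g \<in> mp_maps M" shows "norm1 (rearrange z g) = norm1 z"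
  using integral_comp_mp_maps[OF g borel_measurable_integrable[OF Z_integrable_norm(1)[OF z]]]
    integral_comp_mp_maps[OF g borel_measurable_integrable[OF Z_integrable_norm(2)[OF z]]]
  by (simp add: norm1_def rearrange_def)

text \<open>Uniform closeness lets a fixed function \<open>w\<close> be paired using only its integrable norm.\<close>

lemma \<beta>_perturb:
  assumes z: "z \<in> \<Z>" "z' \<in> \<Z>" and w: "w \<in> \<Z>"
    and close: "AE \<omega> in M. dist (fst z \<omega>) (fst z' \<omega>) < e \<and> dist (snd z \<omega>) (snd z' \<omega>) < e"
  shows "\<bar>\<beta> z w - \<beta> z' w\<bar> \<le> e * norm1 w"
proof -
  have d: "z - z' \<in> \<Z>" using z by (rule subspace_diff[OF subspace_Z])
  have pairing_bound: "\<bar>pairing v f\<bar> \<le> (\<integral>\<omega>. h \<omega> \<partial>M)"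
    if "v \<in> \<V>" "f \<in> \<X>" "integrable M h" "AE \<omega> in M. norm (v \<omega>) * norm (f \<omega>) \<le> h \<omega>" for v f h
  proof -
    have "\<bar>pairing v f\<bar> \<le> (\<integral>\<omega>. \<bar>blinfun_apply (v \<omega>) (f \<omega>)\<bar> \<partial>M)"
      unfolding pairing_def by (rule integral_abs_bound)
    also have "\<dots> \<le> (\<integral>\<omega>. h \<omega> \<partial>M)"
    proof (rule integral_mono_AE)
      show "AE \<omega> in M. \<bar>blinfun_apply (v \<omega>) (f \<omega>)\<bar> \<le> h \<omega>"
        using that(4) by eventually_elim (metis norm_blinfun order_trans real_norm_def)
    qed (use pairing_integrable that in auto)
    finally show ?thesis .
  qed
  have "\<bar>pairing (snd (z - z')) (fst w)\<bar> \<le> (\<integral>\<omega>. e * norm (fst w \<omega>) \<partial>M)"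
  proof (rule pairing_bound)
    show "AE \<omega> in M. norm (snd (z - z') \<omega>) * norm (fst w \<omega>) \<le> e * norm (fst w \<omega>)"
      using close by eventually_elim (auto simp: dist_norm intro!: mult_right_mono)
  qed (use ZD[OF d] ZD[OF w] Z_integrable_norm[OF w] in auto)
  moreover have "\<bar>pairing (snd w) (fst (z - z'))\<bar> \<le> (\<integral>\<omega>. e * norm (snd w \<omega>) \<partial>M)"
  proof (rule pairing_bound)
    show "AE \<omega> in M. norm (snd w \<omega>) * norm (fst (z - z') \<omega>) \<le> e * norm (snd w \<omega>)"
      using close by eventually_elim (auto simp: dist_norm mult.commute[of "norm (snd w _)"] intro!: mult_right_mono)
  qed (use ZD[OF d] ZD[OF w] Z_integrable_norm[OF w] in auto)
  ultimately have "\<bar>\<beta> (z - z') w\<bar> \<le> e * norm1 w"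
    unfolding \<beta>_def norm1_def by (simp add: distrib_left)
  then show ?thesis using \<beta>_diff[OF z w] by simp
qed

lemma same_law_approx:
  assumes "same_law z w" "e > 0"
  obtains g where "g \<in> mp_maps M"
    "AE \<omega> in M. dist (fst (rearrange z g) \<omega>) (fst w \<omega>) < e \<and> dist (snd (rearrange z g) \<omega>) (snd w \<omega>) < e"
proof -
  have z: "z \<in> \<Z>" "w \<in> \<Z>" "law z = law w" using assms(1) by (auto simp: same_law_def)
  obtain g where "g \<in> mp_maps M"
    "AE \<omega> in M. dist (fst z (g \<omega>)) (fst w \<omega>) < e \<and> dist (snd z (g \<omega>)) (snd w \<omega>) < e"
    by (rule equidistributed_approx_rearrangement[OF prob_space_axioms borel nonatomic s t
          Z_measurable(1)[OF z(1)] Z_measurable(1)[OF z(2)] Z_measurable(2)[OF z(1)] Z_measurable(2)[OF z(2)]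
          z(3)[unfolded law_def] assms(2)]) blast
  then show ?thesis using that by (simp add: rearrange_def)
qed

text \<open>The point \<open>w\<close> is moved by the map that approximately carries \<open>z\<close> to \<open>z'\<close>. An exact counterpart
need not exist, since \<open>z'\<close> may generate a larger sigma algebra than \<open>z\<close>; the error \<open>e\<close> accounts for this.\<close>

lemma same_law_transfer:
  assumes zz: "same_law z z'" and w: "w \<in> \<Z>" and e: "e > 0"
  shows "\<exists>w'. same_law w w' \<and> \<beta> z w \<le> \<beta> z' w' + e"
proof -
  define \<delta> where "\<delta> = e / (norm1 w + 1)"
  have \<delta>: "\<delta> > 0" using e norm1_nonneg[of w] by (simp add: \<delta>_def)
  have "\<delta> * norm1 w \<le> \<delta> * (norm1 w + 1)" using \<delta> by simp
  also have "\<dots> = e" using norm1_nonneg[of w] by (simp add: \<delta>_def)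
  finally have \<delta>e: "\<delta> * norm1 w \<le> e" .
  obtain g where g: "g \<in> mp_maps M" "AE \<omega> in M. dist (fst (rearrange z g) \<omega>) (fst z' \<omega>) < \<delta> \<and> dist (snd (rearrange z g) \<omega>) (snd z' \<omega>) < \<delta>"
    by (rule same_law_approx[OF zz \<delta>]) blast
  have z: "z \<in> \<Z>" "z' \<in> \<Z>" using zz by (auto simp: same_law_def)
  have "\<bar>\<beta> (rearrange z g) (rearrange w g) - \<beta> z' (rearrange w g)\<bar> \<le> \<delta> * norm1 (rearrange w g)"
    by (rule \<beta>_perturb[OF rearrange_Z[OF z(1) g(1)] z(2) rearrange_Z[OF w g(1)] g(2)])
  then have "\<beta> z w \<le> \<beta> z' (rearrange w g) + e"
    unfolding \<beta>_rearrange[OF z(1) w g(1)] norm1_rearrange[OF w g(1)] using \<delta>e by linarith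
  then show ?thesis using same_law_rearrange[OF w g(1)] by blast
qed

lemma same_law_bounded: "same_law z x \<Longrightarrow> same_law z y \<Longrightarrow> \<beta> x y \<le> 2 * \<Phi> z"
  using \<beta>_le[of x y] \<Phi>_same_law[of z x] \<Phi>_same_law[of z y] by (auto simp: same_law_def)

text \<open>The operator as a set of pairs of functions, closed under changes on null sets.\<close>

definition graph :: "('w, 'a) Lp_operator \<Rightarrow> (('w \<Rightarrow> 'a) \<times> ('w \<Rightarrow> 'a \<Rightarrow>\<^sub>L real)) set" where
  "graph A = {z \<in> \<Z>. (Lp_class M p (fst z), Lp_class M q (snd z)) \<in> A}"

lemma pairing_diff_class:
  assumes "z \<in> \<Z>" "w \<in> \<Z>"
  shows "Lp_pairing M (Lp_diff M q (Lp_class M q (snd z)) (Lp_class M q (snd w)))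
      (Lp_diff M p (Lp_class M p (fst z)) (Lp_class M p (fst w))) = \<beta> (z - w) (z - w) / 2"
proof -
  have mem: "fst z \<in> \<X>" "fst w \<in> \<X>" "snd z \<in> \<V>" "snd w \<in> \<V>" using assms by auto
  have d: "(\<lambda>\<omega>. fst z \<omega> - fst w \<omega>) \<in> \<X>" "(\<lambda>\<omega>. snd z \<omega> - snd w \<omega>) \<in> \<V>"
    using Lp_fun_diff[OF s _ mem(1,2)] Lp_fun_diff[OF t _ mem(3,4)] p q by auto
  show ?thesis
    unfolding Lp_diff_class[OF s mem(1,2)] Lp_diff_class[OF t mem(3,4)] \<beta>_self
    using Lp_pairing_eq[OF Lp_class_mem[OF d(1)] Lp_class_mem[OF d(2)]] by (simp add: pairing_def)
qed

lemma graph_rep: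
  assumes "(X, V) \<in> A" "A \<subseteq> Lp M p \<times> Lp M q"
  shows "(Lp_rep X, Lp_rep V) \<in> graph A" "Lp_class M p (Lp_rep X) = X" "Lp_class M q (Lp_rep V) = V"
  using assms by (auto simp: graph_def Lp_class_rep)

lemma monotone_op_iff:
  "monotone_op M p q A \<longleftrightarrow> A \<subseteq> Lp M p \<times> Lp M q \<and> (\<forall>z\<in>graph A. \<forall>w\<in>graph A. 0 \<le> \<beta> (z - w) (z - w))"
proof (intro iffI conjI ballI)
  assume A: "monotone_op M p q A"
  then show "A \<subseteq> Lp M p \<times> Lp M q" by (simp add: monotone_op_def)
  fix z w assume zw: "z \<in> graph A" "w \<in> graph A"
  then have "z \<in> \<Z>" "w \<in> \<Z>" by (auto simp: graph_def)
  moreover have "0 \<le> Lp_pairing M (Lp_diff M q (Lp_class M q (snd z)) (Lp_class M q (snd w)))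
      (Lp_diff M p (Lp_class M p (fst z)) (Lp_class M p (fst w)))"
    using A zw by (auto simp: monotone_op_def graph_def)
  ultimately show "0 \<le> \<beta> (z - w) (z - w)" by (simp add: pairing_diff_class)
next
  assume *: "A \<subseteq> Lp M p \<times> Lp M q \<and> (\<forall>z\<in>graph A. \<forall>w\<in>graph A. 0 \<le> \<beta> (z - w) (z - w))"
  have "0 \<le> Lp_pairing M (Lp_diff M q V W) (Lp_diff M p X Y)" if "(X, V) \<in> A" "(Y, W) \<in> A" for X V Y W
  proof -
    note x = graph_rep[OF that(1) conjunct1[OF *]] and y = graph_rep[OF that(2) conjunct1[OF *]]
    have "(Lp_rep X, Lp_rep V) \<in> \<Z>" "(Lp_rep Y, Lp_rep W) \<in> \<Z>" using x(1) y(1) by (auto simp: graph_def)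
    note eq = pairing_diff_class[OF this, unfolded fst_conv snd_conv x(2,3) y(2,3)]
    have "0 \<le> \<beta> ((Lp_rep X, Lp_rep V) - (Lp_rep Y, Lp_rep W)) ((Lp_rep X, Lp_rep V) - (Lp_rep Y, Lp_rep W))"
      using * x(1) y(1) by blast
    then show ?thesis unfolding eq by simp
  qed
  with * show "monotone_op M p q A" by (auto simp: monotone_op_def)
qed

lemma joint_law_rep:
  assumes "z \<in> \<Z>"
  shows "joint_law M (Lp_class M p (fst z)) (Lp_class M q (snd z)) = law z"
proof -
  have "fst z \<in> \<X>" "snd z \<in> \<V>" using assms by auto
  from joint_law_eq[OF Lp_class_mem[OF this(1)] Lp_class_mem[OF this(2)]] show ?thesis by (simp add: law_def)
qed

lemma mp_invariant_if_law_invariant: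
  fixes A :: "('w, 'a) Lp_operator"
  assumes A: "A \<subseteq> Lp M p \<times> Lp M q" and law: "law_invariant M p q A"
  shows "mp_invariant M p q A"
proof -
  have "(Lp_comp M p X g, Lp_comp M q V g) \<in> A" if XV: "(X, V) \<in> A" and g: "g \<in> mp_maps M" for X V g
  proof -
    define z where "z = (Lp_rep X, Lp_rep V)"
    have z: "z \<in> \<Z>" "X = Lp_class M p (fst z)" "V = Lp_class M q (snd z)"
      using graph_rep[OF XV A] by (auto simp: z_def graph_def)
    have eq: "Lp_comp M p X g = Lp_class M p (fst (rearrange z g))" "Lp_comp M q V g = Lp_class M q (snd (rearrange z g))"
      unfolding z(2,3) rearrange_def fst_conv snd_conv by (intro Lp_comp_class ZD z(1) g)+
    have "same_law z (rearrange z g)" by (rule same_law_rearrange[OF z(1) g])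
    then have "joint_law M X V = joint_law M (Lp_comp M p X g) (Lp_comp M q V g)"
      unfolding eq using joint_law_rep z by (simp add: same_law_def)
    moreover have "Lp_comp M p X g \<in> Lp M p" "Lp_comp M q V g \<in> Lp M q"
      using rearrange_Z[OF z(1) g] by (auto simp: eq intro!: Lp_class_mem)
    ultimately show ?thesis using law XV unfolding law_invariant_def by blast
  qed
  then show ?thesis by (auto simp: mp_invariant_def)
qed

context
  fixes A :: "('w, 'a) Lp_operator"
  assumes mono: "monotone_op M p q A" and inv: "mp_invariant M p q A" and A_ne: "A \<noteq> {}"
begin

text \<open>The functions whose classes may occur in the domain of the extension.\<close>

definition K :: "('w \<Rightarrow> 'a) set" where
  "K = {f \<in> \<X>. Lp_class M p f \<in> Lp_closed_convex_hull M p (Domain A)}"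

lemma A_sub: "A \<subseteq> Lp M p \<times> Lp M q" using mono by (simp add: monotone_op_def)

lemma D_sub: "Domain A \<subseteq> Lp M p" using A_sub by auto

lemma K_X: "K \<subseteq> \<X>" by (auto simp: K_def)

lemma graph_nonempty:
  obtains z where "z \<in> graph A"
proof -
  obtain X V where "(X, V) \<in> A" using A_ne by auto
  from graph_rep(1)[OF this A_sub] show ?thesis by (rule that)
qed

lemma graph_fst_K:
  assumes "z \<in> graph A" shows "fst z \<in> K"
proof -
  have "z \<in> \<Z>" "Lp_class M p (fst z) \<in> Domain A" using assms by (auto simp: graph_def)
  then show ?thesis using closed_convex_hull_subset[OF s _ D_sub] p by (auto simp: K_def)
qed

lemma K_convex: "convex K"
proof (rule convexI)
  fix f g and a b :: real assume "f \<in> K" "g \<in> K" "0 \<le> a" "0 \<le> b" "a + b = 1"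
  then have "Lp_class M p (\<lambda>\<omega>. a *\<^sub>R f \<omega> + b *\<^sub>R g \<omega>) \<in> Lp_closed_convex_hull M p (Domain A)"
    using p by (intro closed_convex_hull_lincomb[OF s _ D_sub]) (auto simp: K_def)
  moreover have "a *\<^sub>R f + b *\<^sub>R g \<in> \<X>"
    using \<open>f \<in> K\<close> \<open>g \<in> K\<close> subspace_X by (auto simp: K_def intro: subspace_add subspace_scale)
  ultimately show "a *\<^sub>R f + b *\<^sub>R g \<in> K" by (simp add: K_def plus_fun_def scaleR_fun_def)
qed

lemma K_separation:
  assumes f: "f \<in> \<X>" "f \<notin> K"
  shows "\<exists>v\<in>\<V>. \<exists>\<sigma>. (\<forall>g\<in>K. pairing v g \<le> \<sigma>) \<and> \<sigma> < pairing v f"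
proof -
  have "Lp_class M p f \<notin> Lp_closed_convex_hull M p (Domain A)" using f by (simp add: K_def)
  then obtain d where d: "d > 0" "\<And>g. g \<in> K \<Longrightarrow> d \<le> Lp_energy M p (\<lambda>\<omega>. g \<omega> - f \<omega>)"
    using closed_convex_hull_energy_gap[OF s _ D_sub f(1)] p by (auto simp: K_def)
  moreover have "g - f = (\<lambda>\<omega>. g \<omega> - f \<omega>)" for g by (simp add: fun_eq_iff)
  moreover have "K \<noteq> {}" using graph_nonempty graph_fst_K by blast
  ultimately show ?thesis by (intro separation[OF K_X _ K_convex f(1)]) auto
qed

lemma graph_rearrange:
  assumes z: "z \<in> graph A" and g: "g \<in> mp_maps M"
  shows "rearrange z g \<in> graph A"
proof -
  have zZ: "z \<in> \<Z>" using z by (simp add: graph_def)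
  have "(Lp_comp M p (Lp_class M p (fst z)) g, Lp_comp M q (Lp_class M q (snd z)) g) \<in> A"
    using z g inv unfolding graph_def mp_invariant_def by blast
  then show ?thesis
    using rearrange_Z[OF zZ g] Lp_comp_class[OF ZD(1)[OF zZ] g] Lp_comp_class[OF ZD(2)[OF zZ] g]
    by (simp add: graph_def rearrange_def)
qed

text \<open>Functions with the law of \<open>fst z\<close> are limits of rearrangements of \<open>fst z\<close>, which stay in the hull.\<close>

lemma K_same_law:
  assumes zw: "same_law z w" and z: "fst z \<in> K" shows "fst w \<in> K"
proof -
  have zZ: "z \<in> \<Z>" "w \<in> \<Z>" using zw by (auto simp: same_law_def)
  have "\<exists>g. g \<in> mp_maps M \<and> (AE \<omega> in M. dist (fst (rearrange z g) \<omega>) (fst w \<omega>) < 1 / real (Suc n))" for n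
  proof -
    have "1 / real (Suc n) > 0" by simp
    from same_law_approx[OF zw this] obtain g where g: "g \<in> mp_maps M"
      "AE \<omega> in M. dist (fst (rearrange z g) \<omega>) (fst w \<omega>) < 1 / real (Suc n) \<and> dist (snd (rearrange z g) \<omega>) (snd w \<omega>) < 1 / real (Suc n)"
      by blast
    from g(2) have "AE \<omega> in M. dist (fst (rearrange z g) \<omega>) (fst w \<omega>) < 1 / real (Suc n)"
      by eventually_elim simp
    with g(1) show ?thesis by blast
  qed
  then obtain g where g: "\<And>n. g n \<in> mp_maps M"
    "\<And>n. AE \<omega> in M. dist (fst (rearrange z (g n)) \<omega>) (fst w \<omega>) < 1 / real (Suc n)"
    by metis
  define f where "f n = fst (rearrange z (g n))" for n
  have f: "f n \<in> \<X>" for n unfolding f_def by (rule ZD(1)[OF rearrange_Z[OF zZ(1) g(1)]])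
  have "Lp_comp M p X h \<in> Domain A" if "X \<in> Domain A" "h \<in> mp_maps M" for X h
    using inv that unfolding mp_invariant_def by fastforce
  then have fC: "Lp_class M p (f n) \<in> Lp_closed_convex_hull M p (Domain A)" for n
    using closed_convex_hull_comp[OF s _ D_sub g(1)[of n], of "Lp_class M p (fst z)"] p z g(1)[of n]
      Lp_comp_class[OF _ g(1)[of n], of "fst z" p]
    by (auto simp: K_def f_def rearrange_def)
  have "(\<lambda>n. Lp_energy M p (\<lambda>\<omega>. f n \<omega> - fst w \<omega>)) \<longlonglongrightarrow> 0"
  proof (rule tendsto_sandwich[OF _ _ tendsto_const])
    show "\<forall>\<^sub>F n in sequentially. 0 \<le> Lp_energy M p (\<lambda>\<omega>. f n \<omega> - fst w \<omega>)"
      using p by (intro always_eventually allI Lp_energy_nonneg) auto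
    have "Lp_energy M p (\<lambda>\<omega>. f n \<omega> - fst w \<omega>) \<le> (1 / real (Suc n)) powr p / p" for n
    proof -
      have fd: "(\<lambda>\<omega>. f n \<omega> - fst w \<omega>) \<in> \<X>"
        using Lp_fun_diff[OF s _ f, of "fst w"] zZ p by auto
      have "(\<integral>\<omega>. norm (f n \<omega> - fst w \<omega>) powr p \<partial>M) \<le> (\<integral>\<omega>. (1 / real (Suc n)) powr p \<partial>M)"
      proof (rule integral_mono_AE[OF Lp_funD(2)[OF fd]])
        show "AE \<omega> in M. norm (f n \<omega> - fst w \<omega>) powr p \<le> (1 / real (Suc n)) powr p"
          using g(2)[of n]
        proof eventually_elim
          case (elim \<omega>)
          then show ?case using p by (intro powr_mono2) (auto simp: f_def dist_norm)
        qed
      qed simp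
      then show ?thesis using p by (simp add: Lp_energy_def prob_space divide_right_mono)
    qed
    then show "\<forall>\<^sub>F n in sequentially. Lp_energy M p (\<lambda>\<omega>. f n \<omega> - fst w \<omega>) \<le> (1 / real (Suc n)) powr p / p"
      by (intro always_eventually allI)
    have "(\<lambda>n. (1 / real (Suc n)) powr p / p) \<longlonglongrightarrow> 0 powr p / p"
      using p by (intro tendsto_divide tendsto_powr' tendsto_const LIMSEQ_Suc[OF lim_1_over_n]) auto
    then show "(\<lambda>n. (1 / real (Suc n)) powr p / p) \<longlonglongrightarrow> 0" by simp
  qed
  then have "Lp_class M p (fst w) \<in> Lp_closed_convex_hull M p (Domain A)"
    using p zZ by (intro closed_convex_hull_limit[OF s _ D_sub f fC]) auto
  then show ?thesis using zZ by (auto simp: K_def)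
qed

text \<open>Monotonicity survives the passage from \<open>A\<close> to all pairs that share their law with an element
of \<open>A\<close>, because these are limits of rearrangements. This makes the starting set for Zorn's lemma
invariant under equality of laws.\<close>

lemma graph_law_monotone:
  assumes z: "z \<in> graph A" "same_law z z'" and w: "w \<in> graph A" "same_law w w'"
  shows "\<beta> z' w' \<le> \<beta> z' z' / 2 + \<beta> w' w' / 2"
proof (rule field_le_epsilon)
  fix \<epsilon> :: real assume \<epsilon>: "0 < \<epsilon>"
  define n where "n = norm1 w' + norm1 z + 1"
  have n: "n > 0" "norm1 w' + norm1 z \<le> n" using norm1_nonneg[of w'] norm1_nonneg[of z] by (auto simp: n_def)
  define e where "e = \<epsilon> / n"
  have e: "e > 0" using \<epsilon> n by (simp add: e_def)
  have "e * (norm1 w' + norm1 z) \<le> e * n" using n e by (intro mult_left_mono) auto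
  also have "e * n = \<epsilon>" using n by (simp add: e_def)
  finally have en: "e * norm1 w' + e * norm1 z \<le> \<epsilon>" by (simp add: distrib_left)
  have Z: "z \<in> \<Z>" "z' \<in> \<Z>" "w \<in> \<Z>" "w' \<in> \<Z>" using z w by (auto simp: same_law_def)
  obtain g where g: "g \<in> mp_maps M" "AE \<omega> in M. dist (fst (rearrange z g) \<omega>) (fst z' \<omega>) < e \<and> dist (snd (rearrange z g) \<omega>) (snd z' \<omega>) < e"
    by (rule same_law_approx[OF z(2) e]) blast
  obtain h where h: "h \<in> mp_maps M" "AE \<omega> in M. dist (fst (rearrange w h) \<omega>) (fst w' \<omega>) < e \<and> dist (snd (rearrange w h) \<omega>) (snd w' \<omega>) < e"
    by (rule same_law_approx[OF w(2) e]) blast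
  let ?z = "rearrange z g" and ?w = "rearrange w h"
  have zw: "?z \<in> graph A" "?w \<in> graph A" by (intro graph_rearrange z w g h)+
  have ZZ: "?z \<in> \<Z>" "?w \<in> \<Z>" by (intro rearrange_Z Z g h)+
  have "\<bar>\<beta> ?z w' - \<beta> z' w'\<bar> \<le> e * norm1 w'" by (rule \<beta>_perturb[OF ZZ(1) Z(2) Z(4) g(2)])
  moreover have "\<bar>\<beta> ?w ?z - \<beta> w' ?z\<bar> \<le> e * norm1 z"
    using \<beta>_perturb[OF ZZ(2) Z(4) ZZ(1) h(2)] unfolding norm1_rearrange[OF Z(1) g(1)] .
  moreover have "\<beta> ?z w' = \<beta> w' ?z" "\<beta> ?w ?z = \<beta> ?z ?w" by (rule \<beta>_sym)+
  moreover have "0 \<le> \<beta> (?z - ?w) (?z - ?w)" using mono zw monotone_op_iff by blast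
  then have "2 * \<beta> ?z ?w \<le> \<beta> ?z ?z + \<beta> ?w ?w" using \<beta>_diff_self[OF ZZ] by simp
  moreover have "\<beta> ?z ?z = \<beta> z' z'" "\<beta> ?w ?w = \<beta> w' w'"
    using \<beta>_rearrange[OF Z(1) Z(1) g(1)] \<beta>_rearrange[OF Z(3) Z(3) h(1)] \<beta>_same_law[OF z(2)] \<beta>_same_law[OF w(2)] by auto
  ultimately show "\<beta> z' w' \<le> \<beta> z' z' / 2 + \<beta> w' w' / 2 + \<epsilon>" using en by linarith
qed

theorem maximal_law_invariant_extension:
  "\<exists>B. A \<subseteq> B \<and> maximal_monotone_op M p q B \<and> law_invariant M p q B
     \<and> Domain B \<subseteq> Lp_closed_convex_hull M p (Domain A)"
proof -
  define W where "W = {z \<in> \<Z>. fst z \<in> K}"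
  define H0 where "H0 = {(w, \<beta> w w / 2) |w. \<exists>z\<in>graph A. same_law z w}"
  have W_law: "w \<in> W" if "z \<in> W" "same_law z w" for z w
    using that K_same_law[OF that(2)] by (auto simp: W_def same_law_def)
  obtain H where H: "H0 \<subseteq> H" "H \<subseteq> W \<times> UNIV"
    and H_clique: "\<And>z a w b. (z, a) \<in> H \<Longrightarrow> (w, b) \<in> H \<Longrightarrow> \<beta> z w \<le> a + b"
    and H_inv: "\<And>z a w. (z, a) \<in> H \<Longrightarrow> same_law z w \<Longrightarrow> (w, a) \<in> H"
    and H_max: "\<And>z a. z \<in> W \<Longrightarrow> (\<And>w b. (w, b) \<in> H \<Longrightarrow> \<beta> z w \<le> a + b) \<Longrightarrow> (z, a) \<in> H"
  proof (rule maximal_invariant_clique[where R = same_law and W = W and \<beta> = \<beta> and ?H0.0 = H0])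
    show "\<beta> z w = \<beta> w z" for z w by (rule \<beta>_sym)
    show "same_law z z" if "z \<in> W" for z using that by (auto simp: W_def intro: same_law_refl)
    show "same_law w z" if "same_law z w" for z w by (rule same_law_sym[OF that])
    show "same_law x z" if "same_law x y" "same_law y z" for x y z by (rule same_law_trans[OF that])
    show "w \<in> W" if "z \<in> W" "same_law z w" for z w by (rule W_law[OF that])
    show "\<exists>K. \<forall>x y. same_law z x \<longrightarrow> same_law z y \<longrightarrow> \<beta> x y \<le> K" for z
      using same_law_bounded by blast
    show "\<exists>w'. same_law w w' \<and> \<beta> z w \<le> \<beta> z' w' + e"
      if "same_law z z'" "w \<in> W" "e > 0" for z z' w e
      using that by (intro same_law_transfer) (auto simp: W_def)
    show "H0 \<subseteq> W \<times> UNIV"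
      using graph_fst_K K_same_law by (fastforce simp: H0_def W_def same_law_def)
    show "\<beta> z w \<le> a + b" if "(z, a) \<in> H0" "(w, b) \<in> H0" for z a w b
    proof -
      from that obtain x y where x: "x \<in> graph A" "same_law x z" and y: "y \<in> graph A" "same_law y w"
        and ab: "a = \<beta> z z / 2" "b = \<beta> w w / 2" unfolding H0_def by blast
      show ?thesis unfolding ab by (rule graph_law_monotone[OF x y])
    qed
    show "(w, a) \<in> H0" if "(z, a) \<in> H0" "same_law z w" for z a w
    proof -
      from that(1) obtain x where "x \<in> graph A" "same_law x z" "a = \<beta> z z / 2" unfolding H0_def by blast
      moreover from this have "same_law x w" "a = \<beta> w w / 2"
        using same_law_trans[OF _ that(2)] \<beta>_same_law[OF that(2)] by auto
      ultimately show ?thesis unfolding H0_def by blast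
    qed
  qed blast
  have WZ: "z \<in> \<Z>" "fst z \<in> K" if "(z, a) \<in> H" for z a using that H(2) by (auto simp: W_def)
  obtain z1 where "z1 \<in> graph A" by (rule graph_nonempty)
  moreover from this have "same_law z1 z1" by (intro same_law_refl) (simp add: graph_def)
  ultimately have "(z1, \<beta> z1 z1 / 2) \<in> H0" unfolding H0_def by blast
  then obtain b1 where z1: "(z1, b1) \<in> H" using H(1) by blast
  have H_maxZ: "(z, a) \<in> H" if z: "z \<in> \<Z>" and rel: "\<And>w b. (w, b) \<in> H \<Longrightarrow> \<beta> z w \<le> a + b" for z a
  proof (cases "fst z \<in> K")
    case True
    then show ?thesis using z rel by (intro H_max) (auto simp: W_def)
  next
    case False
    then obtain v \<sigma> where v: "v \<in> \<V>" "\<And>f. f \<in> K \<Longrightarrow> pairing v f \<le> \<sigma>" "\<sigma> < pairing v (fst z)"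
      using K_separation[OF ZD(1)[OF z] False] by blast
    \<comment> \<open>moving \<open>z1\<close> in the normal direction \<open>v\<close> costs at most \<open>\<sigma>\<close> per unit, but gains \<open>pairing v (fst z)\<close> at \<open>z\<close>\<close>
    define shift where "shift r = z1 + r *\<^sub>R (0, v)" for r
    have 0: "(0, v) \<in> \<Z>" using v(1) subspace_0[OF subspace_X] by simp
    have sZ: "shift r \<in> \<Z>" for r
      unfolding shift_def using WZ(1)[OF z1] 0 by (intro subspace_add[OF subspace_Z] subspace_scale[OF subspace_Z])
    have \<beta>_shift: "\<beta> (shift r) w = \<beta> z1 w + r * pairing v (fst w)" if "w \<in> \<Z>" for r w
    proof -
      have "\<beta> (0, v) w = pairing v (fst w)" by (simp add: \<beta>_def pairing_zero)
      then show ?thesis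
        unfolding shift_def using WZ(1)[OF z1] 0 that subspace_scale[OF subspace_Z 0, of r]
        by (simp add: \<beta>_add \<beta>_scale del: scaleR_Pair)
    qed
    have sH: "(shift r, b1 + r * \<sigma>) \<in> H" if r: "r \<ge> 0" for r
    proof (rule H_max)
      show "shift r \<in> W" using sZ[of r] WZ(2)[OF z1] by (simp add: W_def shift_def)
      fix w b assume w: "(w, b) \<in> H"
      have "r * pairing v (fst w) \<le> r * \<sigma>" using v(2) WZ(2)[OF w] r by (intro mult_left_mono) auto
      then show "\<beta> (shift r) w \<le> b1 + r * \<sigma> + b"
        using H_clique[OF z1 w] \<beta>_shift[OF WZ(1)[OF w]] by simp
    qed
    define r where "r = (\<bar>a + b1 - \<beta> z1 z\<bar> + 1) / (pairing v (fst z) - \<sigma>)"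
    have r: "r \<ge> 0" "r * (pairing v (fst z) - \<sigma>) = \<bar>a + b1 - \<beta> z1 z\<bar> + 1" using v(3) by (auto simp: r_def)
    have "\<beta> z1 z + r * pairing v (fst z) \<le> a + (b1 + r * \<sigma>)"
      using rel[OF sH[OF r(1)]] \<beta>_shift[OF z] \<beta>_sym[of z "shift r"] by simp
    then have False using r(2) by (simp add: algebra_simps)
    then show ?thesis ..
  qed
  define B where "B = {(Lp_class M p (fst z), Lp_class M q (snd z)) |z. (z, \<beta> z z / 2) \<in> H}"
  have class_law: "same_law z w"
    if "z \<in> \<Z>" "w \<in> \<Z>" "Lp_class M p (fst z) = Lp_class M p (fst w)" "Lp_class M q (snd z) = Lp_class M q (snd w)" for z w
    using joint_law_rep[OF that(1)] joint_law_rep[OF that(2)] that by (simp add: same_law_def)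
  have B_iff: "(Lp_class M p (fst z), Lp_class M q (snd z)) \<in> B \<longleftrightarrow> (z, \<beta> z z / 2) \<in> H" if z: "z \<in> \<Z>" for z
  proof
    assume "(Lp_class M p (fst z), Lp_class M q (snd z)) \<in> B"
    then obtain w where w: "(w, \<beta> w w / 2) \<in> H" "Lp_class M p (fst z) = Lp_class M p (fst w)"
      "Lp_class M q (snd z) = Lp_class M q (snd w)" by (auto simp: B_def)
    have "same_law w z" using class_law[OF z WZ(1)[OF w(1)] w(2,3)] by (rule same_law_sym)
    then show "(z, \<beta> z z / 2) \<in> H" using H_inv[OF w(1)] \<beta>_same_law by simp
  next
    assume "(z, \<beta> z z / 2) \<in> H"
    then show "(Lp_class M p (fst z), Lp_class M q (snd z)) \<in> B" unfolding B_def by blast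
  qed
  have B_sub: "B \<subseteq> Lp M p \<times> Lp M q" 
  proof
    fix P assume "P \<in> B"
    then obtain z where z: "P = (Lp_class M p (fst z), Lp_class M q (snd z))" "(z, \<beta> z z / 2) \<in> H"
      unfolding B_def by blast
    show "P \<in> Lp M p \<times> Lp M q"
      unfolding z(1) using WZ(1)[OF z(2)] by (intro SigmaI Lp_class_mem(1) ZD)
  qed
  have graph_B: "z \<in> graph B \<longleftrightarrow> (z, \<beta> z z / 2) \<in> H" for z
    using B_iff[of z] WZ(1)[of z] unfolding graph_def by blast
  have "A \<subseteq> B"
  proof clarify
    fix X V assume XV: "(X, V) \<in> A"
    let ?z = "(Lp_rep X, Lp_rep V)"
    note r = graph_rep[OF XV A_sub]
    have z: "?z \<in> \<Z>" using r(1) by (auto simp: graph_def)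
    have "(?z, \<beta> ?z ?z / 2) \<in> H0" unfolding H0_def using r(1) same_law_refl[OF z] by blast
    then have "(?z, \<beta> ?z ?z / 2) \<in> H" using H(1) by blast
    then show "(X, V) \<in> B" using B_iff[OF z] r(2,3) by simp
  qed
  moreover have "maximal_monotone_op M p q B"
    unfolding maximal_monotone_op_def
  proof (intro conjI allI impI)
    have "0 \<le> \<beta> (z - w) (z - w)" if "(z, \<beta> z z / 2) \<in> H" "(w, \<beta> w w / 2) \<in> H" for z w
      using H_clique[OF that] \<beta>_diff_self[OF WZ(1)[OF that(1)] WZ(1)[OF that(2)]] by simp
    then show "monotone_op M p q B" using B_sub by (simp add: monotone_op_iff graph_B)
    fix B' assume B': "monotone_op M p q B' \<and> B \<subseteq> B'"
    have "(X, V) \<in> B" if XV: "(X, V) \<in> B'" for X V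
    proof -
      let ?z = "(Lp_rep X, Lp_rep V)"
      have B'_sub: "B' \<subseteq> Lp M p \<times> Lp M q" using B' by (simp add: monotone_op_def)
      note r = graph_rep[OF XV B'_sub]
      have z: "?z \<in> \<Z>" using r(1) by (auto simp: graph_def)
      have "(?z, \<beta> ?z ?z / 2) \<in> H"
      proof (rule contact_set_maximal)
        show "H \<subseteq> \<Z> \<times> UNIV" using WZ(1) by auto
        show "H \<noteq> {}" using z1 by blast
        show "0 \<le> \<beta> (w - ?z) (w - ?z)" if "(w, \<beta> w w / 2) \<in> H" for w
        proof -
          have "w \<in> graph B" using that graph_B by simp
          then have "w \<in> graph B'" using B' by (auto simp: graph_def)
          then show ?thesis using B' r(1) monotone_op_iff by blast
        qed
      qed (fact H_clique H_maxZ z)+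
      then show ?thesis using B_iff[OF z] r(2,3) by simp
    qed
    then show "B' = B" using B' by auto
  qed
  moreover have "law_invariant M p q B"
  proof -
    have "(X', V') \<in> B"
      if XV: "(X, V) \<in> B" and X': "X' \<in> Lp M p" "V' \<in> Lp M q" and law: "joint_law M X V = joint_law M X' V'"
      for X V X' V'
    proof -
      obtain z where z: "(z, \<beta> z z / 2) \<in> H" "X = Lp_class M p (fst z)" "V = Lp_class M q (snd z)"
        using XV by (auto simp: B_def)
      let ?w = "(Lp_rep X', Lp_rep V')"
      have w: "?w \<in> \<Z>" "X' = Lp_class M p (fst ?w)" "V' = Lp_class M q (snd ?w)"
        using X' by (auto simp: Lp_class_rep)
      have "same_law z ?w"
        using law z w joint_law_rep[OF w(1)] joint_law_rep[OF WZ(1)[OF z(1)]] WZ(1)[OF z(1)]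
        by (simp add: same_law_def)
      then have "(?w, \<beta> ?w ?w / 2) \<in> H" using H_inv[OF z(1)] \<beta>_same_law by simp
      then show ?thesis using B_iff[OF w(1)] w(2,3) by simp
    qed
    then show ?thesis by (auto simp: law_invariant_def)
  qed
  moreover have "Domain B \<subseteq> Lp_closed_convex_hull M p (Domain A)"
    using WZ(2) by (auto simp: B_def K_def)
  ultimately show ?thesis by blast
qed

end
end

theorem theorem4p5:
  fixes M :: "'w measure"
    and p q :: real
    and A :: "('w, 'a::{banach, second_countable_topology}) Lp_operator"
  assumes "prob_space M" and "standard_borel M" and "nonatomic M"
    and "reflexive_space TYPE('a)"
    and "1 < p" and "1 / p + 1 / q = 1"
    and "A \<noteq> {}"
    and "monotone_op M p q A"
    and "mp_invariant M p q A"
  shows "\<exists>B. A \<subseteq> B \<and> maximal_monotone_op M p q B \<and> mp_invariant M p q B \<and> law_invariant M p q B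
           \<and> Domain B \<subseteq> Lp_closed_convex_hull M p (Domain A)"
proof -
  obtain s :: "nat \<Rightarrow> 'a" where s: "dense_seq s" using dense_seq_exists by blast
  obtain t :: "nat \<Rightarrow> 'a \<Rightarrow>\<^sub>L real" and u :: "nat \<Rightarrow> ('a \<Rightarrow>\<^sub>L real) \<Rightarrow>\<^sub>L real"
    where tu: "dense_seq t" "dense_seq u"
    using reflexive_dense_seq_dual[OF assms(4)] by blast
  interpret prob_space M by fact
  interpret reflexive_Lp M p q s t u by standard (use assms s tu in auto)
  obtain B where B: "A \<subseteq> B" "maximal_monotone_op M p q B" "law_invariant M p q B"
    "Domain B \<subseteq> Lp_closed_convex_hull M p (Domain A)"
    using maximal_law_invariant_extension[OF assms(8,9,7)] by blast
  have "B \<subseteq> Lp M p \<times> Lp M q" using B(2) by (auto simp: maximal_monotone_op_def monotone_op_def)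
  from mp_invariant_if_law_invariant[OF this B(3)] B show ?thesis by blast
qed

end
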